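(* Let $\mathbb{K}$ be an algebraically closed field of characteristic zero. Let $$X=\mathbb{V}\left(T_{01}^2T_{02}^{2m_{02}}\cdots T_{0n_0}^{2m_{0n_0}}+T_{11}^2\cdots T_{1k_1}^2\,T_{1,k_1+1}^{2m_{1,k_1+1}}\cdots T_{1n_1}^{2m_{1n_1}}+T_{21}^{l_{21}}\cdots T_{2n_2}^{l_{2n_2}}\right)\subset\mathbb{K}^{n_0+n_1+n_2},$$ where $n_0\ge 2$, $1\le k_1\le n_1$, $n_2\ge 1$, all $m_{jk}$ occurring in the equation are integers $\ge 2$, all $l_{2i}$ are integers $\ge 2$, and $\{l_{21},\ldots,l_{2n_2}\}\neq\{2,2a_1,\ldots,2a_{n_2-1}\}$ for all positive integers $a_1,\ldots,a_{n_2-1}$ (that is, it is not the case that $l_{21},\ldots,l_{2n_2}$ are all even and at least one of them equals $2$). Then 1) $\mathrm{ML}(X)\supset\mathbb{K}[T_{02},\ldots,T_{0n_0}]$. 2) If $k_1=1$, then (a) $\mathrm{ML}(X)=\mathbb{K}[T_{02},\ldots,T_{0n_0},T_{12},\ldots,T_{1n_1}]$, and (b) generic $\mathrm{SAut}(X)$-orbits can be separated by $\mathrm{ML}(X)$. 3) If $k_1=n_1$, then (a) $\mathrm{ML}(X)=\mathbb{K}[T_{02},\ldots,T_{0n_0}]$, and (b) generic $\mathrm{SAut}(X)$-orbits can be separated by $\mathrm{ML}(X)$.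
   Context: The $T_{ij}$ ($i\in\{0,1,2\}$, $1\le j\le n_i$) are the coordinates on $\mathbb{K}^{n_0+n_1+n_2}$, and $\mathbb{V}(g)$ is the zero locus of $g$. A derivation $\partial$ of a commutative $\mathbb{K}$-algebra $A$ is locally nilpotent (an LND) if for every $a\in A$ there is a positive integer $n$ with $\partial^n(a)=0$. The Makar-Limanov invariant $\mathrm{ML}(X)\subset\mathbb{K}[X]$ is the intersection of the kernels of all LNDs of $\mathbb{K}[X]$. $\mathrm{SAut}(X)$ is the subgroup of $\mathrm{Aut}(X)$ generated by all algebraic subgroups isomorphic to the additive group of $\mathbb{K}$ (equivalently, by all $\exp(s\partial)$ with $s\in\mathbb{K}$ and $\partial$ an LND of $\mathbb{K}[X]$). "Generic $\mathrm{SAut}(X)$-orbits can be separated by $\mathrm{ML}(X)$" means: there is a nonempty Zariski open $\mathrm{SAut}(X)$-invariant subset $U\subset X$ such that for any two points $P,Q\in U$ in different $\mathrm{SAut}(X)$-orbits there is $f\in\mathrm{ML}(X)$ with $f(P)\neq f(Q)$. *)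

theory Defs
  imports
    "HOL-Algebra.Bij"
    "HOL-Algebra.Generated_Groups"
    "HOL-Algebra.Group_Action"
    "HOL-Computational_Algebra.Polynomial"
begin

section \<open>Polynomial functions and coordinate rings\<close>

text \<open>The subalgebra generated by a set \<open>C\<close> of functions inside the algebra of all functions
  with values in the ground field.\<close>

inductive_set subalgebra_gen :: "('p \<Rightarrow> 'k) set \<Rightarrow> ('p \<Rightarrow> 'k :: field) set"
  for C :: "('p \<Rightarrow> 'k) set"
where
  const: "(\<lambda>_. c) \<in> subalgebra_gen C"
| gen: "f \<in> C \<Longrightarrow> f \<in> subalgebra_gen C"
| add: "f \<in> subalgebra_gen C \<Longrightarrow> g \<in> subalgebra_gen C \<Longrightarrow> (\<lambda>x. f x + g x) \<in> subalgebra_gen C"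
| mult: "f \<in> subalgebra_gen C \<Longrightarrow> g \<in> subalgebra_gen C \<Longrightarrow> (\<lambda>x. f x * g x) \<in> subalgebra_gen C"

text \<open>The affine space with coordinates indexed by a finite set \<open>I\<close>.\<close>

definition affine_space :: "'i set \<Rightarrow> ('i \<Rightarrow> 'k) set" where
  "affine_space I = (I \<rightarrow>\<^sub>E UNIV)"

definition coordinates :: "'i set \<Rightarrow> (('i \<Rightarrow> 'k) \<Rightarrow> 'k :: field) set" where
  "coordinates J = (\<lambda>j x. x j) ` J"

definition zero_locus :: "'i set \<Rightarrow> (('i \<Rightarrow> 'k) \<Rightarrow> 'k :: field) \<Rightarrow> ('i \<Rightarrow> 'k) set" where
  "zero_locus I g = {x \<in> affine_space I. g x = 0}"

text \<open>For \<open>X\<close> closed in \<open>affine_space I\<close> and \<open>J \<subseteq> I\<close>, \<open>coordinate_subring X J\<close> is the subalgebra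
  of \<open>\<bbbK>[X]\<close> generated by the restrictions to \<open>X\<close> of the coordinates with index in \<open>J\<close>; for \<open>J = I\<close>
  it is \<open>\<bbbK>[X]\<close> itself. Elements of \<open>\<bbbK>[X]\<close> are functions on \<open>X\<close>; they are made total
  by the value \<open>0\<close> outside \<open>X\<close>, which is compatible with pointwise addition, multiplication and
  scaling. The unit of \<open>\<bbbK>[X]\<close> is therefore the indicator function of \<open>X\<close>.\<close>

definition coordinate_subring ::
    "('i \<Rightarrow> 'k) set \<Rightarrow> 'i set \<Rightarrow> (('i \<Rightarrow> 'k) \<Rightarrow> 'k :: field) set" where
  "coordinate_subring X J =
     {(\<lambda>x. if x \<in> X then p x else 0) | p. p \<in> subalgebra_gen (coordinates J)}"


section \<open>Locally nilpotent derivations and the Makar-Limanov invariant\<close>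

text \<open>Here \<open>A\<close> is an algebra of functions with pointwise operations.\<close>

definition derivation ::
    "('p \<Rightarrow> 'k :: field) set \<Rightarrow> (('p \<Rightarrow> 'k) \<Rightarrow> ('p \<Rightarrow> 'k)) \<Rightarrow> bool" where
  "derivation A D \<longleftrightarrow>
     D \<in> A \<rightarrow> A \<and>
     (\<forall>f\<in>A. \<forall>g\<in>A. D (\<lambda>x. f x + g x) = (\<lambda>x. D f x + D g x)) \<and>
     (\<forall>c. \<forall>f\<in>A. D (\<lambda>x. c * f x) = (\<lambda>x. c * D f x)) \<and>
     (\<forall>f\<in>A. \<forall>g\<in>A. D (\<lambda>x. f x * g x) = (\<lambda>x. f x * D g x + D f x * g x))"

definition locally_nilpotent_derivation ::
    "('p \<Rightarrow> 'k :: field) set \<Rightarrow> (('p \<Rightarrow> 'k) \<Rightarrow> ('p \<Rightarrow> 'k)) \<Rightarrow> bool" where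
  "locally_nilpotent_derivation A D \<longleftrightarrow>
     derivation A D \<and> (\<forall>f\<in>A. \<exists>n>0. (D ^^ n) f = (\<lambda>_. 0))"

definition makar_limanov :: "'i set \<Rightarrow> ('i \<Rightarrow> 'k) set \<Rightarrow> (('i \<Rightarrow> 'k) \<Rightarrow> 'k :: field) set" where
  "makar_limanov I X = {f \<in> coordinate_subring X I.
     \<forall>D. locally_nilpotent_derivation (coordinate_subring X I) D \<longrightarrow> D f = (\<lambda>_. 0)}"


section \<open>Automorphisms\<close>

text \<open>Maps from a set \<open>S\<close>, whose polynomial functions are generated by \<open>C\<close>, to the affine space
  over \<open>I\<close> that are given by polynomials.\<close>

definition polynomial_map_on ::
    "'p set \<Rightarrow> ('p \<Rightarrow> 'k) set \<Rightarrow> 'i set \<Rightarrow> ('p \<Rightarrow> 'i \<Rightarrow> 'k :: field) \<Rightarrow> bool" where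
  "polynomial_map_on S C I \<phi> \<longleftrightarrow>
     (\<forall>i\<in>I. \<exists>p \<in> subalgebra_gen C. \<forall>x\<in>S. \<phi> x i = p x)"

definition automorphisms ::
    "'i set \<Rightarrow> ('i \<Rightarrow> 'k) set \<Rightarrow> (('i \<Rightarrow> 'k) \<Rightarrow> ('i \<Rightarrow> 'k :: field)) set" where
  "automorphisms I X = {\<alpha> \<in> Bij X.
     polynomial_map_on X (coordinates I) I \<alpha> \<and>
     polynomial_map_on X (coordinates I) I (inv_into X \<alpha>)}"

definition Aut_group ::
    "'i set \<Rightarrow> ('i \<Rightarrow> 'k) set \<Rightarrow> (('i \<Rightarrow> 'k) \<Rightarrow> ('i \<Rightarrow> 'k :: field)) monoid" where
  "Aut_group I X = BijGroup X \<lparr>carrier := automorphisms I X\<rparr>"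

definition additive_group :: "'k :: field monoid" where
  "additive_group = \<lparr>carrier = UNIV, monoid.mult = (+), one = 0\<rparr>"

text \<open>A subgroup \<open>H\<close> of \<open>Aut(X)\<close> is an algebraic subgroup isomorphic to \<open>\<bbbG>\<^sub>a\<close> if there is
  a group isomorphism \<open>\<phi>\<close> from the additive group of \<open>\<bbbK>\<close> onto \<open>H\<close> for which the action map
  \<open>(s, x) \<mapsto> \<phi> s x\<close> is a morphism \<open>\<bbbK> \<times> X \<rightarrow> X\<close>. The polynomial functions on \<open>\<bbbK> \<times> X\<close>
  are generated by the coordinate \<open>s\<close> and the coordinates of \<open>x\<close>.\<close>

definition Ga_subgroup ::
    "'i set \<Rightarrow> ('i \<Rightarrow> 'k) set \<Rightarrow> (('i \<Rightarrow> 'k) \<Rightarrow> ('i \<Rightarrow> 'k :: field)) set \<Rightarrow> bool" where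
  "Ga_subgroup I X H \<longleftrightarrow>
     subgroup H (Aut_group I X) \<and>
     (\<exists>\<phi> \<in> iso (additive_group :: 'k monoid) (Aut_group I X \<lparr>carrier := H\<rparr>).
        polynomial_map_on (UNIV \<times> X) (insert fst ((\<lambda>f. f \<circ> snd) ` coordinates I)) I
          (\<lambda>(s, x). \<phi> s x))"

definition SAut ::
    "'i set \<Rightarrow> ('i \<Rightarrow> 'k) set \<Rightarrow> (('i \<Rightarrow> 'k) \<Rightarrow> ('i \<Rightarrow> 'k :: field)) set" where
  "SAut I X = generate (Aut_group I X) (\<Union> {H. Ga_subgroup I X H})"

definition SAut_orbit ::
    "'i set \<Rightarrow> ('i \<Rightarrow> 'k) set \<Rightarrow> ('i \<Rightarrow> 'k) \<Rightarrow> ('i \<Rightarrow> 'k :: field) set" where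
  "SAut_orbit I X = orbit (Aut_group I X \<lparr>carrier := SAut I X\<rparr>) (\<lambda>\<alpha>. \<alpha>)"


section \<open>Separation of generic orbits\<close>

definition zariski_open ::
    "'i set \<Rightarrow> ('i \<Rightarrow> 'k) set \<Rightarrow> ('i \<Rightarrow> 'k :: field) set \<Rightarrow> bool" where
  "zariski_open I X U \<longleftrightarrow> U \<subseteq> X \<and>
     (\<exists>F \<subseteq> coordinate_subring X I. X - U = {x \<in> X. \<forall>f\<in>F. f x = 0})"

definition generic_orbits_separated :: "'i set \<Rightarrow> ('i \<Rightarrow> 'k :: field) set \<Rightarrow> bool" where
  "generic_orbits_separated I X \<longleftrightarrow>
     (\<exists>U. zariski_open I X U \<and> U \<noteq> {} \<and> (\<forall>\<alpha> \<in> SAut I X. \<alpha> ` U = U) \<and>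
        (\<forall>P\<in>U. \<forall>Q\<in>U. SAut_orbit I X P \<noteq> SAut_orbit I X Q \<longrightarrow> (\<exists>f \<in> makar_limanov I X. f P \<noteq> f Q)))"

end

theory Submission
  imports Defs "HOL-Library.Function_Algebras"
begin

text \<open>Write the equation as \<open>A\<^sup>2 + B\<^sup>2 + P = 0\<close> with \<open>A = T\<^sub>0\<^sub>1 u\<close>.

  Invariance of \<open>T\<^sub>t\<close> (\<open>t = 0j\<close>, \<open>j \<ge> 2\<close>). Give \<open>T\<^sub>t\<close> degree \<open>1\<close> and \<open>T\<^sub>0\<^sub>1\<close> the degree that makes \<open>A\<close>
  homogeneous of degree \<open>0\<close>. If an LND moves \<open>T\<^sub>t\<close>, its lowest homogeneous component is a nonzero LND of
  negative degree, and therefore kills \<open>T\<^sub>0\<^sub>1\<close>. For an LND \<open>D\<close> killing \<open>T\<^sub>0\<^sub>1\<close> a Mason-Stothers estimate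
  for \<open>V = D(A) B - A D(B)\<close>, in terms of the degree function of \<open>D\<close>, gives a contradiction if all exponents
  in \<open>P\<close> are at least \<open>4\<close>, or if some linear form in \<open>A\<close>, \<open>B\<close> lies in the kernel. If some exponent in
  \<open>P\<close> is odd, make \<open>D\<close> homogeneous for the finest grading; then homogeneous elements are monomials times
  products of linear forms in \<open>A\<close> and \<open>B\<close>, so the kernel would be spanned by monomials in the killed
  variables. With \<open>n = deg A = deg B\<close> this forces \<open>D\<^sup>n(B) A = D\<^sup>n(A) B\<close>, which is absurd.

  Conversely, since \<open>(A + \<iota> B) (A - \<iota> B) = - P\<close> for \<open>\<iota>\<^sup>2 = - 1\<close>, there are explicit additive actions fixing
  \<open>A + \<iota> B\<close> or \<open>A - \<iota> B\<close>. They act transitively on the generic part of the fibres of the map given by the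
  invariant coordinates. A torus contracts such a fibre to a section, so every invariant function is a
  polynomial in these coordinates.\<close>

section \<open>Polynomial functions\<close>

text \<open>The Mason-Stothers estimate needs a factor of \<open>P\<close> of degree at least 3/4 of
  deg \<open>P\<close> that divides the Wronskian, and exponent 4 is where this starts:
  \<open>B\<close> may consist of coordinates of exponent one and then contributes nothing, and
  \<open>A\<close> contributes half its degree only once its one coordinate of exponent one is
  killed. This is why every derivation is first degenerated to one that kills
  \<open>T\<^sub>0\<^sub>1\<close>.

  The hypothesis on the exponents of \<open>P\<close> says that all are at least 4 or one is odd. An
  odd exponent excludes a square root of \<open>P\<close>; if all were even, such a root would have
  the same weight as \<open>A\<close> and \<open>B\<close>, and homogeneous elements would involve
  forms in three quantities, which need not split into linear factors.

  If only one coordinate of block 1 has exponent one in \<open>B\<close>, the blocks 0 and 1 can be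
  exchanged, which gives the invariance of the other coordinates of block 1.

  Since elements of K[X] are functions, facts about the ideal of \<open>X\<close> (its generator,
  primality, homogeneity) are obtained by evaluation: at roots of the equation, along a rational
  parametrization, and along torus orbits.\<close>

lemma subalgebra_gen_uminus: "f \<in> subalgebra_gen C \<Longrightarrow> (\<lambda>x. - f x) \<in> subalgebra_gen C"
  using subalgebra_gen.mult[OF subalgebra_gen.const[of "-1" C], of f] by simp

lemma subalgebra_gen_diff:
  "f \<in> subalgebra_gen C \<Longrightarrow> g \<in> subalgebra_gen C \<Longrightarrow> (\<lambda>x. f x - g x) \<in> subalgebra_gen C"
  using subalgebra_gen.add[OF _ subalgebra_gen_uminus, of f C g] by simp

lemma subalgebra_gen_sum:
  "(\<And>i. i \<in> S \<Longrightarrow> f i \<in> subalgebra_gen C) \<Longrightarrow> (\<lambda>x. \<Sum>i\<in>S. f i x) \<in> subalgebra_gen C"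
proof (induction S rule: infinite_finite_induct)
  case (insert a S)
  then show ?case using subalgebra_gen.add[of "f a" C "\<lambda>x. \<Sum>i\<in>S. f i x"] by simp
qed (auto simp: subalgebra_gen.const)

lemma subalgebra_gen_prod:
  "(\<And>i. i \<in> S \<Longrightarrow> f i \<in> subalgebra_gen C) \<Longrightarrow> (\<lambda>x. \<Prod>i\<in>S. f i x) \<in> subalgebra_gen C"
proof (induction S rule: infinite_finite_induct)
  case (insert a S)
  then show ?case using subalgebra_gen.mult[of "f a" C "\<lambda>x. \<Prod>i\<in>S. f i x"] by simp
qed (auto simp: subalgebra_gen.const)

lemma subalgebra_gen_power: "f \<in> subalgebra_gen C \<Longrightarrow> (\<lambda>x. f x ^ n) \<in> subalgebra_gen C"
  using subalgebra_gen_prod[of "{..<n}" "\<lambda>_. f" C] by simp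

lemma subalgebra_gen_coordinate: "i \<in> J \<Longrightarrow> (\<lambda>x. x i) \<in> subalgebra_gen (coordinates J)"
  by (rule subalgebra_gen.gen) (auto simp: coordinates_def)

lemmas subalgebra_gen_intros =
  subalgebra_gen.const subalgebra_gen.add subalgebra_gen.mult subalgebra_gen_uminus
  subalgebra_gen_diff subalgebra_gen_sum subalgebra_gen_prod subalgebra_gen_power

lemma subalgebra_gen_subst:
  assumes "f \<in> subalgebra_gen (coordinates I)"
    and "\<And>i. i \<in> I \<Longrightarrow> (\<lambda>x. \<sigma> x i) \<in> subalgebra_gen C"
  shows "(\<lambda>x. f (\<sigma> x)) \<in> subalgebra_gen C"
  using assms(1)
  by induction (auto simp: coordinates_def assms(2) intro: subalgebra_gen.intros)

lemma subalgebra_gen_mono: "C \<subseteq> C' \<Longrightarrow> subalgebra_gen C \<subseteq> subalgebra_gen C'"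
proof
  fix f assume "C \<subseteq> C'" "f \<in> subalgebra_gen C"
  from this(2) show "f \<in> subalgebra_gen C'"
    by induction (use \<open>C \<subseteq> C'\<close> in \<open>auto intro: subalgebra_gen.intros\<close>)
qed

lemma coordinates_mono: "J \<subseteq> I \<Longrightarrow> coordinates J \<subseteq> coordinates I"
  by (auto simp: coordinates_def)

lemma subalgebra_gen_cong_point:
  assumes "f \<in> subalgebra_gen (coordinates J)" "\<And>j. j \<in> J \<Longrightarrow> x j = y j"
  shows "f x = f y"
  using assms(1) by induction (auto simp: coordinates_def assms(2))

lemma subalgebra_gen_poly_curve:
  fixes \<sigma> :: "'k \<Rightarrow> 'i \<Rightarrow> 'k::field"
  assumes "f \<in> subalgebra_gen (coordinates I)"
    and "\<And>i. i \<in> I \<Longrightarrow> \<exists>p. \<forall>s. \<sigma> s i = poly p s"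
  shows "\<exists>p. \<forall>s. f (\<sigma> s) = poly p s"
  using assms(1)
proof induction
  case (const c)
  show ?case by (rule exI[of _ "[:c:]"]) simp
next
  case (gen f)
  then show ?case using assms(2) by (auto simp: coordinates_def)
next
  case (add f g)
  then obtain p q where "\<forall>s. f (\<sigma> s) = poly p s" "\<forall>s. g (\<sigma> s) = poly q s" by blast
  then show ?case by (intro exI[of _ "p + q"]) simp
next
  case (mult f g)
  then obtain p q where "\<forall>s. f (\<sigma> s) = poly p s" "\<forall>s. g (\<sigma> s) = poly q s" by blast
  then show ?case by (intro exI[of _ "p * q"]) simp
qed

lemma poly_eqI_cofinite:
  fixes p q :: "'k::field_char_0 poly"
  assumes "\<And>s. s \<noteq> 0 \<Longrightarrow> poly p s = poly q s"
  shows "p = q"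
proof (rule ccontr)
  assume "p \<noteq> q"
  then have "finite {s. poly (p - q) s = 0}" by (intro poly_roots_finite) auto
  moreover have "UNIV - {0} \<subseteq> {s. poly (p - q) s = 0}" using assms by auto
  ultimately have "finite (UNIV - {0::'k})" by (rule rev_finite_subset)
  then show False using infinite_UNIV_char_0[where ?'a = 'k] by simp
qed

text \<open>Restricted to the line through a point with \<open>f\<close> nonzero and a point with
  \<open>g\<close> nonzero, both become nonzero polynomials in one variable.\<close>

lemma subalgebra_gen_no_zero_divisors:
  fixes f g :: "('i \<Rightarrow> 'k::field_char_0) \<Rightarrow> 'k"
  assumes f: "f \<in> subalgebra_gen (coordinates I)" and g: "g \<in> subalgebra_gen (coordinates I)"
    and fg: "\<And>x. f x * g x = 0"
  shows "(\<forall>x. f x = 0) \<or> (\<forall>x. g x = 0)"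
proof (rule ccontr)
  assume "\<not> ?thesis"
  then obtain x y where x: "f x \<noteq> 0" and y: "g y \<noteq> 0" by blast
  define \<sigma> where "\<sigma> s = (\<lambda>i. x i + s * (y i - x i))" for s
  have lin: "\<exists>p. \<forall>s. \<sigma> s i = poly p s" for i
    by (rule exI[of _ "[:x i, y i - x i:]"]) (simp add: \<sigma>_def)
  obtain p where p: "\<And>s. f (\<sigma> s) = poly p s"
    using subalgebra_gen_poly_curve[OF f, of \<sigma>] lin by blast
  obtain q where q: "\<And>s. g (\<sigma> s) = poly q s"
    using subalgebra_gen_poly_curve[OF g, of \<sigma>] lin by blast
  have "p * q = 0" by (rule poly_eqI_cofinite) (simp add: p[symmetric] q[symmetric] fg)
  moreover have "\<sigma> 0 = x" "\<sigma> 1 = y" by (auto simp: \<sigma>_def)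
  then have "p \<noteq> 0" "q \<noteq> 0" using x y p[of 0] q[of 1] by auto
  ultimately show False by simp
qed

lemma subalgebra_gen_upd:
  "f \<in> subalgebra_gen (coordinates I) \<Longrightarrow>
   (\<lambda>x. f (x(j := c))) \<in> subalgebra_gen (coordinates (I - {j}))"
  by (erule subalgebra_gen_subst)
     (case_tac "i = j", auto intro: subalgebra_gen.const subalgebra_gen_coordinate)

lemma subalgebra_gen_coordinates_Diff:
  "f \<in> subalgebra_gen (coordinates (I - J)) \<Longrightarrow> f \<in> subalgebra_gen (coordinates I)"
  using subalgebra_gen_mono[OF coordinates_mono[of "I - J" I]] by auto

lemma subalgebra_gen_divide_coordinate:
  assumes "f \<in> subalgebra_gen (coordinates I)" "j \<in> I"
  shows "\<exists>g\<in>subalgebra_gen (coordinates I). \<forall>x. f x = f (x(j := 0)) + x j * g x"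
  using assms(1)
proof induction
  case (const c)
  show ?case by (rule bexI[of _ "\<lambda>_. 0"]) (auto intro: subalgebra_gen.const)
next
  case (gen f)
  then obtain i where i: "f = (\<lambda>x. x i)" "i \<in> I" by (auto simp: coordinates_def)
  show ?case
    by (rule bexI[of _ "\<lambda>_. if i = j then 1 else 0"]) (auto simp: i subalgebra_gen.const)
next
  case (add f g)
  then obtain f' g' where *: "f' \<in> subalgebra_gen (coordinates I)" "g' \<in> subalgebra_gen (coordinates I)"
    "\<And>x. f x = f (x(j := 0)) + x j * f' x" "\<And>x. g x = g (x(j := 0)) + x j * g' x" by blast
  show ?case
  proof (rule bexI[of _ "\<lambda>x. f' x + g' x"], rule allI)
    fix x show "f x + g x = f (x(j := 0)) + g (x(j := 0)) + x j * (f' x + g' x)"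
      using *(3,4)[of x] by (simp add: algebra_simps)
  qed (intro subalgebra_gen.intros *)
next
  case (mult f g)
  then obtain f' g' where *: "f' \<in> subalgebra_gen (coordinates I)" "g' \<in> subalgebra_gen (coordinates I)"
    "\<And>x. f x = f (x(j := 0)) + x j * f' x" "\<And>x. g x = g (x(j := 0)) + x j * g' x" by blast
  show ?case
  \<comment> \<open>The quotient comes from f g - f0 g0 = (f - f0) g + f0 (g - g0), where f0 and g0
    are the values at \<open>x(j := 0)\<close>.\<close>
  proof (rule bexI[of _ "\<lambda>x. f' x * g x + f (x(j := 0)) * g' x"], rule allI)
    fix x
    show "f x * g x = f (x(j := 0)) * g (x(j := 0)) + x j * (f' x * g x + f (x(j := 0)) * g' x)"
      using *(3,4)[of x] by algebra
  qed (intro subalgebra_gen.intros * mult.hyps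
      subalgebra_gen_coordinates_Diff[OF subalgebra_gen_upd[OF mult.hyps(1)]])
qed

text \<open>Since polynomials over an infinite field are identified with functions, divisibility by a
  coordinate is vanishing on a coordinate hyperplane.\<close>

lemma coordinate_dvd:
  assumes "f \<in> subalgebra_gen (coordinates I)" "j \<in> I" "\<And>x. f (x(j := 0)) = 0"
  obtains g where "g \<in> subalgebra_gen (coordinates I)" "\<And>x. f x = x j * g x"
  using subalgebra_gen_divide_coordinate[OF assms(1,2)] by (metis add_0 assms(3))

lemma coordinate_cancel:
  fixes f g :: "('i \<Rightarrow> 'k::field_char_0) \<Rightarrow> 'k"
  assumes "f \<in> subalgebra_gen (coordinates I)" "g \<in> subalgebra_gen (coordinates I)" "j \<in> I"
    and "\<And>x. x j * f x = x j * g x"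
  shows "f x = g x"
proof -
  have "(\<forall>x. x j = (0::'k)) \<or> (\<forall>x. f x - g x = 0)"
    by (rule subalgebra_gen_no_zero_divisors[where I = I])
       (use assms in \<open>auto intro: subalgebra_gen_diff subalgebra_gen_coordinate simp: algebra_simps\<close>)
  moreover have "\<not> (\<forall>x. x j = (0::'k))" by (auto intro!: exI[of _ "\<lambda>_. 1"])
  ultimately show ?thesis by auto
qed

section \<open>The degree function of a locally nilpotent derivation\<close>

text \<open>The unit of \<open>B\<close> need not be the constant
  function \<open>1\<close>, because elements of a coordinate ring vanish outside of the variety.\<close>

locale lnd_domain =
  fixes B :: "('p \<Rightarrow> 'k::field_char_0) set" and D :: "('p \<Rightarrow> 'k) \<Rightarrow> ('p \<Rightarrow> 'k)"
  assumes zero_closed: "0 \<in> B"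
    and add_closed: "\<And>f g. f \<in> B \<Longrightarrow> g \<in> B \<Longrightarrow> f + g \<in> B"
    and mult_closed: "\<And>f g. f \<in> B \<Longrightarrow> g \<in> B \<Longrightarrow> f * g \<in> B"
    and scale_closed: "\<And>c f. f \<in> B \<Longrightarrow> (\<lambda>x. c * f x) \<in> B"
    and no_zero_divisors: "\<And>f g. f \<in> B \<Longrightarrow> g \<in> B \<Longrightarrow> f * g = 0 \<Longrightarrow> f = 0 \<or> g = 0"
    and lnd: "locally_nilpotent_derivation B D"
begin

lemma D_closed: "f \<in> B \<Longrightarrow> D f \<in> B"
  and D_add: "f \<in> B \<Longrightarrow> g \<in> B \<Longrightarrow> D (f + g) = D f + D g"
  and D_scale: "f \<in> B \<Longrightarrow> D (\<lambda>x. c * f x) = (\<lambda>x. c * D f x)"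
  and D_mult: "f \<in> B \<Longrightarrow> g \<in> B \<Longrightarrow> D (f * g) = f * D g + D f * g"
  using lnd
  by (auto simp: locally_nilpotent_derivation_def derivation_def plus_fun_def times_fun_def)

lemma D_nilpotent: "f \<in> B \<Longrightarrow> \<exists>n. (D ^^ n) f = 0"
  using lnd by (auto simp: locally_nilpotent_derivation_def zero_fun_def)

lemma uminus_closed: "f \<in> B \<Longrightarrow> - f \<in> B"
  using scale_closed[of f "-1"] by (simp add: fun_Compl_def)

lemma diff_closed: "f \<in> B \<Longrightarrow> g \<in> B \<Longrightarrow> f - g \<in> B"
  using add_closed[OF _ uminus_closed, of f g] by simp

lemma D_zero [simp]: "D 0 = 0"
  using D_add[OF zero_closed zero_closed] by simp

lemma D_uminus: "f \<in> B \<Longrightarrow> D (- f) = - D f"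
  using D_scale[of f "-1"] by (simp add: fun_Compl_def)

lemma iter_closed: "f \<in> B \<Longrightarrow> (D ^^ n) f \<in> B"
  by (induction n) (auto intro: D_closed)

lemma iter_zero [simp]: "(D ^^ n) 0 = 0"
  by (induction n) (simp_all only: funpow.simps id_apply o_apply D_zero)

lemma iter_add: "f \<in> B \<Longrightarrow> g \<in> B \<Longrightarrow> (D ^^ n) (f + g) = (D ^^ n) f + (D ^^ n) g"
  by (induction n) (auto simp: D_add iter_closed)

lemma iter_ker_mult: "f \<in> B \<Longrightarrow> g \<in> B \<Longrightarrow> D f = 0 \<Longrightarrow> (D ^^ n) (f * g) = f * (D ^^ n) g"
  by (induction n) (auto simp: D_mult iter_closed)

lemma iter_eq_0_mono: "(D ^^ m) f = 0 \<Longrightarrow> m \<le> n \<Longrightarrow> (D ^^ n) f = 0"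
  by (metis funpow_add iter_zero le_add_diff_inverse2 o_apply)

text \<open>All other terms of the Leibniz expansion contain a vanishing iterate. Splitting off one
  derivation lowers \<open>a + b\<close> by one, and the two surviving contributions add up by
  Pascal's rule.\<close>

lemma iter_mult_top:
  assumes "f \<in> B" "g \<in> B" "(D ^^ Suc a) f = 0" "(D ^^ Suc b) g = 0"
  shows "(D ^^ (a + b)) (f * g) = (\<lambda>x. of_nat ((a + b) choose a) * ((D ^^ a) f * (D ^^ b) g) x)
    \<and> (D ^^ Suc (a + b)) (f * g) = 0"
  using assms
proof (induction "a + b" arbitrary: a b f g)
  case 0
  then have "a = 0" "b = 0" "D f = 0" "D g = 0" by auto
  then have "D (f * g) = 0" by (simp only: D_mult[OF 0(2,3)] mult_zero_left mult_zero_right add_0)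
  then show ?case using \<open>a = 0\<close> \<open>b = 0\<close> by (simp add: times_fun_def)
next
  case (Suc n)
  note B = Suc.prems(1,2)
  let ?top = "(\<lambda>x. of_nat ((a + b) choose a) * ((D ^^ a) f * (D ^^ b) g) x)"
  have step: "(D ^^ (a + b)) (f * g) = (D ^^ n) (f * D g) + (D ^^ n) (D f * g)"
  proof -
    have "(D ^^ (a + b)) (f * g) = (D ^^ n) (D (f * g))"
      by (simp add: Suc.hyps(2)[symmetric] funpow_swap1)
    then show ?thesis using B by (simp add: D_mult iter_add mult_closed D_closed)
  qed
  have left: "(D ^^ n) (D f * g) = (if a = 0 then 0
      else (\<lambda>x. of_nat (n choose (a - 1)) * ((D ^^ a) f * (D ^^ b) g) x))"
  proof (cases a)
    case 0
    then show ?thesis using Suc.prems by simp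
  next
    case (Suc a')
    have "n = a' + b" using Suc Suc.hyps(2) by simp
    moreover have "(D ^^ Suc a') (D f) = 0" using Suc.prems(3) Suc by (simp add: funpow_swap1)
    ultimately show ?thesis
      using Suc.hyps(1)[of a' b "D f" g] B Suc.prems(4) Suc by (simp add: D_closed funpow_swap1)
  qed
  have right: "(D ^^ n) (f * D g) = (if b = 0 then 0
      else (\<lambda>x. of_nat (n choose a) * ((D ^^ a) f * (D ^^ b) g) x))"
  proof (cases b)
    case 0
    then show ?thesis using Suc.prems by simp
  next
    case (Suc b')
    have "n = a + b'" using Suc Suc.hyps(2) by simp
    moreover have "(D ^^ Suc b') (D g) = 0" using Suc.prems(4) Suc by (simp add: funpow_swap1)
    ultimately show ?thesis
      using Suc.hyps(1)[of a b' f "D g"] B Suc.prems(3) Suc by (simp add: D_closed funpow_swap1)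
  qed
  have top: "(D ^^ (a + b)) (f * g) = ?top"
  proof (cases "a = 0 \<or> b = 0")
    case True
    then show ?thesis
      using Suc.hyps(2) unfolding step left right by (auto simp: fun_eq_iff)
  next
    case False
    then obtain a' where a': "a = Suc a'" by (cases a) auto
    have "a + b = Suc n" using Suc.hyps(2) by simp
    then have "(a + b) choose a = (n choose a) + (n choose (a - 1))" by (simp add: a')
    then show ?thesis
      using False unfolding step left right by (auto simp: fun_eq_iff algebra_simps)
  qed
  have "D ((D ^^ a) f) = 0" "D ((D ^^ b) g) = 0" using Suc.prems(3,4) by simp_all
  then have "D ((D ^^ a) f * (D ^^ b) g) = 0"
    by (simp only: D_mult iter_closed B mult_zero_left mult_zero_right add_0)
  then have "D ?top = 0"
    using D_scale[OF mult_closed[OF iter_closed iter_closed, OF B]] by (simp add: fun_eq_iff)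
  then show ?case using top by simp
qed

text \<open>The index of the last nonzero iterate. The value \<open>deg 0 = 0\<close> replaces minus
  infinity, so additivity on products needs nonzero factors.\<close>

definition deg :: "('p \<Rightarrow> 'k) \<Rightarrow> nat" where
  "deg f = (LEAST n. (D ^^ Suc n) f = 0)"

lemma iter_Suc_deg: "f \<in> B \<Longrightarrow> (D ^^ Suc (deg f)) f = 0"
proof -
  assume "f \<in> B"
  then obtain n where "(D ^^ n) f = 0" using D_nilpotent by blast
  then have "(D ^^ Suc n) f = 0" by simp
  then show ?thesis unfolding deg_def by (rule LeastI)
qed

lemma iter_deg: "f \<in> B \<Longrightarrow> f \<noteq> 0 \<Longrightarrow> (D ^^ deg f) f \<noteq> 0"
proof (cases "deg f")
  case (Suc n)
  then show ?thesis using not_less_Least[of n "\<lambda>n. (D ^^ Suc n) f = 0"] by (simp add: deg_def)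
qed simp

lemma deg_le: "(D ^^ Suc n) f = 0 \<Longrightarrow> deg f \<le> n"
  unfolding deg_def by (rule Least_le)

lemma deg_eqI: "f \<in> B \<Longrightarrow> (D ^^ n) f \<noteq> 0 \<Longrightarrow> (D ^^ Suc n) f = 0 \<Longrightarrow> deg f = n"
  by (metis Suc_leI deg_le iter_Suc_deg iter_eq_0_mono le_neq_implies_less)

lemma deg_eq_0_iff: "f \<in> B \<Longrightarrow> deg f = 0 \<longleftrightarrow> D f = 0"
  using deg_le[of 0 f] iter_Suc_deg[of f] by auto

lemma deg_D: "f \<in> B \<Longrightarrow> D f \<noteq> 0 \<Longrightarrow> deg f = Suc (deg (D f))"
proof -
  assume f: "f \<in> B" "D f \<noteq> 0"
  have "(D ^^ deg (D f)) (D f) \<noteq> 0" "(D ^^ Suc (deg (D f))) (D f) = 0"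
    using iter_deg iter_Suc_deg f D_closed by blast+
  then show ?thesis by (intro deg_eqI f) (simp_all add: funpow_swap1)
qed

text \<open>Characteristic zero keeps the binomial coefficient of the top term nonzero, and the
  absence of zero divisors keeps the product of the top iterates nonzero.\<close>

lemma deg_mult:
  assumes "f \<in> B" "g \<in> B" "f \<noteq> 0" "g \<noteq> 0"
  shows "deg (f * g) = deg f + deg g"
proof (rule deg_eqI)
  let ?h = "(D ^^ deg f) f * (D ^^ deg g) g"
  have "?h \<noteq> 0"
    using no_zero_divisors[OF iter_closed iter_closed, of f g] assms iter_deg by blast
  then obtain x where "?h x \<noteq> 0" by (auto simp: fun_eq_iff)
  moreover have "(deg f + deg g) choose deg f \<noteq> 0" by simp
  ultimately show "(D ^^ (deg f + deg g)) (f * g) \<noteq> 0"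
    using iter_mult_top[OF assms(1,2) iter_Suc_deg iter_Suc_deg] assms
    by (auto simp: fun_eq_iff intro!: exI[of _ x])
  show "(D ^^ Suc (deg f + deg g)) (f * g) = 0"
    using iter_mult_top[OF assms(1,2) iter_Suc_deg iter_Suc_deg] assms by blast
qed (use assms in \<open>auto intro: mult_closed\<close>)

lemma deg_scale: "f \<in> B \<Longrightarrow> c \<noteq> 0 \<Longrightarrow> deg (\<lambda>x. c * f x) = deg f"
proof -
  assume f: "f \<in> B" "c \<noteq> 0"
  have "(D ^^ n) (\<lambda>x. c * f x) = (\<lambda>x. c * (D ^^ n) f x)" for n
    by (induction n) (auto simp: D_scale iter_closed f)
  then have "(D ^^ n) (\<lambda>x. c * f x) = 0 \<longleftrightarrow> (D ^^ n) f = 0" for n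
    using f by (auto simp: fun_eq_iff)
  then show ?thesis unfolding deg_def by presburger
qed

lemma deg_uminus: "f \<in> B \<Longrightarrow> deg (- f) = deg f"
  using deg_scale[of f "-1"] by (simp add: fun_Compl_def)

lemma deg_add_le: "f \<in> B \<Longrightarrow> g \<in> B \<Longrightarrow> deg (f + g) \<le> max (deg f) (deg g)"
proof (rule deg_le)
  assume f: "f \<in> B" "g \<in> B"
  have "(D ^^ Suc (max (deg f) (deg g))) f = 0" "(D ^^ Suc (max (deg f) (deg g))) g = 0"
    by (rule iter_eq_0_mono[OF iter_Suc_deg]; simp add: f)+
  then show "(D ^^ Suc (max (deg f) (deg g))) (f + g) = 0"
    using iter_add[OF f] by (metis add_0)
qed

lemma deg_add_eq: "f \<in> B \<Longrightarrow> g \<in> B \<Longrightarrow> deg g < deg f \<Longrightarrow> deg (f + g) = deg f"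
proof -
  assume f: "f \<in> B" "g \<in> B" "deg g < deg f"
  have "f \<noteq> 0" using f(3) deg_eq_0_iff[OF zero_closed] by (metis D_zero less_nat_zero_code)
  have "(D ^^ deg f) g = 0" "(D ^^ Suc (deg f)) g = 0"
    using f(3) by (auto intro!: iter_eq_0_mono[OF iter_Suc_deg[OF f(2)]] simp del: funpow.simps)
  then show ?thesis
    using iter_add[OF f(1,2)] iter_deg[OF f(1) \<open>f \<noteq> 0\<close>] iter_Suc_deg[OF f(1)]
    by (intro deg_eqI add_closed f) (auto simp del: funpow.simps)
qed

text \<open>A sum of two degrees is zero only if both are: the kernel is factorially closed.\<close>

lemma ker_factor: "f \<in> B \<Longrightarrow> g \<in> B \<Longrightarrow> f * g \<noteq> 0 \<Longrightarrow> D (f * g) = 0 \<Longrightarrow> D f = 0 \<and> D g = 0"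
  using deg_mult[of f g] deg_eq_0_iff[of "f * g"] deg_eq_0_iff[of f] deg_eq_0_iff[of g]
  by (metis add_is_0 mult_closed mult_zero_left mult_zero_right)

text \<open>Otherwise the degree of \<open>D f\<close> would be at least that of \<open>f\<close>,
  but \<open>D\<close> lowers degrees by one.\<close>

lemma ker_if_dvd_D: "f \<in> B \<Longrightarrow> g \<in> B \<Longrightarrow> D f = f * g \<Longrightarrow> D f = 0"
proof (rule ccontr)
  assume f: "f \<in> B" "g \<in> B" "D f = f * g" "D f \<noteq> 0"
  then have "deg (f * g) = deg f + deg g" by (intro deg_mult) auto
  then show False using deg_D[OF f(1,4)] f(3) by simp
qed

end

section \<open>The coordinate ring of a trinomial hypersurface\<close>

definition mon :: "'i set \<Rightarrow> ('i \<Rightarrow> nat) \<Rightarrow> ('i \<Rightarrow> 'k) \<Rightarrow> 'k::field" where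
  "mon S e x = (\<Prod>i\<in>S. x i ^ e i)"

lemma mon_upd: "i \<notin> S \<Longrightarrow> mon S e (x(i := c)) = mon S e x"
  by (auto simp: mon_def intro!: prod.cong)

lemma mon_remove: "finite S \<Longrightarrow> i \<in> S \<Longrightarrow> mon S e x = x i ^ e i * mon (S - {i}) e x"
  by (simp add: mon_def prod.remove)

lemma mon_insert: "finite S \<Longrightarrow> i \<notin> S \<Longrightarrow> mon (insert i S) e x = x i ^ e i * mon S e x"
  by (simp add: mon_def)

lemma mon_add: "mon S (\<lambda>i. e i + e' i) x = mon S e x * mon S e' x"
  by (simp add: mon_def power_add prod.distrib)

lemma mon_1 [simp]: "mon S e (\<lambda>_. 1) = 1"
  by (simp add: mon_def)

lemma mon_nonzero: "(\<And>i. i \<in> S \<Longrightarrow> x i \<noteq> 0) \<Longrightarrow> mon S e x \<noteq> 0"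
  by (cases "finite S") (auto simp: mon_def)

lemma mon_eq_0: "finite S \<Longrightarrow> i \<in> S \<Longrightarrow> x i = 0 \<Longrightarrow> e i > 0 \<Longrightarrow> mon S e x = 0"
  by (auto simp: mon_def intro!: bexI[of _ i])

lemma mon_cong: "(\<And>i. i \<in> S \<Longrightarrow> x i = y i) \<Longrightarrow> mon S e x = mon S e y"
  by (auto simp: mon_def intro!: prod.cong)

lemma mon_poly: "S \<subseteq> I \<Longrightarrow> mon S e \<in> subalgebra_gen (coordinates I)"
  unfolding mon_def[abs_def]
  by (auto intro!: subalgebra_gen_prod subalgebra_gen_power subalgebra_gen_coordinate)

text \<open>The exponents \<open>\<mu>\<close> of the first two blocks are halved, because their
  monomials enter as squares; those of \<open>J2\<close> are the true ones. \<open>J0\<close> and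
  \<open>J1\<close> play symmetric roles, each with one marked coordinate of exponent one, so they
  can be exchanged by a second interpretation.\<close>

locale trinomial =
  fixes J0 J1 J2 :: "'i set" and \<mu> :: "'i \<Rightarrow> nat" and x0 y0 :: 'i
    and X :: "('i \<Rightarrow> 'k::{alg_closed_field, field_char_0}) set" and I :: "'i set"
  assumes finite_blocks: "finite J0" "finite J1" "finite J2"
    and disjoint: "J0 \<inter> J1 = {}" "J0 \<inter> J2 = {}" "J1 \<inter> J2 = {}"
    and x0: "x0 \<in> J0" "\<mu> x0 = 1" and y0: "y0 \<in> J1" "\<mu> y0 = 1"
    and J2_ne: "J2 \<noteq> {}"
    and \<mu>_pos: "\<And>i. i \<in> J0 \<union> J1 \<Longrightarrow> 1 \<le> \<mu> i" and \<mu>_ge2: "\<And>i. i \<in> J2 \<Longrightarrow> 2 \<le> \<mu> i"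
    and I_eq: "I = J0 \<union> J1 \<union> J2"
    and X_eq: "X = zero_locus I (\<lambda>x. mon J0 \<mu> x ^ 2 + mon J1 \<mu> x ^ 2 + mon J2 \<mu> x)"
begin

abbreviation "R \<equiv> subalgebra_gen (coordinates I) :: (('i \<Rightarrow> 'k) \<Rightarrow> 'k) set"
abbreviation "A \<equiv> mon J0 \<mu> :: ('i \<Rightarrow> 'k) \<Rightarrow> 'k"
abbreviation "B \<equiv> mon J1 \<mu> :: ('i \<Rightarrow> 'k) \<Rightarrow> 'k"
abbreviation "P \<equiv> mon J2 \<mu> :: ('i \<Rightarrow> 'k) \<Rightarrow> 'k"

definition F :: "('i \<Rightarrow> 'k) \<Rightarrow> 'k" where "F x = A x ^ 2 + B x ^ 2 + P x"

definition res :: "(('i \<Rightarrow> 'k) \<Rightarrow> 'k) \<Rightarrow> (('i \<Rightarrow> 'k) \<Rightarrow> 'k)" where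
  "res p = (\<lambda>x. if x \<in> X then p x else 0)"

abbreviation "KX \<equiv> coordinate_subring X I"

lemma finite_I: "finite I"
  using finite_blocks by (simp add: I_eq)

lemma \<mu>_pos': "i \<in> I \<Longrightarrow> 0 < \<mu> i"
  using \<mu>_pos[of i] \<mu>_ge2[of i] by (auto simp: I_eq)

lemma blocks_subset: "J0 \<subseteq> I" "J1 \<subseteq> I" "J2 \<subseteq> I" "x0 \<in> I" "y0 \<in> I" "x0 \<noteq> y0"
  using x0 y0 disjoint by (auto simp: I_eq)

lemma ABP_poly: "A \<in> R" "B \<in> R" "P \<in> R"
  by (simp_all add: mon_poly blocks_subset)

lemma F_poly: "F \<in> R"
  unfolding F_def[abs_def] by (intro subalgebra_gen_intros ABP_poly)

lemma poly_restrict: "f \<in> R \<Longrightarrow> f (restrict x I) = f x"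
  by (erule subalgebra_gen_cong_point) auto

lemma X_F: "X = {x \<in> affine_space I. F x = 0}"
  by (simp add: X_eq zero_locus_def F_def)

lemma restrict_X: "F x = 0 \<Longrightarrow> restrict x I \<in> X"
  using poly_restrict[OF F_poly, of x] by (auto simp: X_F affine_space_def)

lemma X_zero: "x \<in> X \<Longrightarrow> A x ^ 2 + B x ^ 2 + P x = 0"
  by (simp add: X_F F_def)

lemma vanish_X: "f \<in> R \<Longrightarrow> (\<And>x. x \<in> X \<Longrightarrow> f x = 0) \<Longrightarrow> F x = 0 \<Longrightarrow> f x = 0"
  using restrict_X[of x] poly_restrict[of f x] by auto

section \<open>The vanishing ideal of \<open>X\<close>\<close>

definition u :: "('i \<Rightarrow> 'k) \<Rightarrow> 'k" where "u = mon (J0 - {x0}) \<mu>"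

lemma A_u: "A x = x x0 * u x"
  using mon_remove[OF finite_blocks(1) x0(1), of \<mu> x] by (simp add: x0 u_def)

text \<open>\<open>F\<close> is quadratic in the coordinate \<open>x0\<close> with leading
  coefficient \<open>u ^ 2\<close>; pseudo-division leaves a remainder that is linear in this
  coordinate.\<close>

lemma pseudo_division:
  assumes "f \<in> R"
  shows "\<exists>k. \<exists>q\<in>R. \<exists>r\<in>subalgebra_gen (coordinates (I - {x0})). \<exists>s\<in>subalgebra_gen (coordinates (I - {x0})).
    \<forall>x. u x ^ (2 * k) * f x = q x * F x + r x * x x0 + s x"
  using assms
proof induction
  case (const c)
  show ?case
    by (rule exI[of _ 0], rule bexI[of _ "\<lambda>_. 0"], rule bexI[of _ "\<lambda>_. 0"], rule bexI[of _ "\<lambda>_. c"])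
       (auto intro: subalgebra_gen.const)
next
  case (gen f)
  then obtain i where i: "f = (\<lambda>x. x i)" "i \<in> I" by (auto simp: coordinates_def)
  show ?case
  proof (cases "i = x0")
    case True
    show ?thesis
      by (rule exI[of _ 0], rule bexI[of _ "\<lambda>_. 0"], rule bexI[of _ "\<lambda>_. 1"], rule bexI[of _ "\<lambda>_. 0"])
         (auto intro: subalgebra_gen.const simp: i True)
  next
    case False
    show ?thesis
      by (rule exI[of _ 0], rule bexI[of _ "\<lambda>_. 0"], rule bexI[of _ "\<lambda>_. 0"], rule bexI[of _ f])
         (use False in \<open>auto intro: subalgebra_gen.const subalgebra_gen_coordinate simp: i\<close>)
  qed
next
  case (add f f')
  let ?R = "subalgebra_gen (coordinates (I - {x0})) :: (('i \<Rightarrow> 'k) \<Rightarrow> 'k) set"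
  have u': "u \<in> ?R" unfolding u_def by (rule mon_poly) (auto simp: I_eq)
  note u = subalgebra_gen_coordinates_Diff[OF u']
  obtain k q r s where 1: "q \<in> R" "r \<in> ?R" "s \<in> ?R"
    "\<And>x. u x ^ (2 * k) * f x = q x * F x + r x * x x0 + s x" using add.IH(1) by blast
  obtain k' q' r' s' where 2: "q' \<in> R" "r' \<in> ?R" "s' \<in> ?R"
    "\<And>x. u x ^ (2 * k') * f' x = q' x * F x + r' x * x x0 + s' x" using add.IH(2) by blast
  have eq: "u x ^ (2 * (k + k')) * (f x + f' x)
      = (u x ^ (2 * k') * q x + u x ^ (2 * k) * q' x) * F x
        + (u x ^ (2 * k') * r x + u x ^ (2 * k) * r' x) * x x0
        + (u x ^ (2 * k') * s x + u x ^ (2 * k) * s' x)" for x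
  proof -
    have "u x ^ (2 * (k + k')) * (f x + f' x)
      = u x ^ (2 * k') * (u x ^ (2 * k) * f x) + u x ^ (2 * k) * (u x ^ (2 * k') * f' x)"
      by (simp add: power_add algebra_simps)
    then show ?thesis unfolding 1(4) 2(4) by (simp add: algebra_simps)
  qed
  show ?case
    by (rule exI[of _ "k + k'"], rule bexI[of _ "\<lambda>x. u x ^ (2 * k') * q x + u x ^ (2 * k) * q' x"],
        rule bexI[of _ "\<lambda>x. u x ^ (2 * k') * r x + u x ^ (2 * k) * r' x"],
        rule bexI[of _ "\<lambda>x. u x ^ (2 * k') * s x + u x ^ (2 * k) * s' x"], rule allI, rule eq)
       (intro subalgebra_gen_intros u u' 1(1-3) 2(1-3))+
next
  case (mult f f')
  let ?R = "subalgebra_gen (coordinates (I - {x0})) :: (('i \<Rightarrow> 'k) \<Rightarrow> 'k) set"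
  have u': "u \<in> ?R" unfolding u_def by (rule mon_poly) (auto simp: I_eq)
  note u = subalgebra_gen_coordinates_Diff[OF u']
  have "B \<in> ?R" "P \<in> ?R" using disjoint x0 by (auto intro!: mon_poly simp: I_eq)
  then have G: "(\<lambda>x. B x ^ 2 + P x) \<in> ?R" by (intro subalgebra_gen_intros)
  obtain k q r s where 1: "q \<in> R" "r \<in> ?R" "s \<in> ?R"
    "\<And>x. u x ^ (2 * k) * f x = q x * F x + r x * x x0 + s x" using mult.IH(1) by blast
  obtain k' q' r' s' where 2: "q' \<in> R" "r' \<in> ?R" "s' \<in> ?R"
    "\<And>x. u x ^ (2 * k') * f' x = q' x * F x + r' x * x x0 + s' x" using mult.IH(2) by blast
  note rs = 1(2,3)[THEN subalgebra_gen_coordinates_Diff] 2(2,3)[THEN subalgebra_gen_coordinates_Diff]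
  \<comment> \<open>The product of two linear remainders has a term in the square of
    \<open>x x0\<close>; one more factor \<open>u x ^ 2\<close> turns that square into
    \<open>F x - (B x ^ 2 + P x)\<close>, which accounts for \<open>r x * r' x\<close> here and in
    \<open>?s\<close>.\<close>
  let ?q = "\<lambda>x. u x ^ 2 * (q x * (q' x * F x + r' x * x x0 + s' x) + (r x * x x0 + s x) * q' x) + r x * r' x"
  let ?r = "\<lambda>x. u x ^ 2 * (r x * s' x + s x * r' x)"
  let ?s = "\<lambda>x. u x ^ 2 * (s x * s' x) - r x * r' x * (B x ^ 2 + P x)"
  have eq: "u x ^ (2 * (k + k' + 1)) * (f x * f' x) = ?q x * F x + ?r x * x x0 + ?s x" for x
  proof -
    have "u x ^ (2 * (k + k' + 1)) * (f x * f' x)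
      = u x ^ 2 * ((u x ^ (2 * k) * f x) * (u x ^ (2 * k') * f' x))"
      by (simp add: distrib_left power_add power2_eq_square)
    also have "\<dots> = u x ^ 2 * ((q x * F x + r x * x x0 + s x) * (q' x * F x + r' x * x x0 + s' x))"
      by (simp only: 1(4) 2(4))
    also have "\<dots> = ?q x * F x + ?r x * x x0 + ?s x"
      unfolding F_def A_u by algebra
    finally show ?thesis .
  qed
  show ?case
    by (rule exI[of _ "k + k' + 1"], rule bexI[of _ ?q], rule bexI[of _ ?r], rule bexI[of _ ?s],
        rule allI, rule eq)
       (intro subalgebra_gen_intros subalgebra_gen_coordinate blocks_subset F_poly u u' 1(1-3) 2(1-3) G rs)+
qed

text \<open>One of the three monomials vanishes at this point and the other two are 1, so in
  characteristic zero no coordinate divides \<open>F\<close>.\<close>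

lemma F_at_1: "j \<in> I \<Longrightarrow> F ((\<lambda>_. 1)(j := 0)) \<noteq> 0"
proof -
  assume j: "j \<in> I"
  have "mon S \<mu> ((\<lambda>_. 1)(j := 0)) = (if j \<in> S then 0 else (1::'k))" if "finite S" "S \<subseteq> I" for S
    using that \<mu>_pos'[OF j] by (auto simp: mon_upd intro: mon_eq_0)
  then show ?thesis
    using j disjoint finite_blocks blocks_subset by (auto simp: F_def I_eq)
qed

text \<open>A coordinate is prime in the polynomial ring and does not divide \<open>F\<close>, so it
  divides \<open>q\<close>.\<close>

lemma F_cancel_coordinate:
  assumes "j \<in> I" "f \<in> R" "q \<in> R" "\<And>x. x j * f x = q x * F x"
  shows "\<exists>q'\<in>R. \<forall>x. f x = q' x * F x"
proof -
  note upd = subalgebra_gen_coordinates_Diff[OF subalgebra_gen_upd]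
  have "(\<forall>x. q (x(j := 0)) = 0) \<or> (\<forall>x. F (x(j := 0)) = 0)"
    by (rule subalgebra_gen_no_zero_divisors[OF upd upd, OF assms(3) F_poly])
       (metis assms(4) fun_upd_same mult_zero_left)
  then have "q (x(j := 0)) = 0" for x using F_at_1[OF assms(1)] by blast
  then obtain q' where q': "q' \<in> R" "\<And>x. q x = x j * q' x"
    using coordinate_dvd[OF assms(3,1)] by blast
  have "f x = q' x * F x" for x
    by (rule coordinate_cancel[where j = j and I = I])
       (use assms q' in \<open>auto intro: subalgebra_gen_intros F_poly\<close>)
  then show ?thesis using q'(1) by blast
qed

lemma F_cancel_mon:
  assumes "S \<subseteq> I" "f \<in> R" "q \<in> R" "\<And>x. mon S e x * f x = q x * F x"
  shows "\<exists>q'\<in>R. \<forall>x. f x = q' x * F x"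
proof -
  have "finite S" using assms(1) finite_I by (rule finite_subset)
  then show ?thesis using assms
  proof (induction S arbitrary: f q)
    case empty
    then show ?case by (auto simp: mon_def)
  next
    case (insert j S)
    have "\<exists>q'\<in>R. \<forall>x. f x = q' x * F x" if "f \<in> R" "q \<in> R" "\<And>x. x j ^ n * f x = q x * F x" for n f q
      using that
    proof (induction n arbitrary: f q)
      case 0
      then show ?case by auto
    next
      case (Suc n)
      have "j \<in> I" using insert.prems by simp
      then have "(\<lambda>x. x j ^ n * f x) \<in> R"
        by (intro subalgebra_gen_intros subalgebra_gen_coordinate Suc.prems)
      then obtain q' where "q' \<in> R" "\<And>x. x j ^ n * f x = q' x * F x"
        using F_cancel_coordinate[OF \<open>j \<in> I\<close> _ Suc.prems(2), of "\<lambda>x. x j ^ n * f x"] Suc.prems(3)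
        by (auto simp: mult.assoc)
      then show ?case using Suc.IH Suc.prems(1) by blast
    qed note powers = this
    have S: "S \<subseteq> I" using insert.prems by simp
    have "(\<lambda>x. mon S e x * f x) \<in> R"
      by (intro subalgebra_gen_intros mon_poly S insert.prems)
    then obtain q' where "q' \<in> R" "\<And>x. mon S e x * f x = q' x * F x"
      using powers[of "\<lambda>x. mon S e x * f x" q "e j"] insert.prems insert.hyps
      by (auto simp: mon_insert mult.assoc)
    then show ?case using insert.IH[OF S insert.prems(2)] by blast
  qed
qed

text \<open>At a general point of the remaining coordinates, \<open>F\<close> has two opposite
  nonzero roots in the coordinate \<open>x0\<close>. The linear remainder vanishes at both, hence is
  zero. Then \<open>F\<close> divides a monomial times \<open>f\<close>, and the monomial
  cancels.\<close>

lemma vanishing_ideal: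
  assumes f: "f \<in> R" and 0: "\<And>x. x \<in> X \<Longrightarrow> f x = 0"
  shows "\<exists>q\<in>R. \<forall>x. f x = q x * F x"
proof -
  let ?R = "subalgebra_gen (coordinates (I - {x0})) :: (('i \<Rightarrow> 'k) \<Rightarrow> 'k) set"
  obtain k q r s where qrs: "q \<in> R" "r \<in> ?R" "s \<in> ?R"
    "\<And>x. u x ^ (2 * k) * f x = q x * F x + r x * x x0 + s x"
    using pseudo_division[OF f] by blast
  have u': "u \<in> R" unfolding u_def by (rule mon_poly) (auto simp: I_eq)
  have x0J: "x0 \<notin> J1" "x0 \<notin> J2" using x0 disjoint by auto
  \<comment> \<open>Where \<open>?h\<close> is nonzero, the quadratic has nonzero leading
    coefficient and constant term, so its roots \<open>c\<close> and \<open>- c\<close> are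
    distinct.\<close>
  let ?h = "\<lambda>x. u x * (B x ^ 2 + P x)"
  have h: "?h \<in> R" by (intro subalgebra_gen_intros u' ABP_poly)
  have "u (\<lambda>_. 1) = 1" by (simp add: u_def)
  then have h1: "?h (\<lambda>_. 1) \<noteq> 0" by simp
  have rs: "r x = 0 \<and> s x = 0" if "?h x \<noteq> 0" for x
  proof -
    have nz: "u x \<noteq> 0" "B x ^ 2 + P x \<noteq> 0" using that by auto
    obtain c where c: "c ^ 2 = - (B x ^ 2 + P x) / u x ^ 2"
      using nth_root_exists[of 2] by (metis zero_less_numeral)
    then have "c \<noteq> 0" using nz by (auto simp: field_simps)
    have "r x * d + s x = 0" if d: "d ^ 2 = c ^ 2" for d
    proof -
      let ?x = "x(x0 := d)"
      have inv: "u ?x = u x" "B ?x = B x" "P ?x = P x" "r ?x = r x" "s ?x = s x"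
        using x0J by (auto simp: u_def mon_upd intro!: subalgebra_gen_cong_point[OF qrs(2)]
            subalgebra_gen_cong_point[OF qrs(3)] split: if_splits)
      have "d ^ 2 * u x ^ 2 = - (B x ^ 2 + P x)" using nz by (simp add: d c)
      then have "F ?x = 0" by (simp add: F_def A_u inv power_mult_distrib)
      with f 0 have "f ?x = 0" by (rule vanish_X)
      then show ?thesis using qrs(4)[of ?x] \<open>F ?x = 0\<close> by (simp add: inv)
    qed
    from this[of c] this[of "- c"] have "r x * c + s x = 0" "s x - r x * c = 0" by simp_all
    then have "2 * s x = 0" "2 * (r x * c) = 0" by (algebra, algebra)
    then show ?thesis using \<open>c \<noteq> 0\<close> by simp
  qed
  have "(\<forall>x. ?h x = 0) \<or> (\<forall>x. r x = 0)"
    by (rule subalgebra_gen_no_zero_divisors[OF h subalgebra_gen_coordinates_Diff[OF qrs(2)]])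
       (use rs in \<open>metis mult_zero_left mult_zero_right\<close>)
  moreover have "(\<forall>x. ?h x = 0) \<or> (\<forall>x. s x = 0)"
    by (rule subalgebra_gen_no_zero_divisors[OF h subalgebra_gen_coordinates_Diff[OF qrs(3)]])
       (use rs in \<open>metis mult_zero_left mult_zero_right\<close>)
  ultimately have "\<And>x. r x = 0" "\<And>x. s x = 0" using h1 by blast+
  then have "mon (J0 - {x0}) (\<lambda>i. \<mu> i * (2 * k)) x * f x = q x * F x" for x
    using qrs(4)[of x] by (simp add: u_def mon_def power_mult prod_power_distrib)
  then show ?thesis
    by (rule F_cancel_mon[rotated 3]) (use f qrs in \<open>auto simp: I_eq\<close>)
qed

lemma mon_cancel_X:
  assumes "S \<subseteq> I" "f \<in> R" "\<And>x. x \<in> X \<Longrightarrow> mon S e x * f x = 0" "x \<in> X"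
  shows "f x = 0"
proof -
  have "(\<lambda>x. mon S e x * f x) \<in> R" by (intro subalgebra_gen_intros mon_poly assms)
  then obtain q where "q \<in> R" "\<And>x. mon S e x * f x = q x * F x"
    using vanishing_ideal[of "\<lambda>x. mon S e x * f x"] assms(3) by blast
  then obtain q' where "f x = q' x * F x" using F_cancel_mon[OF assms(1,2)] by blast
  then show ?thesis using assms(4) by (simp add: X_F)
qed

section \<open>Coprime coordinates and the absence of zero divisors\<close>

definition separated :: "'i \<Rightarrow> 'i \<Rightarrow> bool" where
  "separated p q \<longleftrightarrow> p \<in> I \<and> q \<in> I \<and> \<not> (p \<in> J0 \<and> q \<in> J0) \<and> \<not> (p \<in> J1 \<and> q \<in> J1) \<and> \<not> (p \<in> J2 \<and> q \<in> J2)"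

text \<open>In the quotient by \<open>T\<^sub>p\<close> the relation only involves the two other monomials, hence
  \<open>T\<^sub>q\<close> is not a zero divisor there.\<close>

lemma coordinate_coprime:
  assumes "separated p q" "f \<in> R" "g \<in> R" "\<And>x. x \<in> X \<Longrightarrow> x p * f x = x q * g x"
  shows "\<exists>h\<in>R. \<forall>x\<in>X. g x = x p * h x"
proof -
  have pq: "p \<in> I" "q \<in> I" "p \<noteq> q" using assms(1) unfolding separated_def by (auto simp: I_eq)
  note upd = subalgebra_gen_coordinates_Diff[OF subalgebra_gen_upd]
  have "(\<lambda>x. x p * f x - x q * g x) \<in> R"
    by (intro subalgebra_gen_intros subalgebra_gen_coordinate assms pq)
  then obtain r where r: "r \<in> R" "\<And>x. x p * f x - x q * g x = r x * F x"
    using vanishing_ideal[of "\<lambda>x. x p * f x - x q * g x"] assms(4) by auto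
  obtain r1 where r1: "r1 \<in> R" "\<And>x. r x = r (x(p := 0)) + x p * r1 x"
    using subalgebra_gen_divide_coordinate[OF r(1) pq(1)] by blast
  obtain r2 where r2: "r2 \<in> R" "\<And>x. r (x(p := 0)) = r (x(q := 0, p := 0)) + x q * r2 x"
    using subalgebra_gen_divide_coordinate[OF upd[OF r(1), of p 0] pq(2)] by blast
  have r0: "(\<lambda>x. r (x(q := 0, p := 0))) \<in> R" "(\<lambda>x. F (x(q := 0, p := 0))) \<in> R"
    using upd[OF upd[OF r(1), of p 0], of q 0] upd[OF upd[OF F_poly, of p 0], of q 0] by simp_all
  have "(\<forall>x. r (x(q := 0, p := 0)) = 0) \<or> (\<forall>x. F (x(q := 0, p := 0)) = 0)"
  proof (rule subalgebra_gen_no_zero_divisors[OF r0])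
    fix x :: "'i \<Rightarrow> 'k"
    show "r (x(q := 0, p := 0)) * F (x(q := 0, p := 0)) = 0"
      using r(2)[of "x(q := 0, p := 0)"] pq(3) by simp
  qed
  moreover have "F ((\<lambda>_. 1)(q := 0, p := 0)) = 1"
  proof -
    have mon0: "mon S \<mu> ((\<lambda>_. 1)(q := 0, p := 0)) = (if p \<in> S \<or> q \<in> S then 0 else (1::'k))"
      if "finite S" "S \<subseteq> I" for S
    proof -
      have "mon S \<mu> ((\<lambda>_. 1)(q := 0, p := 0)) = (0::'k)" if "p \<in> S \<or> q \<in> S"
        using that pq \<mu>_pos' \<open>finite S\<close> mon_eq_0[of S p "(\<lambda>_. 1)(q := 0, p := 0)" \<mu>]
          mon_eq_0[of S q "(\<lambda>_. 1)(q := 0, p := 0)" \<mu>] by auto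
      then show ?thesis by (auto simp: mon_upd)
    qed
    show ?thesis
      using assms(1) disjoint unfolding F_def separated_def
      by (subst (1 2 3) mon0) (auto simp: finite_blocks blocks_subset I_eq)
  qed
  ultimately have "r (x(q := 0, p := 0)) = 0" for x by (metis zero_neq_one)
  then have eq: "x p * (f x - r1 x * F x) = x q * (g x + r2 x * F x)" for x
    using r(2)[of x] r1(2)[of x] r2(2)[of x] by (simp add: algebra_simps)
  let ?g = "\<lambda>x. g x + r2 x * F x"
  have g: "?g \<in> R" by (intro subalgebra_gen_intros assms r2 F_poly)
  have "?g (x(p := 0)) = 0" for x
  proof -
    have "?g (x(p := 0)) = (\<lambda>_. 0) x"
      by (rule coordinate_cancel[where j = q and I = I, OF upd[OF g] subalgebra_gen.const pq(2)])
         (use eq[of "_(p := 0)"] pq(3) in simp)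
    then show ?thesis by simp
  qed
  then obtain h where h: "h \<in> R" "\<And>x. ?g x = x p * h x"
    using coordinate_dvd[OF g pq(1)] by blast
  have "g x = x p * h x" if "x \<in> X" for x using h(2)[of x] that by (simp add: X_F)
  then show ?thesis using h(1) by blast
qed

text \<open>The variety is rational: where \<open>b u v \<noteq> 0\<close> it is parametrised by \<open>b = A - \<iota> B\<close> and all
  coordinates other than \<open>x0\<close> and \<open>y0\<close>, because \<open>(A + \<iota> B) (A - \<iota> B) = - P\<close>.
  The slot \<open>x0\<close> of a parameter stores \<open>b\<close>.\<close>

lemma no_zero_divisors_X:
  assumes f: "f \<in> R" and g: "g \<in> R" and fg: "\<And>x. x \<in> X \<Longrightarrow> f x * g x = 0"
  shows "(\<forall>x\<in>X. f x = 0) \<or> (\<forall>x\<in>X. g x = 0)"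
proof -
  obtain \<iota> :: 'k where \<iota>: "\<iota> ^ 2 = - 1" using nth_root_exists[of 2 "-1"] by auto
  then have \<iota>0: "\<iota> \<noteq> 0" by auto
  define v :: "('i \<Rightarrow> 'k) \<Rightarrow> 'k" where "v = mon (J1 - {y0}) \<mu>"
  have B_v: "B x = x y0 * v x" for x
    using mon_remove[OF finite_blocks(2) y0(1), of \<mu> x] by (simp add: y0 v_def)
  define w where "w p = p x0 * u p * v p" for p
  \<comment> \<open>This solves A - \<iota> B = b and A + \<iota> B = - P / b for A and B, and then
    divides by \<open>u\<close> and \<open>v\<close>.\<close>
  define \<psi> where "\<psi> p = p(x0 := (p x0 ^ 2 - P p) / (2 * u p * p x0),
                         y0 := - (P p + p x0 ^ 2) / (2 * \<iota> * v p * p x0))" for p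
  have uv: "u \<in> R" "v \<in> R" by (auto simp: u_def v_def I_eq intro!: mon_poly)
  have x0y0: "x0 \<notin> J1" "x0 \<notin> J2" "y0 \<notin> J0" "y0 \<notin> J2" "y0 \<noteq> x0"
    using x0 y0 disjoint by auto
  have inv: "u (p(x0 := c, y0 := d)) = u p" "v (p(x0 := c, y0 := d)) = v p" "P (p(x0 := c, y0 := d)) = P p" for p c d
    using x0y0 by (auto simp: u_def v_def mon_upd)
  have wR: "w \<in> R"
    unfolding w_def[abs_def] by (intro subalgebra_gen_intros subalgebra_gen_coordinate blocks_subset uv)
  have F\<psi>: "F (\<psi> p) = 0" if "w p \<noteq> 0" for p
  proof -
    have nz: "u p \<noteq> 0" "v p \<noteq> 0" "p x0 \<noteq> 0" using that by (auto simp: w_def)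
    have "A (\<psi> p) = (p x0 ^ 2 - P p) / (2 * p x0)"
      using nz x0y0 by (simp add: A_u \<psi>_def inv)
    moreover define t where "t = P p + p x0 ^ 2"
    have "B (\<psi> p) = - t / (2 * \<iota> * p x0)"
      using nz x0y0 by (simp add: B_v \<psi>_def inv t_def)
    moreover have "P (\<psi> p) = P p" by (simp add: \<psi>_def inv)
    ultimately have "F (\<psi> p) = (p x0 ^ 2 - P p) ^ 2 / (2 * p x0) ^ 2
        + t ^ 2 / (\<iota> ^ 2 * (2 * p x0) ^ 2) + P p"
      by (simp add: F_def power_divide power_mult_distrib)
    also have "\<dots> = 0" unfolding \<iota> t_def using nz by (simp add: field_simps power2_eq_square)
    finally show ?thesis .
  qed
  \<comment> \<open>Pulled back along the parametrization, every polynomial function becomes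
    polynomial after multiplication by a power of \<open>w\<close>, the common denominator.\<close>
  have clear: "\<exists>k. \<exists>f'\<in>R. \<forall>p. w p \<noteq> 0 \<longrightarrow> f (\<psi> p) * w p ^ k = f' p" if "f \<in> R" for f
    using that
  proof induction
    case (const c)
    show ?case by (rule exI[of _ 0], rule bexI[of _ "\<lambda>_. c"]) (auto intro: subalgebra_gen.const)
  next
    case (gen f)
    then obtain i where i: "f = (\<lambda>x. x i)" "i \<in> I" by (auto simp: coordinates_def)
    consider "i = x0" | "i = y0" | "i \<noteq> x0" "i \<noteq> y0" by blast
    then show ?case
    proof cases
      case 1
      have "(\<lambda>p. (p x0 ^ 2 - P p) * v p * (1 / 2)) \<in> R"
        by (intro subalgebra_gen_intros subalgebra_gen_coordinate blocks_subset uv ABP_poly)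
      from bexI[OF _ this] show ?thesis
        by (rule exI[of _ 1]) (use x0y0 in \<open>auto simp: i 1 \<psi>_def w_def\<close>)
    next
      case 2
      have "(\<lambda>p. - (P p + p x0 ^ 2) * u p * (1 / (2 * \<iota>))) \<in> R"
        by (intro subalgebra_gen_intros subalgebra_gen_coordinate blocks_subset uv ABP_poly)
      from bexI[OF _ this] show ?thesis
        by (rule exI[of _ 1]) (use x0y0 \<iota>0 in \<open>auto simp: i 2 \<psi>_def w_def field_simps\<close>)
    next
      case 3
      show ?thesis
        by (rule exI[of _ 0], rule bexI[of _ f])
           (use 3 in \<open>auto simp: i \<psi>_def intro!: subalgebra_gen_coordinate\<close>)
    qed
  next
    case (add f g)
    then obtain k f' l g' where *: "f' \<in> R" "g' \<in> R" "\<And>p. w p \<noteq> 0 \<Longrightarrow> f (\<psi> p) * w p ^ k = f' p"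
      "\<And>p. w p \<noteq> 0 \<Longrightarrow> g (\<psi> p) * w p ^ l = g' p" by blast
    show ?case
      by (rule exI[of _ "k + l"], rule bexI[of _ "\<lambda>p. w p ^ l * f' p + w p ^ k * g' p"])
         (auto simp: *(3,4)[symmetric] power_add algebra_simps intro!: subalgebra_gen_intros wR *(1,2))
  next
    case (mult f g)
    then obtain k f' l g' where *: "f' \<in> R" "g' \<in> R" "\<And>p. w p \<noteq> 0 \<Longrightarrow> f (\<psi> p) * w p ^ k = f' p"
      "\<And>p. w p \<noteq> 0 \<Longrightarrow> g (\<psi> p) * w p ^ l = g' p" by blast
    show ?case
      by (rule exI[of _ "k + l"], rule bexI[of _ "\<lambda>p. f' p * g' p"])
         (auto simp: *(3,4)[symmetric] power_add algebra_simps intro!: subalgebra_gen_intros *(1,2))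
  qed
  define b where "b x = A x - \<iota> * B x" for x
  have dense: "\<forall>x\<in>X. h x = 0" if h: "h \<in> R" and h0: "\<And>p. w p \<noteq> 0 \<Longrightarrow> h (\<psi> p) = 0" for h
  proof -
    have bR: "b \<in> R" unfolding b_def[abs_def] by (intro subalgebra_gen_intros ABP_poly)
    have pt: "h x = 0" if x: "x \<in> X" "b x \<noteq> 0" "u x \<noteq> 0" "v x \<noteq> 0" for x
    proof -
      let ?p = "x(x0 := b x)"
      have inv': "u ?p = u x" "v ?p = v x" "P ?p = P x"
        using x0y0 by (simp_all add: u_def v_def mon_upd)
      define a where "a = A x + \<iota> * B x"
      have P: "P x = - a * b x"
        using X_zero[OF x(1)] \<iota> unfolding b_def a_def by algebra
      have "(b x ^ 2 - P x) / (2 * u x * b x) = (b x + a) / (2 * u x)"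
        "- (P x + b x ^ 2) / (2 * \<iota> * v x * b x) = (a - b x) / (2 * \<iota> * v x)"
        using x \<iota>0 by (simp_all add: P field_simps power2_eq_square)
      then have "\<psi> ?p = x(x0 := (b x + a) / (2 * u x), y0 := (a - b x) / (2 * \<iota> * v x))"
        using x0y0 by (simp add: \<psi>_def inv' fun_eq_iff)
      also have "\<dots> = x"
        using x \<iota>0 x0y0 by (simp add: fun_eq_iff b_def a_def A_u B_v)
      finally have "\<psi> ?p = x" .
      moreover have "w ?p \<noteq> 0" using x by (simp add: w_def inv')
      ultimately show ?thesis using h0 by metis
    qed
    \<comment> \<open>\<open>b\<close> is not a monomial, but it divides \<open>P\<close> on
      \<open>X\<close>. So the product of \<open>P\<close>, \<open>u\<close>, \<open>v\<close> and
      \<open>h\<close> vanishes on \<open>X\<close>, and monomials cancel there.\<close>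
    have "mon J2 \<mu> x * (mon (J0 - {x0}) \<mu> x * (mon (J1 - {y0}) \<mu> x * h x)) = 0" if "x \<in> X" for x
    proof -
      have "b x * u x * v x * h x = 0" using pt[OF that] by auto
      moreover have "P x = - (A x + \<iota> * B x) * b x"
        using X_zero[OF that] \<iota> unfolding b_def by algebra
      ultimately show ?thesis unfolding u_def v_def by algebra
    qed note z = this
    have hR: "(\<lambda>x. mon (J1 - {y0}) \<mu> x * h x) \<in> R"
      by (intro subalgebra_gen_intros mon_poly h) (auto simp: I_eq)
    have hR2: "(\<lambda>x. mon (J0 - {x0}) \<mu> x * (mon (J1 - {y0}) \<mu> x * h x)) \<in> R"
      by (intro subalgebra_gen_intros mon_poly hR) (auto simp: I_eq)
    have "mon (J0 - {x0}) \<mu> x * (mon (J1 - {y0}) \<mu> x * h x) = 0" if "x \<in> X" for x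
      by (rule mon_cancel_X[OF blocks_subset(3) hR2 z that])
    note z = this
    have S: "J0 - {x0} \<subseteq> I" "J1 - {y0} \<subseteq> I" using blocks_subset by auto
    have "mon (J1 - {y0}) \<mu> x * h x = 0" if "x \<in> X" for x
      by (rule mon_cancel_X[OF S(1) hR z that])
    from mon_cancel_X[OF S(2) h this] show ?thesis by blast
  qed
  obtain k f' where f': "f' \<in> R" "\<And>p. w p \<noteq> 0 \<Longrightarrow> f (\<psi> p) * w p ^ k = f' p"
    using clear[OF f] by blast
  obtain l g' where g': "g' \<in> R" "\<And>p. w p \<noteq> 0 \<Longrightarrow> g (\<psi> p) * w p ^ l = g' p"
    using clear[OF g] by blast
  have "f' p * (w p * g' p) = 0" for p
  proof (cases "w p = 0")
    case False
    have "f (\<psi> p) * g (\<psi> p) = 0"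
      by (rule vanish_X[OF subalgebra_gen.mult[OF f g] fg F\<psi>[OF False]])
    then show ?thesis using f'(2)[OF False] g'(2)[OF False] by auto
  qed auto
  then have "(\<forall>p. f' p = 0) \<or> (\<forall>p. w p * g' p = 0)"
    by (intro subalgebra_gen_no_zero_divisors[where I = I] subalgebra_gen_intros f' g' wR)
  then show ?thesis
  proof
    assume "\<forall>p. f' p = 0"
    then show ?thesis using f' by (intro disjI1 dense f) auto
  next
    assume "\<forall>p. w p * g' p = 0"
    then have "g (\<psi> p) = 0" if "w p \<noteq> 0" for p
      using g'(2)[OF that] that by (metis mult_eq_0_iff power_not_zero)
    then show ?thesis by (intro disjI2 dense g)
  qed
qed

end

section \<open>A Mason-Stothers estimate\<close>

text \<open>Induction produces eta-expanded hypotheses; the pointwise rules would then unfold the ring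
  operations of the function algebra under the abstraction.\<close>

lemmas fun_apply = plus_fun_apply times_fun_apply zero_fun_apply one_fun_apply

declare fun_apply [simp del]

section \<open>Monomials in the coordinate ring\<close>

context trinomial
begin

lemma res_apply: "x \<in> X \<Longrightarrow> res p x = p x" "x \<notin> X \<Longrightarrow> res p x = 0"
  by (simp_all add: res_def)

lemma KX_res: "f \<in> KX \<longleftrightarrow> (\<exists>p\<in>R. f = res p)"
  by (auto simp: coordinate_subring_def res_def)

lemma res_in_KX: "p \<in> R \<Longrightarrow> res p \<in> KX"
  by (auto simp: KX_res)

lemma res_add: "res p + res q = res (\<lambda>x. p x + q x)"
  and res_mult: "res p * res q = res (\<lambda>x. p x * q x)"
  and res_scale: "(\<lambda>x. c * res p x) = res (\<lambda>x. c * p x)"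
  by (auto simp: res_def fun_eq_iff fun_apply)

lemma res_eq_iff: "res p = res q \<longleftrightarrow> (\<forall>x\<in>X. p x = q x)"
  by (auto simp: res_def fun_eq_iff fun_apply)

lemma res_eq_0_iff: "res p = 0 \<longleftrightarrow> (\<forall>x\<in>X. p x = 0)"
  by (auto simp: res_def fun_eq_iff fun_apply)

lemma KX_closed:
  shows "0 \<in> KX" and "f \<in> KX \<Longrightarrow> g \<in> KX \<Longrightarrow> f + g \<in> KX"
    and "f \<in> KX \<Longrightarrow> g \<in> KX \<Longrightarrow> f * g \<in> KX" and "f \<in> KX \<Longrightarrow> (\<lambda>x. c * f x) \<in> KX"
    and "f \<in> KX \<Longrightarrow> g \<in> KX \<Longrightarrow> f * g = 0 \<Longrightarrow> f = 0 \<or> g = 0"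
proof -
  show "0 \<in> KX" by (auto simp: KX_res res_def fun_eq_iff fun_apply intro!: bexI[of _ "\<lambda>_. 0"] subalgebra_gen.const)
  show "f \<in> KX \<Longrightarrow> g \<in> KX \<Longrightarrow> f + g \<in> KX" "f \<in> KX \<Longrightarrow> g \<in> KX \<Longrightarrow> f * g \<in> KX"
    unfolding KX_res by (auto simp: res_add res_mult intro: subalgebra_gen.intros)
  show "f \<in> KX \<Longrightarrow> (\<lambda>x. c * f x) \<in> KX"
    unfolding KX_res using subalgebra_gen.mult[OF subalgebra_gen.const] by (metis res_scale)
  show "f \<in> KX \<Longrightarrow> g \<in> KX \<Longrightarrow> f * g = 0 \<Longrightarrow> f = 0 \<or> g = 0"
    unfolding KX_res using no_zero_divisors_X by (force simp: res_mult res_eq_0_iff)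
qed

lemma lnd_domain_KX: "locally_nilpotent_derivation KX D \<Longrightarrow> lnd_domain KX D"
  by unfold_locales (auto simp: KX_closed(1-4) dest: KX_closed(5))

definition T :: "'i \<Rightarrow> ('i \<Rightarrow> 'k) \<Rightarrow> 'k" where "T i = res (\<lambda>x. x i)"

definition M :: "'i set \<Rightarrow> ('i \<Rightarrow> nat) \<Rightarrow> ('i \<Rightarrow> 'k) \<Rightarrow> 'k" where "M S e = res (mon S e)"

abbreviation unit :: "('i \<Rightarrow> 'k) \<Rightarrow> 'k" where "unit \<equiv> res (\<lambda>_. 1)"

lemma T_in_KX: "i \<in> I \<Longrightarrow> T i \<in> KX"
  by (simp add: T_def res_in_KX subalgebra_gen_coordinate)

lemma M_in_KX: "S \<subseteq> I \<Longrightarrow> M S e \<in> KX"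
  by (simp add: M_def res_in_KX mon_poly)

lemma unit_in_KX: "unit \<in> KX"
  by (simp add: res_in_KX subalgebra_gen.const)

lemma unit_mult: "f \<in> KX \<Longrightarrow> unit * f = f"
  by (auto simp: KX_res res_mult)

text \<open>\<open>x0\<close> and \<open>y0\<close> occur with exponent one and the ground field has
  roots, so these two coordinates and one of \<open>J2\<close> suffice to prescribe the three
  monomials.\<close>

lemma point_exists:
  fixes a b c :: 'k
  assumes "a ^ 2 + b ^ 2 + c = 0" and q: "q \<in> J2"
  shows "\<exists>x\<in>X. A x = a \<and> B x = b \<and> P x = c \<and> x x0 = a \<and> x y0 = b \<and> x q ^ \<mu> q = c \<and>
    (\<forall>i\<in>I - {x0, y0, q}. x i = 1)"
proof -
  have "\<mu> q > 0" using \<mu>_ge2[OF q] by simp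
  then obtain d where d: "d ^ \<mu> q = c" using nth_root_exists by blast
  define x where "x = (\<lambda>i\<in>I. if i = x0 then a else if i = y0 then b else if i = q then d else 1)"
  have ne: "x0 \<notin> J1" "x0 \<notin> J2" "y0 \<notin> J0" "y0 \<notin> J2" "q \<notin> J0" "q \<notin> J1" "x0 \<noteq> q" "y0 \<noteq> q" "x0 \<noteq> y0"
    "x0 \<in> I" "y0 \<in> I" "q \<in> I"
    using x0 y0 q disjoint blocks_subset by (auto simp: I_eq)
  have xv: "x x0 = a" "x y0 = b" "x q = d" "\<And>i. i \<in> I \<Longrightarrow> i \<noteq> x0 \<Longrightarrow> i \<noteq> y0 \<Longrightarrow> i \<noteq> q \<Longrightarrow> x i = 1"
    using ne by (auto simp: x_def)
  have sub: "J0 - {x0} \<subseteq> I - {x0, y0, q}" "J1 - {y0} \<subseteq> I - {x0, y0, q}" "J2 - {q} \<subseteq> I - {x0, y0, q}"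
    using ne blocks_subset by auto
  have "mon (J0 - {x0}) \<mu> x = 1" "mon (J1 - {y0}) \<mu> x = 1" "mon (J2 - {q}) \<mu> x = 1"
    unfolding mon_def by (rule prod.neutral, use sub xv(4) in fastforce)+
  then have "A x = a" "B x = b" "P x = c"
    using x0 y0 q mon_remove[OF finite_blocks(1) x0(1), of \<mu> x]
      mon_remove[OF finite_blocks(2) y0(1), of \<mu> x] mon_remove[OF finite_blocks(3) q, of \<mu> x]
    by (simp_all add: xv(1-3) d)
  moreover from this have "x \<in> X"
    using assms by (auto simp: X_F F_def affine_space_def x_def)
  ultimately show ?thesis
    using ne xv d by (intro bexI[of _ x]) auto
qed

lemma nonzero_point: "\<exists>x\<in>X. \<forall>i\<in>I. x i \<noteq> 0"
proof -
  obtain q where q: "q \<in> J2" using J2_ne by blast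
  obtain x where x: "x \<in> X" "x x0 = 1" "x y0 = 1" "x q ^ \<mu> q = - 2" "\<forall>i\<in>I - {x0, y0, q}. x i = 1"
    using point_exists[of 1 1 "- 2" q] q by auto
  have "x q \<noteq> 0" using x(4) \<mu>_ge2[OF q] by (auto simp: zero_power)
  then have "\<forall>i\<in>I. x i \<noteq> 0" using x by (metis DiffI insertE one_neq_zero singletonD)
  then show ?thesis using x(1) by blast
qed

lemma unit_nonzero: "unit \<noteq> 0"
  using nonzero_point by (auto simp: res_eq_0_iff)

lemma T_nonzero: "i \<in> I \<Longrightarrow> T i \<noteq> 0"
  using nonzero_point by (auto simp: T_def res_eq_0_iff)

lemma M_nonzero:
  assumes "S \<subseteq> I"
  shows "M S e \<noteq> 0"
proof -
  obtain x where "x \<in> X" "\<forall>i\<in>I. x i \<noteq> 0" using nonzero_point by blast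
  then have "mon S e x \<noteq> 0" using assms by (intro mon_nonzero) auto
  then show ?thesis using \<open>x \<in> X\<close> by (auto simp: M_def res_eq_0_iff)
qed

lemma KX_cancel:
  assumes "f \<in> KX" "g \<in> KX" "h \<in> KX" "h \<noteq> 0" "h * f = h * g"
  shows "f = g"
proof -
  have "f - g \<in> KX" using KX_closed(2)[OF assms(1) KX_closed(4)[OF assms(2), of "-1"]]
    by (simp add: fun_diff_def plus_fun_def)
  moreover have "h * (f - g) = 0" using assms(5) by (simp add: right_diff_distrib)
  ultimately show ?thesis using KX_closed(5)[of h "f - g"] assms by simp
qed

lemma M_empty: "M {} e = unit"
  by (simp add: M_def mon_def[abs_def])

lemma M_insert: "i \<in> I \<Longrightarrow> finite S \<Longrightarrow> i \<notin> S \<Longrightarrow> M (insert i S) e = res (\<lambda>x. x i ^ e i) * M S e"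
  by (auto simp: M_def res_mult res_eq_iff mon_insert)

text \<open>Multiplying by one coordinate at a time avoids a separate induction over exponents in
  each use.\<close>

lemma M_induct [consumes 1, case_names unit mult]:
  assumes S: "S \<subseteq> I" and unit: "Q unit"
    and mult: "\<And>i f. i \<in> S \<Longrightarrow> f \<in> KX \<Longrightarrow> Q f \<Longrightarrow> Q (T i * f)"
  shows "Q (M S e)"
proof -
  have "finite S" using S finite_I by (rule finite_subset)
  then have "finite S \<Longrightarrow> S' \<subseteq> S \<Longrightarrow> Q (M S' e)" for S'
  proof (induction S' rule: infinite_finite_induct)
    case (insert i S')
    have "Q (res (\<lambda>x. x i ^ n) * M S' e)" for n
    proof (induction n)
      case 0
      have "res (\<lambda>x. x i ^ 0) * M S' e = M S' e"
        using insert S by (auto intro!: unit_mult M_in_KX)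
      then show ?case using insert by simp
    next
      case (Suc n)
      have "res (\<lambda>x. x i ^ Suc n) * M S' e = T i * (res (\<lambda>x. x i ^ n) * M S' e)"
        by (simp add: T_def M_def res_mult mult.assoc)
      moreover have "res (\<lambda>x. x i ^ n) * M S' e \<in> KX"
        using insert.prems S
        by (intro KX_closed M_in_KX res_in_KX subalgebra_gen_power subalgebra_gen_coordinate) auto
      moreover have "i \<in> S" using insert.prems by simp
      ultimately show ?case using mult[OF _ _ Suc, of i] by (simp only:)
    qed
    then show ?case using M_insert[of i S' e] insert S by auto
  qed (auto simp: M_empty unit dest: finite_subset)
  then show ?thesis using \<open>finite S\<close> by blast
qed

text \<open>K[X] need not be factorial; this replaces unique factorization for monomials in
  different blocks. For a single coordinate of \<open>S\<close> the coordinates of \<open>S'\<close>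
  are peeled off by \<open>coordinate_coprime\<close>; then those of \<open>S\<close> follow by
  cancellation.\<close>

lemma M_coprime:
  assumes S: "S \<subseteq> I" "S' \<subseteq> I" and sep: "\<And>p q. p \<in> S \<Longrightarrow> q \<in> S' \<Longrightarrow> separated p q"
    and fg: "f \<in> KX" "g \<in> KX" "M S e * f = M S' e' * g"
  shows "\<exists>h\<in>KX. g = M S e * h"
proof -
  have single: "\<exists>h\<in>KX. g = T p * h" if p: "p \<in> S" and "f \<in> KX" "g \<in> KX" "T p * f = M S' e' * g" for p f g
    using S(2) that(2-)
  proof (induction arbitrary: f g rule: M_induct)
    case unit
    then show ?case using unit_mult[of g] by (intro bexI[of _ f]) simp_all
  next
    case (mult q m)
    obtain f' where f': "f' \<in> R" "f = res f'" using mult.prems by (auto simp: KX_res)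
    obtain g' where g': "g' \<in> R" "m * g = res g'"
      using KX_closed(3)[OF mult.hyps(2) mult.prems(2)] by (auto simp: KX_res)
    have "T p * f = T q * (m * g)" using mult.prems by (simp add: mult.assoc)
    then have "\<And>x. x \<in> X \<Longrightarrow> x p * f' x = x q * g' x"
      by (simp add: f' g' T_def res_mult res_eq_iff)
    then obtain h where "h \<in> R" "\<forall>x\<in>X. g' x = x p * h x"
      using coordinate_coprime[OF sep[OF p mult.hyps(1)] f'(1) g'(1)] by blast
    then have "m * g = T p * res h" "res h \<in> KX"
      by (auto simp: g' T_def res_mult res_eq_iff res_in_KX)
    then show ?case using mult.IH[of "res h" g] mult.prems by simp
  qed
  show ?thesis using S(1) fg
  proof (induction arbitrary: f g rule: M_induct)
    case unit
    then show ?case using unit_mult[of g] by (intro bexI[of _ g]) simp_all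
  next
    case (mult p m)
    have p: "p \<in> I" using mult.hyps S by blast
    have "T p * (m * f) = M S' e' * g" using mult.prems by (simp add: mult.assoc)
    then obtain h where h: "h \<in> KX" "g = T p * h"
      using single[OF mult.hyps(1) KX_closed(3)[OF mult.hyps(2) mult.prems(1)] mult.prems(2)] by blast
    have "T p * (m * f) = T p * (M S' e' * h)"
      using mult.prems h by (simp add: mult_ac)
    then have "m * f = M S' e' * h"
      by (rule KX_cancel[rotated 4])
        (intro KX_closed mult M_in_KX S h T_in_KX T_nonzero p)+
    then obtain h' where "h' \<in> KX" "h = m * h'" using mult.IH mult.prems h by blast
    then show ?case using h by (auto simp: mult_ac)
  qed
qed

lemma M_split: "(\<And>i. i \<in> S \<Longrightarrow> e i = e1 i + e2 i) \<Longrightarrow> M S e = M S e1 * M S e2"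
  by (auto simp: M_def res_mult res_eq_iff mon_def power_add prod.distrib intro!: prod.cong)

lemma M_factor:
  assumes "S \<subseteq> I" "i \<in> S" "1 \<le> e i"
  shows "\<exists>m\<in>KX. M S e = T i * m"
proof -
  have S: "finite S" using assms(1) finite_I by (rule finite_subset)
  have "mon (S - {i}) (e(i := e i - 1)) x = mon (S - {i}) e x" for x :: "'i \<Rightarrow> 'k"
    by (auto simp: mon_def intro!: prod.cong)
  then have "mon S (e(i := e i - 1)) x = x i ^ (e i - 1) * mon (S - {i}) e x" for x :: "'i \<Rightarrow> 'k"
    using mon_remove[OF S assms(2), of "e(i := e i - 1)" x] by simp
  moreover have "x i ^ e i = x i * x i ^ (e i - 1)" for x :: "'i \<Rightarrow> 'k"
    using assms(3) power_Suc[of "x i" "e i - 1"] by simp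
  ultimately have "mon S e x = x i * mon S (e(i := e i - 1)) x" for x :: "'i \<Rightarrow> 'k"
    using mon_remove[OF S assms(2), of e x] by (metis mult.assoc)
  then have "M S e = T i * M S (e(i := e i - 1))"
    by (auto simp: M_def T_def res_mult res_eq_iff)
  then show ?thesis using M_in_KX[OF assms(1)] by blast
qed

abbreviation "AX \<equiv> M J0 \<mu>"
abbreviation "BX \<equiv> M J1 \<mu>"
abbreviation "PX \<equiv> M J2 \<mu>"

lemma ABPX: "AX \<in> KX" "BX \<in> KX" "PX \<in> KX" "AX \<noteq> 0" "BX \<noteq> 0" "PX \<noteq> 0"
  by (simp_all add: M_in_KX M_nonzero blocks_subset)

lemma trinomial_X: "AX * AX + BX * BX + PX = 0"
  by (auto simp: M_def res_def fun_eq_iff fun_apply power2_eq_square dest!: X_zero)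

lemma PX_eq: "PX = - (AX * AX + BX * BX)"
  using trinomial_X add_eq_0_iff by blast

end

section \<open>Derivations of the coordinate ring\<close>

locale trinomial_lnd = trinomial J0 J1 J2 \<mu> x0 y0 X I
  for J0 J1 J2 :: "'i set" and \<mu> :: "'i \<Rightarrow> nat" and x0 y0 :: 'i
    and X :: "('i \<Rightarrow> 'k::{alg_closed_field, field_char_0}) set" and I +
  fixes D
  assumes lnd_KX: "locally_nilpotent_derivation KX D"
begin

sublocale lnd_domain KX D
  by (rule lnd_domain_KX[OF lnd_KX])

text \<open>The unit is the indicator function of \<open>X\<close>; being idempotent, its degree is
  twice itself, hence zero.\<close>

lemma D_unit: "D unit = 0"
proof -
  have "deg (unit * unit) = deg unit + deg unit"
    by (intro deg_mult unit_in_KX unit_nonzero)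
  then have "deg unit = 0" by (simp add: unit_mult unit_in_KX)
  then show ?thesis by (simp add: deg_eq_0_iff unit_in_KX)
qed

lemma D_const: "D (res (\<lambda>_. c)) = 0"
proof -
  have "res (\<lambda>_. c) = (\<lambda>x. c * unit x)" by (simp add: res_scale)
  then have "D (res (\<lambda>_. c)) = (\<lambda>x. c * D unit x)" by (simp only: D_scale[OF unit_in_KX])
  then show ?thesis by (simp add: D_unit fun_eq_iff fun_apply)
qed

lemma D_eq_0_if_coordinates:
  assumes "\<And>i. i \<in> I \<Longrightarrow> D (T i) = 0" "f \<in> KX"
  shows "D f = 0"
proof -
  obtain p where p: "p \<in> R" "f = res p" using assms(2) by (auto simp: KX_res)
  have "D (res p) = 0" using p(1)
  proof induction
    case (gen f)
    then show ?case using assms(1) by (auto simp: coordinates_def T_def)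
  next
    case (add f g)
    then show ?case using D_add[OF res_in_KX res_in_KX, of f g] by (simp add: res_add)
  next
    case (mult f g)
    then show ?case using D_mult[OF res_in_KX res_in_KX, of f g] by (simp add: res_mult)
  qed (rule D_const)
  then show ?thesis using p by simp
qed

lemma deg_power: "i \<in> I \<Longrightarrow> deg (res (\<lambda>x. x i ^ n)) = n * deg (T i)"
proof (induction n)
  case 0
  then show ?case by (simp add: deg_eq_0_iff unit_in_KX D_unit)
next
  case (Suc n)
  have eq: "res (\<lambda>x. x i ^ Suc n) = T i * res (\<lambda>x. x i ^ n)" by (simp add: T_def res_mult)
  have "res (\<lambda>x. x i ^ n) \<noteq> 0" using nonzero_point Suc.prems by (auto simp: res_eq_0_iff)
  then show ?case
    unfolding eq using Suc
    by (subst deg_mult) (simp_all add: T_in_KX T_nonzero res_in_KX subalgebra_gen_power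
        subalgebra_gen_coordinate)
qed

lemma deg_M: "S \<subseteq> I \<Longrightarrow> deg (M S e) = (\<Sum>i\<in>S. e i * deg (T i))"
proof (induction S rule: infinite_finite_induct)
  case (infinite S)
  then show ?case using finite_I finite_subset by blast
next
  case empty
  then show ?case by (simp add: M_empty deg_eq_0_iff unit_in_KX D_unit)
next
  case (insert i S)
  have "res (\<lambda>x. x i ^ e i) \<noteq> 0" using nonzero_point insert.prems by (auto simp: res_eq_0_iff)
  then show ?case
    using insert by (subst M_insert)
      (auto simp: deg_power M_in_KX M_nonzero res_in_KX subalgebra_gen_power
        subalgebra_gen_coordinate deg_mult)
qed

lemma D_power_dvd: "i \<in> I \<Longrightarrow> \<exists>h\<in>KX. D (res (\<lambda>x. x i ^ n)) = res (\<lambda>x. x i ^ (n - 1)) * h"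
proof (induction n)
  case 0
  then show ?case using D_unit by (intro bexI[of _ 0] zero_closed) simp
next
  case (Suc n)
  have r: "res (\<lambda>x. x i ^ n) \<in> KX" for n
    using Suc.prems by (intro res_in_KX subalgebra_gen_power subalgebra_gen_coordinate)
  have Ti: "T i \<in> KX" using Suc.prems by (rule T_in_KX)
  obtain h where h: "h \<in> KX" "D (res (\<lambda>x. x i ^ n)) = res (\<lambda>x. x i ^ (n - 1)) * h"
    using Suc by blast
  have eq: "res (\<lambda>x. x i ^ Suc n) = T i * res (\<lambda>x. x i ^ n)" by (simp add: T_def res_mult)
  have D: "D (res (\<lambda>x. x i ^ Suc n)) = T i * (res (\<lambda>x. x i ^ (n - 1)) * h) + D (T i) * res (\<lambda>x. x i ^ n)"
    unfolding eq by (simp add: D_mult Ti r h)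
  show ?case
  proof (cases n)
    case 0
    then have "D (res (\<lambda>x. x i ^ Suc n)) = res (\<lambda>x. x i ^ (Suc n - 1)) * D (T i)"
      unfolding eq by (simp add: D_mult Ti D_unit unit_in_KX mult.commute)
    then show ?thesis using D_closed[OF Ti] by blast
  next
    case (Suc m)
    have m: "res (\<lambda>x. x i ^ Suc m) = T i * res (\<lambda>x. x i ^ m)" by (simp add: T_def res_mult)
    have "D (res (\<lambda>x. x i ^ Suc n)) = res (\<lambda>x. x i ^ (Suc n - 1)) * (h + D (T i))"
      unfolding D unfolding Suc diff_Suc_1 m by (simp only: algebra_simps)
    then show ?thesis using D_closed[OF Ti] h(1) add_closed by blast
  qed
qed

text \<open>This is the part of a monomial that a derivation cannot remove: lowering each positive
  exponent by one leaves a common factor of the monomial and its image.\<close>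

lemma D_M_dvd: "S \<subseteq> I \<Longrightarrow> \<exists>h\<in>KX. D (M S e) = M S (\<lambda>i. e i - 1) * h"
proof (induction S rule: infinite_finite_induct)
  case (infinite S)
  then show ?case using finite_I finite_subset by blast
next
  case empty
  then show ?case using D_unit by (intro bexI[of _ 0] zero_closed) (simp add: M_empty)
next
  case (insert i S)
  then have i: "i \<in> I" "S \<subseteq> I" by auto
  have r: "res (\<lambda>x. x i ^ n) \<in> KX" for n
    using i by (intro res_in_KX subalgebra_gen_power subalgebra_gen_coordinate)
  obtain h where h: "h \<in> KX" "D (M S e) = M S (\<lambda>i. e i - 1) * h" using insert by auto
  obtain h' where h': "h' \<in> KX" "D (res (\<lambda>x. x i ^ e i)) = res (\<lambda>x. x i ^ (e i - 1)) * h'"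
    using D_power_dvd[OF i(1)] by blast
  let ?c = "M S (\<lambda>i. min (e i) 1)" and ?d = "res (\<lambda>x. x i ^ (min (e i) 1))"
  have M: "M S e = M S (\<lambda>i. e i - 1) * ?c" by (rule M_split) auto
  have d: "res (\<lambda>x. x i ^ e i) = res (\<lambda>x. x i ^ (e i - 1)) * ?d"
    by (cases "e i") (auto simp: res_mult mult.commute)
  have "D (M (insert i S) e) = res (\<lambda>x. x i ^ e i) * D (M S e) + D (res (\<lambda>x. x i ^ e i)) * M S e"
    using insert i by (simp add: M_insert D_mult r M_in_KX)
  also have "\<dots> = res (\<lambda>x. x i ^ (e i - 1)) * ?d * (M S (\<lambda>i. e i - 1) * h)
      + res (\<lambda>x. x i ^ (e i - 1)) * h' * (M S (\<lambda>i. e i - 1) * ?c)"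
    unfolding h h' M[symmetric] d[symmetric] ..
  also have "\<dots> = M (insert i S) (\<lambda>i. e i - 1) * (?d * h + h' * ?c)"
    using insert i by (simp add: M_insert algebra_simps)
  finally show ?case
    using i h h' r M_in_KX by (intro bexI[of _ "?d * h + h' * ?c"] add_closed mult_closed) auto
qed

lemma killed_if_M_killed:
  "S \<subseteq> I \<Longrightarrow> D (M S e) = 0 \<Longrightarrow> i \<in> S \<Longrightarrow> 1 \<le> e i \<Longrightarrow> D (T i) = 0"
  using M_factor[of S i e] ker_factor[OF T_in_KX, of i] M_nonzero[of S e] by auto

text \<open>The Wronskian of \<open>A\<close> and \<open>B\<close> up to sign; its degree will be
  bounded from both sides.\<close>

definition V :: "('i \<Rightarrow> 'k) \<Rightarrow> 'k" where "V = D AX * BX - AX * D BX"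

text \<open>Each monomial divided by its radical; by \<open>D_M_dvd\<close> it divides the
  derivative of the monomial too.\<close>

abbreviation "A' \<equiv> M J0 (\<lambda>i. \<mu> i - 1)"
abbreviation "B' \<equiv> M J1 (\<lambda>i. \<mu> i - 1)"
abbreviation "P' \<equiv> M J2 (\<lambda>i. \<mu> i - 1)"

lemma V_closed: "V \<in> KX"
  unfolding V_def by (intro diff_closed mult_closed D_closed ABPX)

lemma D_trinomial: "AX * D AX + AX * D AX + (BX * D BX + BX * D BX) + D PX = 0"
proof -
  have "D (AX * AX + BX * BX + PX) = 0" by (simp only: trinomial_X D_zero)
  then show ?thesis
    by (simp add: D_add D_mult add_closed mult_closed ABPX mult.commute add.assoc)
qed

text \<open>The relation and its derivative eliminate \<open>AX * AX\<close> and
  \<open>AX * D AX\<close>. What remains is an expression in \<open>BX\<close> and \<open>PX\<close>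
  that is divisible by \<open>P'\<close>.\<close>

lemma AX_V: "AX * V + AX * V = PX * D BX + PX * D BX - BX * D PX"
proof
  fix x
  have 1: "AX x * AX x + BX x * BX x + PX x = 0"
    using fun_cong[OF trinomial_X, of x] by (simp add: fun_apply)
  have 2: "AX x * D AX x + AX x * D AX x + (BX x * D BX x + BX x * D BX x) + D PX x = 0"
    using fun_cong[OF D_trinomial, of x] by (simp add: fun_apply)
  have p: "PX x = - (AX x * AX x + BX x * BX x)"
    using 1 add_eq_0_iff by blast
  have dp: "D PX x = - (AX x * D AX x + AX x * D AX x + (BX x * D BX x + BX x * D BX x))"
    using 2 add_eq_0_iff by blast
  show "(AX * V + AX * V) x = (PX * D BX + PX * D BX - BX * D PX) x"
    unfolding V_def plus_fun_apply times_fun_apply minus_apply p dp by (simp add: algebra_simps)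
qed

lemma split_blocks:
  assumes "S \<subseteq> I"
  obtains g where "g \<in> KX" "D (M S \<mu>) = M S (\<lambda>i. \<mu> i - 1) * g" "M S \<mu> = M S (\<lambda>i. \<mu> i - 1) * M S (\<lambda>_. 1)"
proof -
  have "M S \<mu> = M S (\<lambda>i. \<mu> i - 1) * M S (\<lambda>_. 1)"
    by (rule M_split) (use assms \<mu>_pos' in \<open>force\<close>)
  then show ?thesis using D_M_dvd[OF assms, of \<mu>] that by blast
qed

text \<open>The two expressions \<open>V = A'B'U\<close> and \<open>2 A V = 2 P D B - B D P\<close> show that \<open>P'\<close> divides
  \<open>A A' B' U\<close>, hence \<open>U\<close>: this is the Mason-Stothers argument, carried out in \<open>K[X]\<close>.\<close>

lemma V_cases:
  obtains (zero) "V = 0" "\<And>f. f \<in> KX \<Longrightarrow> D f = 0"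
  | (nonzero) "V \<noteq> 0" "deg A' + deg B' + deg P' \<le> deg V"
proof -
  obtain gA where gA: "gA \<in> KX" "D AX = A' * gA" "AX = A' * M J0 (\<lambda>_. 1)"
    using split_blocks[OF blocks_subset(1)] by blast
  obtain gB where gB: "gB \<in> KX" "D BX = B' * gB" "BX = B' * M J1 (\<lambda>_. 1)"
    using split_blocks[OF blocks_subset(2)] by blast
  obtain gP where gP: "gP \<in> KX" "D PX = P' * gP" "PX = P' * M J2 (\<lambda>_. 1)"
    using split_blocks[OF blocks_subset(3)] by blast
  let ?rA = "M J0 (\<lambda>_. 1)" and ?rB = "M J1 (\<lambda>_. 1)" and ?rP = "M J2 (\<lambda>_. 1)"
  note MK = M_in_KX[OF blocks_subset(1)] M_in_KX[OF blocks_subset(2)] M_in_KX[OF blocks_subset(3)]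
  note MN = M_nonzero[OF blocks_subset(1)] M_nonzero[OF blocks_subset(2)] M_nonzero[OF blocks_subset(3)]
  define U where "U = gA * ?rB - ?rA * gB"
  have U: "U \<in> KX" unfolding U_def by (intro diff_closed mult_closed gA gB MK)
  have V: "V = A' * (B' * U)"
    unfolding V_def U_def gA(2) gB(2) by (subst gA(3), subst gB(3)) (simp add: algebra_simps)
  have sep: "separated p q" if "p \<in> J2 \<and> q \<in> J0 \<or> p \<in> J2 \<and> q \<in> J1 \<or> p \<in> J0 \<and> q \<in> J1 \<or> p \<in> J1 \<and> q \<in> J0" for p q
    using that disjoint blocks_subset unfolding separated_def by blast
  show ?thesis
  proof (cases "U = 0")
    case True
    \<comment> \<open>If \<open>U\<close> vanishes, coprimality makes the radical divide
      \<open>g\<close>, so the whole monomial divides its own derivative; degrees then force that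
      derivative to be zero.\<close>
    have kill: "D (M S \<mu>) = 0"
      if S: "S \<subseteq> I" "S' \<subseteq> I" "\<And>p q. p \<in> S \<Longrightarrow> q \<in> S' \<Longrightarrow> separated p q"
        and g: "g \<in> KX" "D (M S \<mu>) = M S (\<lambda>i. \<mu> i - 1) * g" "M S \<mu> = M S (\<lambda>i. \<mu> i - 1) * M S (\<lambda>_. 1)"
        and g': "g' \<in> KX" "M S (\<lambda>_. 1) * g' = M S' (\<lambda>_. 1) * g" for S S' g g'
    proof (rule ccontr)
      assume nz: "D (M S \<mu>) \<noteq> 0"
      then have "g \<noteq> 0" using g(2) by auto
      obtain h where h: "h \<in> KX" "g = M S (\<lambda>_. 1) * h"
        using M_coprime[OF S g'(1) g(1) g'(2)] by blast
      have "deg g = deg (M S (\<lambda>_. 1)) + deg h"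
        unfolding h(2) by (intro deg_mult M_in_KX M_nonzero h(1) S(1)) (use h \<open>g \<noteq> 0\<close> in auto)
      moreover have "deg (D (M S \<mu>)) = deg (M S (\<lambda>i. \<mu> i - 1)) + deg g"
        unfolding g(2) using g(1) \<open>g \<noteq> 0\<close> S by (intro deg_mult M_in_KX M_nonzero)
      moreover have "deg (M S \<mu>) = deg (M S (\<lambda>i. \<mu> i - 1)) + deg (M S (\<lambda>_. 1))"
        by (subst g(3)) (use S in \<open>intro deg_mult M_in_KX M_nonzero\<close>)
      ultimately show False using deg_D[OF M_in_KX[OF S(1)] nz] by simp
    qed
    have eq: "?rA * gB = ?rB * gA" using True by (simp add: U_def mult.commute)
    have DA: "D AX = 0"
      by (rule kill[OF blocks_subset(1,2) _ gA gB(1) eq]) (use sep in blast)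
    have DB: "D BX = 0"
      by (rule kill[OF blocks_subset(2,1) _ gB gA(1) eq[symmetric]]) (use sep in blast)
    have DP: "D PX = 0" using D_trinomial DA DB by simp
    have "D (T i) = 0" if "i \<in> I" for i
      using that killed_if_M_killed[OF blocks_subset(1) DA] killed_if_M_killed[OF blocks_subset(2) DB]
        killed_if_M_killed[OF blocks_subset(3) DP] \<mu>_pos'[OF that] by (auto simp: I_eq)
    then have "\<And>f. f \<in> KX \<Longrightarrow> D f = 0" by (rule D_eq_0_if_coordinates)
    moreover have "V = 0" using V True by simp
    ultimately show ?thesis using zero by blast
  next
    case False
    have "P' * (?rP * gB * B' + ?rP * gB * B' - BX * gP) = AX * V + AX * V"
      unfolding AX_V gB(2) gP(2) by (subst gP(3))+ (simp add: algebra_simps)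
    also have "\<dots> = AX * (A' * (B' * (U + U)))" unfolding V by (simp add: algebra_simps)
    finally have eq: "P' * (?rP * gB * B' + ?rP * gB * B' - BX * gP) = AX * (A' * (B' * (U + U)))" .
    have UU: "U + U \<in> KX" by (intro add_closed U)
    have "\<exists>h\<in>KX. A' * (B' * (U + U)) = P' * h"
      by (rule M_coprime[OF blocks_subset(3,1) _ _ _ eq])
         (use sep in blast, (intro diff_closed add_closed mult_closed gB gP MK UU)+)
    then obtain h1 where h1: "h1 \<in> KX" "P' * h1 = A' * (B' * (U + U))" by metis
    have "\<exists>h\<in>KX. B' * (U + U) = P' * h"
      by (rule M_coprime[OF blocks_subset(3,1) _ h1(1) _ h1(2)])
         (use sep in blast, (intro mult_closed MK UU)+)
    then obtain h2 where h2: "h2 \<in> KX" "P' * h2 = B' * (U + U)" by metis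
    have "\<exists>h\<in>KX. U + U = P' * h"
      by (rule M_coprime[OF blocks_subset(3,2) _ h2(1) UU h2(2)]) (use sep in blast)
    then obtain h where h: "h \<in> KX" "U + U = P' * h" by metis
    have two: "U + U = (\<lambda>x. 2 * U x)" by (auto simp: fun_eq_iff fun_apply)
    have "U + U \<noteq> 0" using False by (auto simp: fun_eq_iff fun_apply)
    then have "h \<noteq> 0" using h by auto
    then have "deg (U + U) = deg P' + deg h" unfolding h(2) by (intro deg_mult MK MN h)
    then have "deg P' \<le> deg U" using deg_scale[OF U, of 2] by (simp add: two)
    moreover have "V \<noteq> 0"
      using False no_zero_divisors[of A' "B' * U"] no_zero_divisors[of B' U] U MK MN mult_closed
      unfolding V by metis
    moreover have "B' * U \<noteq> 0" using \<open>V \<noteq> 0\<close> unfolding V by auto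
    then have "deg V = deg A' + (deg B' + deg U)"
      unfolding V using False by (simp add: deg_mult MK MN U mult_closed)
    ultimately show ?thesis using nonzero by simp
  qed
qed

text \<open>The alternatives \<open>f = 0 \<or> deg f < n\<close> express a strict bound under the
  convention that 0 has degree minus infinity.\<close>

lemma deg_less_add: "f \<in> KX \<Longrightarrow> g \<in> KX \<Longrightarrow> f = 0 \<or> deg f < n \<Longrightarrow> g = 0 \<or> deg g < n \<Longrightarrow> f + g = 0 \<or> deg (f + g) < n"
  using deg_add_le[of f g] by auto

lemma deg_less_diff: "f \<in> KX \<Longrightarrow> g \<in> KX \<Longrightarrow> f = 0 \<or> deg f < n \<Longrightarrow> g = 0 \<or> deg g < n \<Longrightarrow> f - g = 0 \<or> deg (f - g) < n"
  using deg_less_add[of f "- g" n] uminus_closed[of g] deg_uminus[of g] by auto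

lemma deg_mult_D: "f \<in> KX \<Longrightarrow> g \<in> KX \<Longrightarrow> f * D g = 0 \<or> deg (f * D g) < deg f + deg g"
  by (cases "f = 0 \<or> D g = 0") (auto simp: deg_mult D_closed deg_D)

lemma deg_PX:
  "deg PX \<le> 2 * max (deg AX) (deg BX)" "deg AX \<noteq> deg BX \<Longrightarrow> deg PX = 2 * max (deg AX) (deg BX)"
proof -
  have sq: "deg (AX * AX) = 2 * deg AX" "deg (BX * BX) = 2 * deg BX"
    by (simp_all add: deg_mult ABPX)
  have P: "deg PX = deg (AX * AX + BX * BX)"
    unfolding PX_eq by (intro deg_uminus add_closed mult_closed ABPX)
  show "deg PX \<le> 2 * max (deg AX) (deg BX)"
    unfolding P using deg_add_le[of "AX * AX" "BX * BX"] sq by (auto simp: mult_closed ABPX)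
  show "deg AX \<noteq> deg BX \<Longrightarrow> deg PX = 2 * max (deg AX) (deg BX)"
    unfolding P using deg_add_eq[of "AX * AX" "BX * BX"] deg_add_eq[of "BX * BX" "AX * AX"] sq
    by (cases "deg AX < deg BX") (auto simp: mult_closed ABPX add.commute)
qed

text \<open>Cancellation in the sum of squares cannot push \<open>deg PX\<close> below
  \<open>deg AX\<close>: \<open>- PX\<close> is the product of AX + \<iota> BX and AX - \<iota> BX,
  whose degrees add up, while their sum is 2 AX.\<close>

lemma deg_AX_le: "deg AX \<le> deg PX"
proof -
  obtain \<iota> :: 'k where \<iota>: "\<iota> ^ 2 = - 1" using nth_root_exists[of 2 "-1"] by auto
  define p where "p = AX + (\<lambda>x. \<iota> * BX x)"
  define q where "q = AX + (\<lambda>x. - \<iota> * BX x)"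
  have pq: "p \<in> KX" "q \<in> KX" unfolding p_def q_def by (intro add_closed scale_closed ABPX)+
  have "p * q = - PX"
  proof
    fix x
    have "AX x * AX x + BX x * BX x + PX x = 0" using fun_cong[OF trinomial_X, of x] by (simp add: fun_apply)
    then show "(p * q) x = (- PX) x" using \<iota> by (simp add: p_def q_def fun_apply) algebra
  qed
  moreover have "- PX \<noteq> 0" using ABPX(6) by simp
  ultimately have "p \<noteq> 0" "q \<noteq> 0" "deg (p * q) = deg PX" using deg_uminus[OF ABPX(3)] by auto
  then have "deg p + deg q = deg PX" using deg_mult pq by simp
  moreover have "p + q = (\<lambda>x. 2 * AX x)" by (auto simp: p_def q_def fun_eq_iff fun_apply)
  then have "deg AX = deg (p + q)" using deg_scale[OF ABPX(1), of 2] by simp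
  ultimately show ?thesis using deg_add_le[OF pq] by simp
qed

text \<open>The only exponent one in block 0 belongs to \<open>x0\<close>, whose degree is 0 here;
  elsewhere \<open>\<mu> i \<le> 2 * (\<mu> i - 1)\<close>.\<close>

lemma deg_A': 
  assumes "D (T x0) = 0" "\<And>i. i \<in> J0 - {x0} \<Longrightarrow> 2 \<le> \<mu> i"
  shows "deg AX \<le> 2 * deg A'"
proof -
  have "\<mu> i * deg (T i) \<le> 2 * ((\<mu> i - 1) * deg (T i))" if "i \<in> J0" for i
  proof (cases "i = x0")
    case True
    then show ?thesis using assms(1) blocks_subset(4) by (simp add: deg_eq_0_iff[THEN iffD2] T_in_KX)
  next
    case False
    then have "\<mu> i \<le> 2 * (\<mu> i - 1)" using assms(2)[of i] that by simp
    from mult_le_mono1[OF this, of "deg (T i)"] show ?thesis by (simp add: mult.assoc)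
  qed
  then show ?thesis
    unfolding deg_M[OF blocks_subset(1)] sum_distrib_left by (rule sum_mono)
qed

lemma deg_P':
  assumes "\<And>i. i \<in> J2 \<Longrightarrow> k * \<mu> i \<le> l * (\<mu> i - 1)"
  shows "k * deg PX \<le> l * deg P'"
  unfolding deg_M[OF blocks_subset(3)] sum_distrib_left
proof (rule sum_mono)
  fix i assume "i \<in> J2"
  from mult_le_mono1[OF assms[OF this], of "deg (T i)"]
  show "k * (\<mu> i * deg (T i)) \<le> l * ((\<mu> i - 1) * deg (T i))" by (simp add: mult.assoc)
qed

text \<open>Let a, b, p, w be the degrees of \<open>AX\<close>, \<open>BX\<close>,
  \<open>PX\<close>, \<open>V\<close>. The definition of \<open>V\<close> gives w < a + b, and
  \<open>AX_V\<close> gives a + w < p + b. From below, w is at least a/2 + 3p/4. If a and b differ,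
  p = 2 max(a, b) contradicts the first bound; if a = b, then p \<le> 2a contradicts the
  second.\<close>

lemma rigid_if_ge4:
  assumes "D (T x0) = 0" "\<And>i. i \<in> J0 - {x0} \<Longrightarrow> 2 \<le> \<mu> i" "\<And>i. i \<in> J2 \<Longrightarrow> 4 \<le> \<mu> i" "f \<in> KX"
  shows "D f = 0"
proof (cases rule: V_cases)
  case zero
  then show ?thesis using assms by blast
next
  case nonzero
  have "V = BX * D AX - AX * D BX" by (simp add: V_def mult.commute)
  then have 2: "deg V < deg AX + deg BX"
    using nonzero(1) deg_less_diff[of "BX * D AX" "AX * D BX" "deg AX + deg BX"]
      deg_mult_D[OF ABPX(2,1)] deg_mult_D[OF ABPX(1,2)]
    by (auto simp: mult_closed D_closed ABPX add.commute)
  have eq: "(\<lambda>x. 2 * (AX * V) x) = (PX * D BX + PX * D BX) - BX * D PX"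
    using AX_V by (auto simp: fun_eq_iff fun_apply)
  have nz: "AX * V \<noteq> 0" using no_zero_divisors[OF ABPX(1) V_closed] ABPX nonzero by blast
  then have nz': "(\<lambda>x. 2 * (AX * V) x) \<noteq> 0" by (auto simp: fun_eq_iff fun_apply)
  have "PX * D BX + PX * D BX = 0 \<or> deg (PX * D BX + PX * D BX) < deg PX + deg BX"
    using deg_mult_D[OF ABPX(3,2)] by (intro deg_less_add mult_closed D_closed ABPX)
  moreover have "BX * D PX = 0 \<or> deg (BX * D PX) < deg PX + deg BX"
    using deg_mult_D[OF ABPX(2,3)] by (simp only: add.commute)
  ultimately have "PX * D BX + PX * D BX - BX * D PX = 0
      \<or> deg (PX * D BX + PX * D BX - BX * D PX) < deg PX + deg BX"
    by (intro deg_less_diff add_closed mult_closed D_closed ABPX)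
  then have "deg (\<lambda>x. 2 * (AX * V) x) < deg PX + deg BX"
    using nz' unfolding eq by blast
  then have 3: "deg AX + deg V < deg PX + deg BX"
    using deg_scale[OF mult_closed[OF ABPX(1) V_closed], of 2] deg_mult[OF ABPX(1) V_closed] ABPX nonzero
    by simp
  have 4: "3 * deg PX \<le> 4 * deg P'" using assms(3) by (intro deg_P') force
  show ?thesis
    using 2 3 4 nonzero(2) deg_A'[OF assms(1,2)] deg_PX by (cases "deg AX = deg BX") (auto simp: max_def split: if_splits)
qed

text \<open>Let a, b, p, w be the degrees of \<open>AX\<close>, \<open>BX\<close>,
  \<open>PX\<close>, \<open>V\<close>. If the killed form c has \<beta> nonzero, then \<beta> V =
  \<open>D AX * c\<close>, so w = a - 1, while w is at least a/2 + p/2 and p is at least a. If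
  \<beta> = 0, then a = 0 and w = b - 1, against w \<ge> p/2 and p = 2b. Exponents 2 in
  \<open>P\<close> suffice for both.\<close>

lemma rigid_if_linear_form:
  assumes "D (T x0) = 0" "\<And>i. i \<in> J0 - {x0} \<Longrightarrow> 2 \<le> \<mu> i" "f \<in> KX"
    and form: "\<alpha> \<noteq> 0 \<or> \<beta> \<noteq> 0" "D (\<lambda>x. \<alpha> * AX x + \<beta> * BX x) = 0"
  shows "D f = 0"
proof (cases rule: V_cases)
  case zero
  then show ?thesis using assms by blast
next
  case nonzero
  have P': "deg PX \<le> 2 * deg P'" using deg_P'[of 1 2] \<mu>_ge2 by force
  define c where "c = (\<lambda>x. \<alpha> * AX x + \<beta> * BX x)"
  have c_eq: "c = (\<lambda>x. \<alpha> * AX x) + (\<lambda>x. \<beta> * BX x)" by (auto simp: c_def fun_apply)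
  have c: "c \<in> KX" unfolding c_eq by (intro add_closed scale_closed ABPX)
  have "D c = (\<lambda>x. \<alpha> * D AX x) + (\<lambda>x. \<beta> * D BX x)"
    unfolding c_eq by (simp add: D_add D_scale scale_closed ABPX)
  then have Dc: "\<alpha> * D AX x + \<beta> * D BX x = 0" for x
    using form(2) by (auto simp: c_def fun_eq_iff fun_apply)
  have c0: "deg c = 0" using form(2) c by (simp add: deg_eq_0_iff c_def)
  show ?thesis
  proof (cases "\<beta> = 0")
    case False
    have eq: "(\<lambda>x. \<beta> * V x) = D AX * c"
    proof
      fix x show "\<beta> * V x = (D AX * c) x" using Dc[of x] by (simp add: V_def c_def fun_apply) algebra
    qed
    have "(\<lambda>x. \<beta> * V x) \<noteq> 0" using nonzero(1) False by (auto simp: fun_eq_iff fun_apply)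
    then have nz: "D AX \<noteq> 0" "c \<noteq> 0" unfolding eq by auto
    have "deg V = deg (D AX) + deg c"
      using deg_scale[OF V_closed False] deg_mult[OF D_closed[OF ABPX(1)] c nz] by (simp add: eq)
    then have "Suc (deg V) = deg AX" using deg_D[OF ABPX(1) nz(1)] c0 by simp
    then show ?thesis using nonzero(2) P' deg_A'[OF assms(1,2)] deg_AX_le by simp
  next
    case True
    then have DA: "D AX = 0" using form(1) Dc by (auto simp: fun_eq_iff fun_apply)
    then have V: "V = - (AX * D BX)" by (simp add: V_def)
    then have nz: "D BX \<noteq> 0" using nonzero(1) by auto
    have A0: "deg AX = 0" using DA by (simp add: deg_eq_0_iff ABPX)
    have "deg V = deg (AX * D BX)" unfolding V by (intro deg_uminus mult_closed D_closed ABPX)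
    also have "\<dots> = deg AX + deg (D BX)" by (intro deg_mult D_closed ABPX nz)
    finally have "Suc (deg V) = deg BX" using deg_D[OF ABPX(2) nz] A0 by simp
    then show ?thesis using nonzero(2) P' deg_PX(2) A0 by simp
  qed
qed

end

section \<open>Gradings\<close>

text \<open>A polynomial is represented by a list of pairs (coefficient, exponent), with repetitions
  allowed. No normal form is needed: homogeneous components will arise by filtering any such
  list.\<close>

definition tsum :: "'i set \<Rightarrow> ('k \<times> ('i \<Rightarrow> nat)) list \<Rightarrow> ('i \<Rightarrow> 'k) \<Rightarrow> 'k::field" where
  "tsum I ts x = (\<Sum>(c, e)\<leftarrow>ts. c * mon I e x)"

definition tprod :: "('k \<times> ('i \<Rightarrow> nat)) list \<Rightarrow> ('k \<times> ('i \<Rightarrow> nat)) list \<Rightarrow> ('k::field \<times> ('i \<Rightarrow> nat)) list" where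
  "tprod ts us = concat (map (\<lambda>(c, e). map (\<lambda>(d, e'). (c * d, \<lambda>i. e i + e' i)) us) ts)"

lemma tsum_simps [simp]:
  "tsum I [] x = 0" "tsum I ((c, e) # ts) x = c * mon I e x + tsum I ts x"
  "tsum I (ts @ us) x = tsum I ts x + tsum I us x"
  by (simp_all add: tsum_def)

lemma tsum_scale: "tsum I (map (\<lambda>(d, e). (c * d, e)) ts) x = c * tsum I ts x"
  by (induction ts) (auto simp: algebra_simps)

lemma tsum_tprod: "tsum I (tprod ts us) x = tsum I ts x * tsum I us x"
proof (induction ts)
  case (Cons t ts)
  obtain c e where t: "t = (c, e)" by (cases t)
  have "tsum I (map (\<lambda>(d, e'). (c * d, \<lambda>i. e i + e' i)) us) x = c * mon I e x * tsum I us x"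
    by (induction us) (auto simp: mon_add algebra_simps)
  then show ?case using Cons by (simp add: t tprod_def algebra_simps)
qed (simp add: tprod_def)

lemma tsum_poly: "tsum I ts \<in> subalgebra_gen (coordinates I)"
proof (induction ts)
  case Nil
  show ?case using subalgebra_gen.const[of 0] by (simp add: tsum_def[abs_def])
next
  case (Cons t ts)
  obtain c e where t: "t = (c, e)" by (cases t)
  have "(\<lambda>x. c * mon I e x + tsum I ts x) \<in> subalgebra_gen (coordinates I)"
    by (intro subalgebra_gen_intros mon_poly subset_refl Cons)
  moreover have "tsum I (t # ts) = (\<lambda>x. c * mon I e x + tsum I ts x)" by (rule ext) (simp add: t)
  ultimately show ?case by simp
qed

lemma poly_tsum:
  assumes "f \<in> subalgebra_gen (coordinates I)" "finite I"
  shows "\<exists>ts. \<forall>x. f x = tsum I ts x"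
  using assms(1)
proof induction
  case (const c)
  show ?case by (rule exI[of _ "[(c, \<lambda>_. 0)]"]) (simp add: mon_def)
next
  case (gen f)
  then obtain i where i: "f = (\<lambda>x. x i)" "i \<in> I" by (auto simp: coordinates_def)
  have "mon I (\<lambda>j. if j = i then 1 else 0) x = (\<Prod>j\<in>I. if j = i then x j else 1)" for x :: "'a \<Rightarrow> 'b"
    unfolding mon_def by (rule prod.cong) auto
  also have "\<dots> x = x i" for x :: "'a \<Rightarrow> 'b" using i assms(2) by simp
  finally show ?case
    by (intro exI[of _ "[(1, \<lambda>j. if j = i then 1 else 0)]"]) (simp add: i)
next
  case (add f g)
  then obtain ts us where "\<forall>x. f x = tsum I ts x" "\<forall>x. g x = tsum I us x" by blast
  then show ?case by (intro exI[of _ "ts @ us"]) simp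
next
  case (mult f g)
  then obtain ts us where "\<forall>x. f x = tsum I ts x" "\<forall>x. g x = tsum I us x" by blast
  then show ?case by (intro exI[of _ "tprod ts us"]) (simp add: tsum_tprod)
qed

definition wt :: "'i set \<Rightarrow> ('i \<Rightarrow> int) \<Rightarrow> ('i \<Rightarrow> nat) \<Rightarrow> int" where
  "wt I \<omega> e = (\<Sum>i\<in>I. int (e i) * \<omega> i)"

lemma wt_add: "wt I \<omega> (\<lambda>i. e i + e' i) = wt I \<omega> e + wt I \<omega> e'"
  by (simp add: wt_def distrib_right sum.distrib)

lemma filter_tprod:
  assumes "\<forall>(c, e)\<in>set ts. wt I \<omega> e = j"
  shows "filter (\<lambda>(c, e). wt I \<omega> e = j + k) (tprod ts us) = tprod ts (filter (\<lambda>(c, e). wt I \<omega> e = k) us)"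
  using assms
proof (induction ts)
  case (Cons t ts)
  obtain c e where t: "t = (c, e)" by (cases t)
  have "wt I \<omega> e = j" using Cons.prems by (simp add: t)
  then have "filter (\<lambda>(c, e). wt I \<omega> e = j + k) (map (\<lambda>(d, e'). (c * d, \<lambda>i. e i + e' i)) us)
    = map (\<lambda>(d, e'). (c * d, \<lambda>i. e i + e' i)) (filter (\<lambda>(c, e). wt I \<omega> e = k) us)"
    by (induction us) (auto simp: wt_add)
  then show ?case using Cons by (simp add: t tprod_def)
qed (simp add: tprod_def)

section \<open>Gradings of the coordinate ring by admissible weights\<close>

context trinomial
begin

lemma KX_tsum: "f \<in> KX \<longleftrightarrow> (\<exists>ts. f = res (tsum I ts))"
proof
  assume "f \<in> KX"
  then obtain p where p: "p \<in> R" "f = res p" by (auto simp: KX_res)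
  then show "\<exists>ts. f = res (tsum I ts)"
    using poly_tsum[OF p(1) finite_I] by (auto simp: res_eq_iff)
qed (auto simp: KX_res tsum_poly)

lemma res_tsum_append: "res (tsum I (ts @ us)) = res (tsum I ts) + res (tsum I us)"
  by (auto simp: res_add res_eq_iff)

lemma res_tsum_tprod: "res (tsum I (tprod ts us)) = res (tsum I ts) * res (tsum I us)"
  by (auto simp: res_mult res_eq_iff tsum_tprod)

lemma res_tsum_scale: "res (tsum I (map (\<lambda>(d, e). (c * d, e)) ts)) = (\<lambda>x. c * res (tsum I ts) x)"
  by (auto simp: res_scale res_eq_iff tsum_scale)

text \<open>A weight vector is admissible if the defining trinomial is homogeneous.\<close>

definition admissible :: "('i \<Rightarrow> int) \<Rightarrow> bool" where
  "admissible \<omega> \<longleftrightarrow> wt J1 \<omega> \<mu> = wt J0 \<omega> \<mu> \<and> wt J2 \<omega> \<mu> = 2 * wt J0 \<omega> \<mu>"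

definition torus :: "('i \<Rightarrow> int) \<Rightarrow> 'k \<Rightarrow> ('i \<Rightarrow> 'k) \<Rightarrow> ('i \<Rightarrow> 'k)" where
  "torus \<omega> s x = (\<lambda>i\<in>I. s powi \<omega> i * x i)"

lemma mon_torus:
  assumes "S \<subseteq> I" "s \<noteq> 0"
  shows "mon S e (torus \<omega> s x) = s powi wt S \<omega> e * mon S e x"
proof -
  have "finite S" using assms(1) finite_I by (rule finite_subset)
  then show ?thesis using assms(1)
  proof (induction S)
    case (insert i S)
    have "(s powi \<omega> i) ^ e i = s powi (int (e i) * \<omega> i)"
      by (metis mult.commute power_int_mult power_int_of_nat)
    then show ?case
      using insert assms(2)
      by (simp add: mon_insert torus_def wt_def power_mult_distrib power_int_add)
  qed (simp add: mon_def wt_def)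
qed

lemma torus_X:
  assumes "admissible \<omega>" "s \<noteq> 0" "x \<in> X"
  shows "torus \<omega> s x \<in> X"
proof -
  let ?m = "s powi wt J0 \<omega> \<mu>"
  have "s powi (2 * wt J0 \<omega> \<mu>) = ?m ^ 2"
    by (metis mult.commute power_int_mult power_int_numeral)
  then have "F (torus \<omega> s x) = ?m ^ 2 * F x"
    using assms(1,2) blocks_subset unfolding F_def
    by (simp add: mon_torus admissible_def power_mult_distrib distrib_left)
  then show ?thesis using assms(3) by (auto simp: X_F affine_space_def torus_def)
qed

text \<open>Along a torus orbit a polynomial becomes a Laurent polynomial in \<open>s\<close>; the
  shift by \<open>m\<close> clears the negative exponents.\<close>

lemma torus_poly:
  assumes "s \<noteq> 0" "\<And>c e. (c, e) \<in> set ts \<Longrightarrow> 0 \<le> wt I \<omega> e + m"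
  shows "poly (\<Sum>(c, e)\<leftarrow>ts. monom (c * mon I e x) (nat (wt I \<omega> e + m))) s
    = s powi m * tsum I ts (torus \<omega> s x)"
  using assms(2)
proof (induction ts)
  case (Cons t ts)
  obtain c e where t: "t = (c, e)" by (cases t)
  have "0 \<le> wt I \<omega> e + m" using Cons.prems[of c e] t by simp
  then have "s ^ nat (wt I \<omega> e + m) = s powi (wt I \<omega> e + m)" by (simp add: power_int_def)
  also have "\<dots> = s powi m * s powi wt I \<omega> e"
    using assms(1) by (simp add: power_int_add mult.commute)
  finally have "s ^ nat (wt I \<omega> e + m) = s powi m * s powi wt I \<omega> e" .
  moreover have "poly (\<Sum>(c, e)\<leftarrow>ts. monom (c * mon I e x) (nat (wt I \<omega> e + m))) s
      = s powi m * tsum I ts (torus \<omega> s x)"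
    by (rule Cons.IH, rule Cons.prems, erule list.set_intros(2))
  ultimately show ?case using assms(1)
    by (simp add: t poly_monom mon_torus algebra_simps)
qed simp

lemma coeff_torus_poly:
  assumes "\<And>c e. (c, e) \<in> set ts \<Longrightarrow> 0 \<le> wt I \<omega> e + m" "0 \<le> k + m"
  shows "coeff (\<Sum>(c, e)\<leftarrow>ts. monom (c * mon I e x) (nat (wt I \<omega> e + m))) (nat (k + m))
    = tsum I (filter (\<lambda>(c, e). wt I \<omega> e = k) ts) x"
  using assms(1)
proof (induction ts)
  case (Cons t ts)
  obtain c e where t: "t = (c, e)" by (cases t)
  have "0 \<le> wt I \<omega> e + m" using Cons.prems[of c e] t by simp
  then have "nat (wt I \<omega> e + m) = nat (k + m) \<longleftrightarrow> wt I \<omega> e = k" using assms(2) by auto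
  then show ?case using Cons by (auto simp: t)
qed simp

text \<open>The torus orbit of a point of \<open>X\<close> stays in \<open>X\<close>, so a function
  vanishing on \<open>X\<close> vanishes along it, and the homogeneous components are its
  coefficients in \<open>s\<close>. This makes components on \<open>X\<close> independent of the
  chosen terms.\<close>

lemma filter_eq_0:
  assumes "admissible \<omega>" "res (tsum I ts) = 0"
  shows "res (tsum I (filter (\<lambda>(c, e). wt I \<omega> e = k) ts)) = 0"
  unfolding res_eq_0_iff
proof
  fix x assume x: "x \<in> X"
  \<comment> \<open>A bound for the absolute values of all weights involved, so that every shifted
    exponent is a natural number.\<close>
  define m where "m = (\<Sum>k\<in>insert k ((\<lambda>(c, e). wt I \<omega> e) ` set ts). \<bar>k\<bar>)"
  have m: "\<bar>j\<bar> \<le> m" if "j \<in> insert k ((\<lambda>(c, e). wt I \<omega> e) ` set ts)" for j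
    unfolding m_def by (rule member_le_sum[OF that]) auto
  have mk: "0 \<le> k + m" using m[of k] by simp
  have me: "0 \<le> wt I \<omega> e + m" if "(c, e) \<in> set ts" for c e
    using m[of "wt I \<omega> e"] that by force
  let ?p = "\<Sum>(c, e)\<leftarrow>ts. monom (c * mon I e x) (nat (wt I \<omega> e + m))"
  have "?p = 0"
  proof (rule poly_eqI_cofinite)
    fix s :: 'k assume s: "s \<noteq> 0"
    have "tsum I ts (torus \<omega> s x) = 0"
      using assms(2) torus_X[OF assms(1) s x] by (auto simp: res_eq_0_iff)
    then show "poly ?p s = poly 0 s" using torus_poly[OF s me] by simp
  qed
  then show "tsum I (filter (\<lambda>(c, e). wt I \<omega> e = k) ts) x = 0"
    using coeff_torus_poly[where ts = ts and x = x, OF me mk] by simp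
qed

text \<open>The term list is picked by \<open>SOME\<close>; by \<open>comp_tsum\<close> any other
  list gives the same function if the weight is admissible.\<close>

definition component :: "('i \<Rightarrow> int) \<Rightarrow> int \<Rightarrow> (('i \<Rightarrow> 'k) \<Rightarrow> 'k) \<Rightarrow> (('i \<Rightarrow> 'k) \<Rightarrow> 'k)" where
  "component \<omega> k f = res (tsum I (filter (\<lambda>(c, e). wt I \<omega> e = k) (SOME ts. f = res (tsum I ts))))"

definition homogeneous :: "('i \<Rightarrow> int) \<Rightarrow> int \<Rightarrow> (('i \<Rightarrow> 'k) \<Rightarrow> 'k) \<Rightarrow> bool" where
  "homogeneous \<omega> k f \<longleftrightarrow> (\<exists>ts. (\<forall>(c, e)\<in>set ts. wt I \<omega> e = k) \<and> f = res (tsum I ts))"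

lemma comp_tsum:
  assumes "admissible \<omega>"
  shows "component \<omega> k (res (tsum I ts)) = res (tsum I (filter (\<lambda>(c, e). wt I \<omega> e = k) ts))"
proof -
  define us where "us = (SOME us. res (tsum I ts) = res (tsum I us))"
  have us: "res (tsum I ts) = res (tsum I us)"
    unfolding us_def by (rule someI[of _ ts]) simp
  let ?P = "\<lambda>(c, e). wt I \<omega> e = k" and ?n = "map (\<lambda>(d, e). (- 1 * d, e))"
  have neg: "tsum I (?n vs) x = - tsum I vs x" for vs and x :: "'i \<Rightarrow> 'k"
    using tsum_scale[of I "- 1" vs x] by simp
  have "res (tsum I (ts @ ?n us)) = 0"
    using us unfolding res_eq_0_iff res_eq_iff tsum_simps neg by simp
  from filter_eq_0[OF assms this, of k]
  have "res (tsum I (filter ?P ts @ filter ?P (?n us))) = 0" by simp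
  moreover have "filter ?P (?n us) = ?n (filter ?P us)" by (induction us) auto
  ultimately have "\<forall>x\<in>X. tsum I (filter ?P ts) x = tsum I (filter ?P us) x"
    unfolding res_eq_0_iff by (simp only: tsum_simps neg) simp
  then show ?thesis unfolding component_def us_def[symmetric] by (simp add: res_eq_iff)
qed

lemma hom_in_KX: "homogeneous \<omega> k f \<Longrightarrow> f \<in> KX"
  by (auto simp: homogeneous_def KX_tsum)

lemma hom_0: "homogeneous \<omega> k 0"
  unfolding homogeneous_def by (rule exI[of _ "[]"]) (auto simp: res_def fun_eq_iff fun_apply)

lemma hom_add: "homogeneous \<omega> k f \<Longrightarrow> homogeneous \<omega> k g \<Longrightarrow> homogeneous \<omega> k (f + g)"
  unfolding homogeneous_def using res_tsum_append by (metis Un_iff set_append)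

lemma hom_scale:
  assumes "homogeneous \<omega> k f"
  shows "homogeneous \<omega> k (\<lambda>x. c * f x)"
proof -
  obtain ts where ts: "\<forall>(c, e)\<in>set ts. wt I \<omega> e = k" "f = res (tsum I ts)"
    using assms by (auto simp: homogeneous_def)
  then show ?thesis
    unfolding homogeneous_def by (intro exI[of _ "map (\<lambda>(d, e). (c * d, e)) ts"]) (auto simp: res_tsum_scale)
qed

lemma hom_diff: "homogeneous \<omega> k f \<Longrightarrow> homogeneous \<omega> k g \<Longrightarrow> homogeneous \<omega> k (f - g)"
  using hom_add[OF _ hom_scale[of \<omega> k g "-1"], of f] by (simp add: plus_fun_def fun_diff_def)

lemma hom_mult: "homogeneous \<omega> j f \<Longrightarrow> homogeneous \<omega> k g \<Longrightarrow> homogeneous \<omega> (j + k) (f * g)"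
proof -
  assume "homogeneous \<omega> j f" "homogeneous \<omega> k g"
  then obtain ts us where ts: "\<forall>(c, e)\<in>set ts. wt I \<omega> e = j" "f = res (tsum I ts)"
    "\<forall>(c, e)\<in>set us. wt I \<omega> e = k" "g = res (tsum I us)"
    by (auto simp: homogeneous_def)
  have "\<forall>(c, e)\<in>set (tprod ts us). wt I \<omega> e = j + k"
    using ts(1,3) by (fastforce simp: tprod_def wt_add)
  then show ?thesis unfolding homogeneous_def using ts(2,4) res_tsum_tprod by metis
qed

lemma hom_M: "S \<subseteq> I \<Longrightarrow> homogeneous \<omega> (wt S \<omega> e) (M S e)"
proof -
  assume S: "S \<subseteq> I"
  let ?e = "\<lambda>i. if i \<in> S then e i else 0"
  have "mon I ?e x = mon S e x" for x :: "'i \<Rightarrow> 'k"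
    unfolding mon_def using S finite_I by (intro prod.mono_neutral_cong_right) auto
  moreover have "wt I \<omega> ?e = wt S \<omega> e"
    unfolding wt_def using S finite_I by (intro sum.mono_neutral_cong_right) auto
  ultimately show ?thesis
    unfolding homogeneous_def M_def by (intro exI[of _ "[(1, ?e)]"]) (simp add: res_eq_iff)
qed

lemma hom_T: "i \<in> I \<Longrightarrow> homogeneous \<omega> (\<omega> i) (T i)"
  using hom_M[of "{i}" \<omega> "\<lambda>_. 1"] by (simp add: wt_def M_def T_def mon_def[abs_def])

lemma hom_unit: "homogeneous \<omega> 0 unit"
  using hom_M[of "{}" \<omega> "\<lambda>_. 1"] by (simp add: wt_def M_empty)

lemma KX_hom_induct [consumes 1, case_names zero hom add]:
  assumes "f \<in> KX" "Q 0" "\<And>k f. homogeneous \<omega> k f \<Longrightarrow> Q f"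
    and "\<And>f g. f \<in> KX \<Longrightarrow> g \<in> KX \<Longrightarrow> Q f \<Longrightarrow> Q g \<Longrightarrow> Q (f + g)"
  shows "Q f"
proof -
  obtain ts where "f = res (tsum I ts)" using assms(1) by (auto simp: KX_tsum)
  moreover have "Q (res (tsum I ts))"
  proof (induction ts)
    case Nil
    have "res (tsum I []) = 0" by (auto simp: res_eq_0_iff)
    then show ?case using assms(2) by (simp only:)
  next
    case (Cons t ts)
    have "res (tsum I (t # ts)) = res (tsum I [t]) + res (tsum I ts)"
      using res_tsum_append[of "[t]" ts] by simp
    moreover have "homogeneous \<omega> (wt I \<omega> (snd t)) (res (tsum I [t]))"
      unfolding homogeneous_def by (rule exI[of _ "[t]"]) auto
    ultimately show ?case using Cons assms(3,4) KX_tsum by metis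
  qed
  ultimately show ?thesis by simp
qed

context
  fixes \<omega> assumes adm: "admissible \<omega>"
begin

lemma comp_add: "f \<in> KX \<Longrightarrow> g \<in> KX \<Longrightarrow> component \<omega> k (f + g) = component \<omega> k f + component \<omega> k g"
  unfolding KX_tsum by (auto simp: comp_tsum[OF adm] res_tsum_append[symmetric])

lemma comp_scale: "f \<in> KX \<Longrightarrow> component \<omega> k (\<lambda>x. c * f x) = (\<lambda>x. c * component \<omega> k f x)"
proof -
  have "filter P (map (\<lambda>(d, e). (c * d, e)) ts) = map (\<lambda>(d, e). (c * d, e)) (filter P ts)"
    if "P = (\<lambda>(c, e). wt I \<omega> e = k)" for P ts
    unfolding that by (induction ts) auto
  then show "f \<in> KX \<Longrightarrow> ?thesis"
    unfolding KX_tsum by (auto simp: comp_tsum[OF adm] res_tsum_scale[symmetric])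
qed

lemma hom_comp: "f \<in> KX \<Longrightarrow> homogeneous \<omega> k (component \<omega> k f)"
proof -
  assume "f \<in> KX"
  then obtain ts where "f = res (tsum I ts)" by (auto simp: KX_tsum)
  then show ?thesis
    unfolding homogeneous_def
    by (intro exI[of _ "filter (\<lambda>(c, e). wt I \<omega> e = k) ts"]) (auto simp: comp_tsum[OF adm])
qed

lemma comp_in_KX: "f \<in> KX \<Longrightarrow> component \<omega> k f \<in> KX"
  using hom_comp hom_in_KX by blast

lemma comp_hom: "homogeneous \<omega> j f \<Longrightarrow> component \<omega> k f = (if k = j then f else 0)"
proof -
  assume "homogeneous \<omega> j f"
  then obtain ts where ts: "\<forall>(c, e)\<in>set ts. wt I \<omega> e = j" "f = res (tsum I ts)"
    by (auto simp: homogeneous_def)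
  have "filter (\<lambda>(c, e). wt I \<omega> e = k) ts = (if k = j then ts else [])"
    using ts(1) by (auto simp: filter_id_conv filter_empty_conv)
  moreover have "res (tsum I []) = 0" by (auto simp: res_eq_0_iff)
  ultimately show ?thesis using ts(2) comp_tsum[OF adm, of k ts] by (simp split: if_splits)
qed

lemma comp_zero: "component \<omega> k 0 = 0"
  using comp_hom[OF hom_0, of k 0] by simp

lemma hom_unique: "homogeneous \<omega> j f \<Longrightarrow> homogeneous \<omega> k f \<Longrightarrow> f \<noteq> 0 \<Longrightarrow> j = k"
  using comp_hom[of j f j] comp_hom[of k f j] by (auto split: if_splits)

lemma comp_hom_mult: "homogeneous \<omega> j f \<Longrightarrow> g \<in> KX \<Longrightarrow> component \<omega> (j + k) (f * g) = f * component \<omega> k g"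
proof -
  assume "homogeneous \<omega> j f" "g \<in> KX"
  then obtain ts us where ts: "\<forall>(c, e)\<in>set ts. wt I \<omega> e = j" "f = res (tsum I ts)" "g = res (tsum I us)"
    by (auto simp: homogeneous_def KX_tsum)
  show ?thesis
    unfolding ts(2,3) res_tsum_tprod[symmetric] comp_tsum[OF adm] filter_tprod[OF ts(1)] ..
qed

text \<open>Taking a component only discards terms, so several gradings can be treated one after
  another.\<close>

lemma hom_comp_other: "homogeneous \<omega>' j f \<Longrightarrow> homogeneous \<omega>' j (component \<omega> k f)"
proof -
  assume "homogeneous \<omega>' j f"
  then obtain ts where "\<forall>(c, e)\<in>set ts. wt I \<omega>' e = j" "f = res (tsum I ts)"
    by (auto simp: homogeneous_def)
  then show ?thesis
    unfolding homogeneous_def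
    by (intro exI[of _ "filter (\<lambda>(c, e). wt I \<omega> e = k) ts"]) (auto simp: comp_tsum[OF adm])
qed

lemma finite_supp: "f \<in> KX \<Longrightarrow> finite {k. component \<omega> k f \<noteq> 0}"
proof -
  assume "f \<in> KX"
  then obtain ts where ts: "f = res (tsum I ts)" by (auto simp: KX_tsum)
  have "component \<omega> k f = 0" if "k \<notin> (\<lambda>(c, e). wt I \<omega> e) ` set ts" for k
  proof -
    have "filter (\<lambda>(c, e). wt I \<omega> e = k) ts = []" using that by (auto simp: filter_empty_conv)
    then show ?thesis using comp_tsum[OF adm, of k ts] by (auto simp: ts res_eq_0_iff)
  qed
  then have "{k. component \<omega> k f \<noteq> 0} \<subseteq> (\<lambda>(c, e). wt I \<omega> e) ` set ts" by blast
  then show ?thesis by (rule finite_subset) simp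
qed

lemma sum_supp:
  assumes "f \<in> KX" "finite K" "{k. component \<omega> k f \<noteq> 0} \<subseteq> K"
  shows "(\<Sum>k\<in>K. component \<omega> k f) = f"
proof -
  have "\<exists>K. finite K \<and> {k. component \<omega> k f \<noteq> 0} \<subseteq> K \<and> (\<Sum>k\<in>K. component \<omega> k f) = f" using assms(1)
  proof (induction rule: KX_hom_induct[where \<omega> = \<omega>])
    case zero
    then show ?case by (intro exI[of _ "{}"]) (auto simp: comp_zero)
  next
    case (hom k f)
    then show ?case by (intro exI[of _ "{k}"]) (auto simp: comp_hom)
  next
    case (add f g)
    then obtain K L where K: "finite K" "{k. component \<omega> k f \<noteq> 0} \<subseteq> K" "(\<Sum>k\<in>K. component \<omega> k f) = f"
      and L: "finite L" "{k. component \<omega> k g \<noteq> 0} \<subseteq> L" "(\<Sum>k\<in>L. component \<omega> k g) = g" by blast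
    have "(\<Sum>k\<in>K \<union> L. component \<omega> k f) = f"
      using K L by (subst K(3)[symmetric], intro sum.mono_neutral_right) auto
    moreover have "(\<Sum>k\<in>K \<union> L. component \<omega> k g) = g"
      using K L by (subst L(3)[symmetric], intro sum.mono_neutral_right) auto
    moreover have "component \<omega> k (f + g) = 0" if "k \<notin> K \<union> L" for k
    proof -
      have "component \<omega> k f = 0" "component \<omega> k g = 0" using that K(2) L(2) by blast+
      then show ?thesis by (simp add: comp_add add.hyps)
    qed
    ultimately show ?case
      using K(1) L(1) by (intro exI[of _ "K \<union> L"]) (auto simp: comp_add add.hyps sum.distrib)
  qed
  then obtain L where L: "finite L" "{k. component \<omega> k f \<noteq> 0} \<subseteq> L" "(\<Sum>k\<in>L. component \<omega> k f) = f" by blast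
  have "(\<Sum>k\<in>K. component \<omega> k f) = (\<Sum>k\<in>{k. component \<omega> k f \<noteq> 0}. component \<omega> k f)"
    using assms by (intro sum.mono_neutral_right) auto
  also have "\<dots> = (\<Sum>k\<in>L. component \<omega> k f)" using L by (intro sum.mono_neutral_left) auto
  finally show ?thesis using L by simp
qed

end

end

lemma sum_fun_apply: "(\<Sum>k\<in>K. f k) x = (\<Sum>k\<in>K. f k x :: 'b::comm_monoid_add)"
  by (induction K rule: infinite_finite_induct) (auto simp: fun_apply)

section \<open>The lowest homogeneous part of a derivation\<close>

context trinomial_lnd
begin

text \<open>The part of \<open>D\<close> that raises \<open>\<omega>\<close>-degrees by exactly
  \<open>l\<close>.\<close>

definition lead :: "('i \<Rightarrow> int) \<Rightarrow> int \<Rightarrow> (('i \<Rightarrow> 'k) \<Rightarrow> 'k) \<Rightarrow> (('i \<Rightarrow> 'k) \<Rightarrow> 'k)" where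
  "lead \<omega> l f = (\<Sum>j\<in>{j. component \<omega> j f \<noteq> 0}. component \<omega> (j + l) (D (component \<omega> j f)))"

lemma sum_closed: "(\<And>k. k \<in> K \<Longrightarrow> h k \<in> KX) \<Longrightarrow> sum h K \<in> KX"
  by (induction K rule: infinite_finite_induct) (auto intro: zero_closed add_closed)

lemma D_sum: "(\<And>k. k \<in> K \<Longrightarrow> h k \<in> KX) \<Longrightarrow> D (sum h K) = (\<Sum>k\<in>K. D (h k))"
  by (induction K rule: infinite_finite_induct) (auto simp: D_add sum_closed)

context
  fixes \<omega> assumes adm: "admissible \<omega>"
begin

lemma component_sum:
  "(\<And>k. k \<in> K \<Longrightarrow> h k \<in> KX) \<Longrightarrow> component \<omega> m (sum h K) = (\<Sum>k\<in>K. component \<omega> m (h k))"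
  by (induction K rule: infinite_finite_induct)
     (auto simp: comp_add[OF adm] comp_zero[OF adm] sum_closed)

lemma component_D:
  assumes "f \<in> KX" "finite K" "{k. component \<omega> k f \<noteq> 0} \<subseteq> K"
  shows "component \<omega> m (D f) = (\<Sum>k\<in>K. component \<omega> m (D (component \<omega> k f)))"
proof -
  have "component \<omega> m (D (\<Sum>k\<in>K. component \<omega> k f)) = (\<Sum>k\<in>K. component \<omega> m (D (component \<omega> k f)))"
    by (simp add: D_sum component_sum comp_in_KX[OF adm] D_closed assms(1))
  then show ?thesis by (simp only: sum_supp[OF adm assms])
qed

lemma lead_sum:
  assumes "finite K" "{k. component \<omega> k f \<noteq> 0} \<subseteq> K"
  shows "lead \<omega> l f = (\<Sum>j\<in>K. component \<omega> (j + l) (D (component \<omega> j f)))"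
  unfolding lead_def using assms
  by (intro sum.mono_neutral_left) (auto simp: comp_zero[OF adm])

lemma lead_closed: "f \<in> KX \<Longrightarrow> lead \<omega> l f \<in> KX"
  unfolding lead_def by (intro sum_closed comp_in_KX[OF adm] D_closed)

lemma lead_hom:
  assumes "homogeneous \<omega> j f"
  shows "lead \<omega> l f = component \<omega> (j + l) (D f)"
proof -
  have "{k. component \<omega> k f \<noteq> 0} \<subseteq> {j}" by (auto simp: comp_hom[OF adm assms] split: if_splits)
  then show ?thesis using lead_sum[of "{j}" f l] comp_hom[OF adm assms, of j] by simp
qed

lemma lead_add:
  assumes "f \<in> KX" "g \<in> KX"
  shows "lead \<omega> l (f + g) = lead \<omega> l f + lead \<omega> l g"
proof -
  let ?K = "{k. component \<omega> k f \<noteq> 0} \<union> {k. component \<omega> k g \<noteq> 0}"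
  have K: "finite ?K" using assms by (simp add: finite_supp[OF adm])
  have "{k. component \<omega> k (f + g) \<noteq> 0} \<subseteq> ?K" using assms by (auto simp: comp_add[OF adm])
  then show ?thesis
    using K assms lead_sum[OF K, of "f + g" l] lead_sum[OF K, of f l] lead_sum[OF K, of g l]
    by (simp add: comp_add[OF adm] D_add comp_in_KX[OF adm] D_closed sum.distrib subset_iff)
qed

lemma lead_scale:
  assumes "f \<in> KX"
  shows "lead \<omega> l (\<lambda>x. c * f x) = (\<lambda>x. c * lead \<omega> l f x)"
proof -
  let ?K = "{k. component \<omega> k f \<noteq> 0}"
  have K: "finite ?K" using assms by (simp add: finite_supp[OF adm])
  have "component \<omega> k (\<lambda>x. c * f x) = 0" if "k \<notin> ?K" for k
    using that assms by (auto simp: comp_scale[OF adm] fun_eq_iff fun_apply)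
  then have "{k. component \<omega> k (\<lambda>x. c * f x) \<noteq> 0} \<subseteq> ?K" by blast
  from lead_sum[OF K this, of l]
  have "lead \<omega> l (\<lambda>x. c * f x) = (\<Sum>j\<in>?K. (\<lambda>x. c * component \<omega> (j + l) (D (component \<omega> j f)) x))"
    by (simp add: comp_scale[OF adm] D_scale comp_in_KX[OF adm] D_closed assms)
  then show ?thesis
    using lead_sum[OF K subset_refl, of l] by (auto simp: fun_eq_iff sum_fun_apply sum_distrib_left)
qed

lemma lead_zero: "lead \<omega> l 0 = 0"
  using lead_hom[OF hom_0, of l 0] by (simp add: comp_zero[OF adm])

lemma lead_mult_hom:
  assumes f: "homogeneous \<omega> j f" and g: "g \<in> KX"
  shows "lead \<omega> l (f * g) = f * lead \<omega> l g + lead \<omega> l f * g"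
  using g
proof (induction rule: KX_hom_induct[where \<omega> = \<omega>])
  case zero
  then show ?case by (simp add: lead_zero)
next
  case (hom k g)
  note fg = hom_in_KX[OF f] hom_in_KX[OF hom]
  have "lead \<omega> l (f * g) = component \<omega> (j + k + l) (f * D g + D f * g)"
    by (simp add: lead_hom[OF hom_mult[OF f hom]] D_mult fg)
  also have "\<dots> = component \<omega> (j + (k + l)) (f * D g) + component \<omega> (k + (j + l)) (g * D f)"
    by (subst comp_add[OF adm]) (simp_all add: fg mult_closed D_closed add_ac mult.commute)
  also have "\<dots> = f * component \<omega> (k + l) (D g) + g * component \<omega> (j + l) (D f)"
    by (simp only: comp_hom_mult[OF adm f D_closed[OF fg(2)]] comp_hom_mult[OF adm hom D_closed[OF fg(1)]])
  finally show ?case by (simp add: lead_hom[OF f] lead_hom[OF hom] mult.commute)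
next
  case (add g h)
  then show ?case
    by (simp add: distrib_left lead_add mult_closed hom_in_KX[OF f] add_ac)
qed

lemma lead_mult:
  assumes "f \<in> KX" "g \<in> KX"
  shows "lead \<omega> l (f * g) = f * lead \<omega> l g + lead \<omega> l f * g"
  using assms(1)
proof (induction rule: KX_hom_induct[where \<omega> = \<omega>])
  case zero
  then show ?case by (simp add: lead_zero)
next
  case (hom k f)
  then show ?case using lead_mult_hom assms(2) by blast
next
  case (add f h)
  then show ?case
    using assms(2) by (simp add: distrib_right lead_add mult_closed add_ac)
qed

context
  fixes l
  assumes lower: "\<And>j f k. homogeneous \<omega> j f \<Longrightarrow> k < j + l \<Longrightarrow> component \<omega> k (D f) = 0"
begin

text \<open>If \<open>D\<close> never raises degrees by less than \<open>l\<close>, the lowest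
  possible component of \<open>(D ^^ n) f\<close> can only arise by taking the lowest part at every
  step. Hence nilpotency passes from \<open>D\<close> to \<open>lead\<close>.\<close>

lemma lead_iter:
  assumes f: "homogeneous \<omega> j f"
  shows "(\<forall>k < j + int n * l. component \<omega> k ((D ^^ n) f) = 0)
    \<and> (lead \<omega> l ^^ n) f = component \<omega> (j + int n * l) ((D ^^ n) f)"
proof (induction n)
  case 0
  then show ?case using comp_hom[OF adm f] by auto
next
  case (Suc n)
  define g where "g = (D ^^ n) f"
  define k0 where "k0 = j + int n * l"
  have g: "g \<in> KX" unfolding g_def by (intro iter_closed hom_in_KX[OF f])
  have below: "component \<omega> k g = 0" if "k < k0" for k
    using Suc that by (simp add: g_def k0_def)
  have lead_n: "(lead \<omega> l ^^ n) f = component \<omega> k0 g" using Suc by (simp add: g_def k0_def)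
  let ?K = "insert k0 {k. component \<omega> k g \<noteq> 0}"
  have K: "finite ?K" by (simp add: finite_supp[OF adm g])
  note D = component_D[OF g K subset_insertI]
  have vanish: "component \<omega> m (D (component \<omega> k g)) = 0" if "k \<in> ?K" "m < k + l" for k m
    by (rule lower[OF hom_comp[OF adm g] that(2)])
  have ge: "k0 \<le> k" if "k \<in> ?K" for k using that below by force
  have "component \<omega> m (D g) = 0" if "m < k0 + l" for m
    unfolding D by (rule sum.neutral) (use vanish ge that in force)
  moreover have "component \<omega> (k0 + l) (D g) = (\<Sum>k\<in>{k0}. component \<omega> (k0 + l) (D (component \<omega> k g)))"
    unfolding D by (rule sum.mono_neutral_right) (use vanish ge K in force)+
  moreover have "lead \<omega> l (component \<omega> k0 g) = component \<omega> (k0 + l) (D (component \<omega> k0 g))"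
    by (rule lead_hom[OF hom_comp[OF adm g]])
  moreover have "j + int (Suc n) * l = k0 + l" by (simp add: k0_def algebra_simps)
  ultimately show ?case using lead_n by (simp add: g_def)
qed

lemma lead_lnd: "locally_nilpotent_derivation KX (lead \<omega> l)"
  unfolding locally_nilpotent_derivation_def
proof (intro conjI ballI)
  show "derivation KX (lead \<omega> l)"
    unfolding derivation_def
    using lead_closed lead_add lead_scale lead_mult by (auto simp: plus_fun_def times_fun_def)
  fix f assume f: "f \<in> KX"
  let ?L = "lead \<omega> l"
  have closed: "(?L ^^ n) f \<in> KX" if "f \<in> KX" for n f
    by (induction n) (auto simp: that lead_closed)
  have zero: "(?L ^^ n) 0 = 0" for n
    by (induction n) (simp_all only: funpow.simps id_apply o_apply lead_zero)
  have add: "(?L ^^ n) (f + g) = (?L ^^ n) f + (?L ^^ n) g" if "f \<in> KX" "g \<in> KX" for n f g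
    by (induction n) (simp_all add: lead_add closed that)
  have mono: "(?L ^^ (m + n)) f = 0" if "(?L ^^ n) f = 0" for m n f
    using that zero by (simp add: funpow_add)
  have "\<exists>n. (?L ^^ n) f = 0" using f
  proof (induction rule: KX_hom_induct[where \<omega> = \<omega>])
    case zero
    show ?case by (rule exI[of _ 0]) simp
  next
    case (hom k f)
    obtain n where "(D ^^ n) f = 0" using D_nilpotent[OF hom_in_KX[OF hom]] by blast
    then show ?case using lead_iter[OF hom, of n] comp_zero[OF adm] by auto
  next
    case (add f g)
    then obtain m n where "(?L ^^ m) f = 0" "(?L ^^ n) g = 0" by blast
    then have "(?L ^^ (n + m)) (f + g) = 0"
      using mono[of m f n] mono[of n g m] \<open>f \<in> KX\<close> \<open>g \<in> KX\<close> \<open>\<And>n f g. f \<in> KX \<Longrightarrow> g \<in> KX \<Longrightarrow> (?L ^^ n) (f + g) = (?L ^^ n) f + (?L ^^ n) g\<close>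
      by (simp add: add.commute)
    then show ?case by blast
  qed
  then obtain n where "(?L ^^ n) f = 0" by blast
  then show "\<exists>n>0. (?L ^^ n) f = (\<lambda>_. 0)"
    using mono[of n f 1] by (intro exI[of _ "1 + n"]) (auto simp: zero_fun_def)
qed

end

text \<open>By the Leibniz rule a lower bound for the degree shift needs checking on the coordinates
  only.\<close>

lemma lower_if_coordinates:
  assumes l: "\<And>i k. i \<in> I \<Longrightarrow> component \<omega> (\<omega> i + k) (D (T i)) \<noteq> 0 \<Longrightarrow> l \<le> k"
    and f: "homogeneous \<omega> j f" and k: "k < j + l"
  shows "component \<omega> k (D f) = 0"
proof -
  have mono: "\<forall>k < wt I \<omega> e + l. component \<omega> k (D (M I e)) = 0" for e
  proof -
    have "\<exists>j. homogeneous \<omega> j (M I e) \<and> (\<forall>k < j + l. component \<omega> k (D (M I e)) = 0)"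
      using subset_refl
    proof (induction rule: M_induct)
      case unit
      show ?case by (rule exI[of _ 0]) (simp add: hom_unit D_unit comp_zero[OF adm])
    next
      case (mult i f)
      then obtain j where j: "homogeneous \<omega> j f" "\<And>k. k < j + l \<Longrightarrow> component \<omega> k (D f) = 0" by blast
      have i: "i \<in> I" "T i \<in> KX" using mult by (auto intro: T_in_KX)
      have "component \<omega> k (D (T i * f)) = 0" if "k < \<omega> i + j + l" for k
      proof -
        have "component \<omega> k (D (T i * f)) = component \<omega> k (T i * D f) + component \<omega> k (f * D (T i))"
          using i mult by (simp add: D_mult comp_add[OF adm] mult_closed D_closed mult.commute)
        also have "component \<omega> k (T i * D f) = T i * component \<omega> (k - \<omega> i) (D f)"
          using comp_hom_mult[OF adm hom_T[OF i(1)] D_closed[OF mult.hyps(2)], of "k - \<omega> i"] by simp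
        also have "component \<omega> (k - \<omega> i) (D f) = 0" using that by (intro j(2)) simp
        also have "component \<omega> k (f * D (T i)) = f * component \<omega> (\<omega> i + (k - j - \<omega> i)) (D (T i))"
          using comp_hom_mult[OF adm j(1) D_closed[OF i(2)], of "k - j"] by simp
        also have "component \<omega> (\<omega> i + (k - j - \<omega> i)) (D (T i)) = 0"
          using l[OF i(1), of "k - j - \<omega> i"] that by force
        finally show ?thesis by simp
      qed
      then show ?case using hom_mult[OF hom_T[OF i(1)] j(1)] by blast
    qed
    then show ?thesis
      using hom_unique[OF adm _ hom_M[OF subset_refl] M_nonzero[OF subset_refl]] by metis
  qed
  obtain ts where ts: "\<forall>(c, e)\<in>set ts. wt I \<omega> e = j" "f = res (tsum I ts)"
    using f by (auto simp: homogeneous_def)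
  have "component \<omega> k (D (res (tsum I ts))) = 0" using ts(1)
  proof (induction ts)
    case Nil
    have "res (tsum I []) = 0" by (auto simp: res_eq_0_iff)
    then show ?case by (simp only: D_zero comp_zero[OF adm])
  next
    case (Cons t ts)
    obtain c e where t: "t = (c, e)" by (cases t)
    have eq: "res (tsum I (t # ts)) = (\<lambda>x. c * M I e x) + res (tsum I ts)"
      by (auto simp: t M_def res_scale res_add res_eq_iff)
    have K: "M I e \<in> KX" "res (tsum I ts) \<in> KX" by (simp_all add: M_in_KX res_in_KX tsum_poly)
    have "component \<omega> k (D (M I e)) = 0" using mono[of e] Cons.prems k by (simp add: t)
    then show ?case
      using Cons unfolding eq
      by (simp add: D_add comp_add[OF adm] D_scale comp_scale[OF adm] K D_closed scale_closed)
         (simp add: fun_eq_iff fun_apply)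
  qed
  then show ?thesis by (simp add: ts(2))
qed

text \<open>There are finitely many coordinates and each image has finitely many components, so a
  least shift \<open>l\<close> exists. Keeping homogeneity for other weights and the killed
  coordinates allows iteration; the minimality of \<open>l\<close> is recorded to show later that
  \<open>l\<close> is negative.\<close>

lemma homogenize:
  assumes "i0 \<in> I" "D (T i0) \<noteq> 0"
  shows "\<exists>D' l. locally_nilpotent_derivation KX D' \<and> (\<exists>i\<in>I. D' (T i) \<noteq> 0) \<and>
    (\<forall>j f. homogeneous \<omega> j f \<longrightarrow> homogeneous \<omega> (j + l) (D' f)) \<and>
    (\<forall>\<omega>' \<delta>. (\<forall>j f. homogeneous \<omega>' j f \<longrightarrow> homogeneous \<omega>' (j + \<delta>) (D f)) \<longrightarrow>
      (\<forall>j f. homogeneous \<omega>' j f \<longrightarrow> homogeneous \<omega>' (j + \<delta>) (D' f))) \<and>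
    (\<forall>i\<in>I. D (T i) = 0 \<longrightarrow> D' (T i) = 0) \<and>
    (\<forall>i\<in>I. \<forall>k. component \<omega> (\<omega> i + k) (D (T i)) \<noteq> 0 \<longrightarrow> l \<le> k)"
proof -
  let ?L = "\<Union>i\<in>I. (\<lambda>k. k - \<omega> i) ` {k. component \<omega> k (D (T i)) \<noteq> 0}"
  have finL: "finite ?L"
    using finite_I by (auto intro!: finite_supp[OF adm] D_closed T_in_KX)
  have mem: "k \<in> ?L \<longleftrightarrow> (\<exists>i\<in>I. component \<omega> (\<omega> i + k) (D (T i)) \<noteq> 0)" for k
    by (force simp: image_iff algebra_simps)
  have "\<exists>k. component \<omega> k (D (T i0)) \<noteq> 0"
    using sum_supp[OF adm D_closed[OF T_in_KX[OF assms(1)]], of "{}"] assms(2) by auto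
  then have "?L \<noteq> {}" using assms(1) by blast
  define l where "l = Min ?L"
  have l: "l \<in> ?L" unfolding l_def by (rule Min_in[OF finL \<open>?L \<noteq> {}\<close>])
  have min: "l \<le> k" if "i \<in> I" "component \<omega> (\<omega> i + k) (D (T i)) \<noteq> 0" for i k
    unfolding l_def using that mem by (intro Min_le[OF finL]) blast
  note lower = lower_if_coordinates[OF min]
  show ?thesis
  proof (intro exI[of _ "lead \<omega> l"] exI[of _ l] conjI allI ballI impI)
    show "locally_nilpotent_derivation KX (lead \<omega> l)" using lower by (rule lead_lnd)
    obtain i where i: "i \<in> I" "component \<omega> (\<omega> i + l) (D (T i)) \<noteq> 0" using l mem by blast
    then show "\<exists>i\<in>I. lead \<omega> l (T i) \<noteq> 0" using lead_hom[OF hom_T] by metis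
    show "homogeneous \<omega> (j + l) (lead \<omega> l f)" if "homogeneous \<omega> j f" for j f
      by (simp add: lead_hom[OF that] hom_comp[OF adm] D_closed hom_in_KX[OF that])
    show "homogeneous \<omega>' (j + \<delta>) (lead \<omega> l f)"
      if D: "\<forall>j f. homogeneous \<omega>' j f \<longrightarrow> homogeneous \<omega>' (j + \<delta>) (D f)" and f: "homogeneous \<omega>' j f"
      for \<omega>' \<delta> j f
    proof -
      have sum: "homogeneous \<omega>' m (sum h K)" if "\<And>k. k \<in> K \<Longrightarrow> homogeneous \<omega>' m (h k)" for m h and K :: "int set"
        using that by (induction K rule: infinite_finite_induct) (auto intro: hom_0 hom_add)
      show ?thesis
        unfolding lead_def by (intro sum hom_comp_other[OF adm] D[rule_format] f)
    qed
    show "lead \<omega> l (T i) = 0" if "i \<in> I" "D (T i) = 0" for i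
      using lead_hom[OF hom_T[OF that(1)]] that(2) comp_zero[OF adm] by simp
  qed (rule min)
qed

end

end

section \<open>Homogeneous elements of the kernel\<close>

lemma homogenization_poly:
  fixes c :: "nat \<Rightarrow> 'k::field"
  assumes "Y \<noteq> 0"
  shows "(\<Sum>i\<le>n. c i * X ^ i * Y ^ (n - i)) = Y ^ n * (\<Sum>i\<le>n. c i * (X / Y) ^ i)"
  unfolding sum_distrib_left
proof (rule sum.cong)
  fix i assume "i \<in> {..n}"
  then have "Y ^ n = Y ^ i * Y ^ (n - i)" by (simp add: power_add[symmetric])
  then show "c i * X ^ i * Y ^ (n - i) = Y ^ n * (c i * (X / Y) ^ i)"
    using assms by (simp add: power_divide)
qed simp

text \<open>Dehomogenize and take a root. If the coefficient of the highest power of X vanishes, the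
  root lies at infinity and Y is the factor.\<close>

lemma binary_form_linear_factor:
  fixes g :: "nat \<Rightarrow> 'k::alg_closed_field"
  obtains \<alpha> \<beta> g' where "\<alpha> \<noteq> 0 \<or> \<beta> \<noteq> 0"
    "\<And>X Y. (\<Sum>i\<le>Suc n. g i * X ^ i * Y ^ (Suc n - i)) = (\<alpha> * X + \<beta> * Y) * (\<Sum>i\<le>n. g' i * X ^ i * Y ^ (n - i))"
proof (cases "g (Suc n) = 0")
  case True
  have "(\<Sum>i\<le>Suc n. g i * X ^ i * Y ^ (Suc n - i)) = (0 * X + 1 * Y) * (\<Sum>i\<le>n. g i * X ^ i * Y ^ (n - i))" for X Y
    using True by (auto simp: sum_distrib_left Suc_diff_le intro!: sum.cong)
  then show ?thesis by (rule that[rotated]) simp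
next
  case False
  define p where "p = (\<Sum>i\<le>Suc n. monom (g i) i)"
  have cp: "coeff p k = (if k \<le> Suc n then g k else 0)" for k
    unfolding p_def coeff_sum by auto
  have deg: "degree p = Suc n"
    by (rule antisym[OF degree_le le_degree]) (use False in \<open>auto simp: cp\<close>)
  then obtain r where r: "poly p r = 0" using alg_closed_imp_poly_has_root[of p] by auto
  then obtain q where q: "p = [:- r, 1:] * q" by (auto simp: poly_eq_0_iff_dvd dvd_def)
  have "q \<noteq> 0" using deg q by auto
  then have "degree p = Suc (degree q)" unfolding q by (subst degree_mult_eq) auto
  then have degq: "degree q = n" using deg by simp
  have "coeff p (Suc n) = coeff q n"
    using degq coeff_eq_0[of q "Suc n"] by (simp add: q)
  then have lead: "g (Suc n) = coeff q n" by (simp add: cp)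
  have py: "poly p x = (\<Sum>i\<le>Suc n. g i * x ^ i)" for x
    unfolding p_def poly_sum by (simp add: poly_monom)
  have "(\<Sum>i\<le>Suc n. g i * X ^ i * Y ^ (Suc n - i)) = (1 * X + (- r) * Y) * (\<Sum>i\<le>n. coeff q i * X ^ i * Y ^ (n - i))" for X Y
  \<comment> \<open>At Y = 0 dehomogenizing is impossible; both sides reduce to their leading
    terms.\<close>
  proof (cases "Y = 0")
    case True
    have "(\<Sum>i\<le>k. h i * X ^ i * 0 ^ (k - i)) = h k * X ^ k" for h :: "nat \<Rightarrow> 'k" and k
    proof -
      have "(\<Sum>i\<le>k. h i * X ^ i * 0 ^ (k - i)) = (\<Sum>i\<in>{k}. h i * X ^ i * 0 ^ (k - i))"
        by (rule sum.mono_neutral_right) auto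
      then show ?thesis by simp
    qed
    then show ?thesis using True lead by simp
  next
    case False
    have "(\<Sum>i\<le>Suc n. g i * X ^ i * Y ^ (Suc n - i)) = Y ^ Suc n * poly p (X / Y)"
      unfolding homogenization_poly[OF False] py ..
    also have "poly p (X / Y) = (X / Y - r) * (\<Sum>i\<le>n. coeff q i * (X / Y) ^ i)"
      using degq by (simp add: q poly_altdef[of q] algebra_simps)
    also have "Y ^ Suc n * \<dots> = (1 * X + (- r) * Y) * (Y ^ n * (\<Sum>i\<le>n. coeff q i * (X / Y) ^ i))"
      using False by (simp add: field_simps)
    finally show ?thesis unfolding homogenization_poly[OF False] .
  qed
  then show ?thesis by (rule that[rotated]) simp
qed

context trinomial
begin

lemma hom_dvd_coordinate:
  assumes i: "i \<in> I" and e: "\<And>e. wt I \<omega> e = k \<Longrightarrow> 1 \<le> e i" and f: "homogeneous \<omega> k f"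
  shows "\<exists>g\<in>KX. f = T i * g"
proof -
  obtain ts where ts: "\<forall>(c, e)\<in>set ts. wt I \<omega> e = k" "f = res (tsum I ts)"
    using f by (auto simp: homogeneous_def)
  have "\<exists>g\<in>KX. res (tsum I ts) = T i * g" using ts(1)
  proof (induction ts)
    case Nil
    have "res (tsum I []) = T i * 0" by (auto simp: res_def fun_eq_iff fun_apply)
    then show ?case using KX_closed(1) by blast
  next
    case (Cons t ts)
    obtain c d where t: "t = (c, d)" by (cases t)
    obtain g where g: "g \<in> KX" "res (tsum I ts) = T i * g" using Cons by auto
    have "1 \<le> d i" using Cons.prems by (intro e) (simp add: t)
    then obtain m where m: "m \<in> KX" "M I d = T i * m"
      using M_factor[OF subset_refl i] by blast
    have "res (tsum I (t # ts)) = (\<lambda>x. c * M I d x) + res (tsum I ts)"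
      by (auto simp: t M_def res_scale res_add res_eq_iff)
    also have "\<dots> = T i * ((\<lambda>x. c * m x) + g)"
      unfolding m(2) g(2) by (auto simp: fun_eq_iff fun_apply algebra_simps)
    finally show ?case using KX_closed(2)[OF KX_closed(4)[OF m(1)] g(1)] by blast
  qed
  then show ?thesis by (simp add: ts(2))
qed

text \<open>The weights \<open>weight t y q\<close> for all \<open>t \<in> J0\<close>, \<open>y \<in> J1\<close>, \<open>q \<in> J2\<close> generate, up to torsion, the
  finest grading for which the trinomial is homogeneous.\<close>

definition weight :: "'i \<Rightarrow> 'i \<Rightarrow> 'i \<Rightarrow> 'i \<Rightarrow> int" where
  "weight t y q = (\<lambda>i. if i = t then int (\<mu> y * \<mu> q) else if i = y then int (\<mu> t * \<mu> q)
     else if i = q then 2 * int (\<mu> t * \<mu> y) else 0)"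

lemma wt_single: "finite S \<Longrightarrow> wt S (\<lambda>i. if i = t then c else 0) e = (if t \<in> S then int (e t) * c else 0)"
  by (simp add: wt_def if_distrib[of "\<lambda>x. _ * x"] cong: if_cong)

lemma wt_sum: "wt S (\<lambda>i. \<omega> i + \<omega>' i) e = wt S \<omega> e + wt S \<omega>' e"
  by (simp add: wt_def distrib_left sum.distrib)

lemma wt_weight:
  assumes "t \<in> J0" "y \<in> J1" "q \<in> J2" "finite S"
  shows "wt S (weight t y q) e = (if t \<in> S then int (e t * (\<mu> y * \<mu> q)) else 0)
    + (if y \<in> S then int (e y * (\<mu> t * \<mu> q)) else 0) + (if q \<in> S then int (e q) * (2 * int (\<mu> t * \<mu> y)) else 0)"
proof -
  have "t \<noteq> y" "t \<noteq> q" "y \<noteq> q" using assms disjoint by auto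
  then have "weight t y q = (\<lambda>i. (if i = t then int (\<mu> y * \<mu> q) else 0)
      + (if i = y then int (\<mu> t * \<mu> q) else 0) + (if i = q then 2 * int (\<mu> t * \<mu> y) else 0))"
    by (auto simp: weight_def fun_eq_iff)
  then show ?thesis by (simp only: wt_sum wt_single[OF assms(4)]) simp
qed

lemma admissible_weight:
  assumes "t \<in> J0" "y \<in> J1" "q \<in> J2"
  shows "admissible (weight t y q)" "wt J0 (weight t y q) \<mu> = int (\<mu> t * (\<mu> y * \<mu> q))"
proof -
  have "t \<notin> J1" "t \<notin> J2" "y \<notin> J0" "y \<notin> J2" "q \<notin> J0" "q \<notin> J1" using assms disjoint by auto
  then show "admissible (weight t y q)" "wt J0 (weight t y q) \<mu> = int (\<mu> t * (\<mu> y * \<mu> q))"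
    unfolding admissible_def by (simp_all add: wt_weight assms finite_blocks)
qed

definition weights :: "('i \<Rightarrow> int) set" where
  "weights = (\<lambda>(t, y, q). weight t y q) ` (J0 \<times> J1 \<times> J2)"

lemma finite_weights: "finite weights"
  by (simp add: weights_def finite_blocks)

lemma weights_admissible: "\<omega> \<in> weights \<Longrightarrow> admissible \<omega>"
  by (auto simp: weights_def admissible_weight)

text \<open>Filtering by one weight after another keeps the function, since it is its own component
  each time.\<close>

lemma multihomogeneous_terms:
  assumes "finite W" "\<And>\<omega>. \<omega> \<in> W \<Longrightarrow> admissible \<omega>" "\<And>\<omega>. \<omega> \<in> W \<Longrightarrow> homogeneous \<omega> (\<kappa> \<omega>) h" "h \<in> KX"
  shows "\<exists>ts. h = res (tsum I ts) \<and> (\<forall>(c, e)\<in>set ts. \<forall>\<omega>\<in>W. wt I \<omega> e = \<kappa> \<omega>)"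
  using assms(1-3)
proof (induction W)
  case empty
  then show ?case using assms(4) by (auto simp: KX_tsum)
next
  case (insert \<omega> W)
  have "\<exists>ts. h = res (tsum I ts) \<and> (\<forall>(c, e)\<in>set ts. \<forall>\<omega>\<in>W. wt I \<omega> e = \<kappa> \<omega>)"
    by (rule insert.IH) (simp_all add: insert.prems)
  then obtain ts where ts: "h = res (tsum I ts)" "\<forall>(c, e)\<in>set ts. \<forall>\<omega>\<in>W. wt I \<omega> e = \<kappa> \<omega>"
    by blast
  have adm: "admissible \<omega>" using insert.prems by simp
  have "component \<omega> (\<kappa> \<omega>) h = h" using comp_hom[OF adm, of "\<kappa> \<omega>" h] insert.prems by simp
  then have "h = res (tsum I (filter (\<lambda>(c, e). wt I \<omega> e = \<kappa> \<omega>) ts))"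
    using comp_tsum[OF adm, of "\<kappa> \<omega>" ts] ts(1) by simp
  moreover have "\<forall>(c, e)\<in>set (filter (\<lambda>(c, e). wt I \<omega> e = \<kappa> \<omega>) ts). \<forall>\<omega>'\<in>insert \<omega> W. wt I \<omega>' e = \<kappa> \<omega>'"
    using ts(2) by auto
  ultimately show ?case by blast
qed

text \<open>Testing with all triples shows that exponents of equal weight differ by a multiple of
  \<open>\<mu>\<close> on each block. The odd exponent makes the multiple \<open>\<rho>\<close> on
  \<open>J2\<close> integral: if all exponents in \<open>J2\<close> were even, a square root of
  \<open>P\<close> would have the weight of \<open>A\<close>.\<close>

lemma exponents_of_equal_weight:
  assumes w: "\<And>t y q. t \<in> J0 \<Longrightarrow> y \<in> J1 \<Longrightarrow> q \<in> J2 \<Longrightarrow> wt I (weight t y q) e = wt I (weight t y q) e'"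
    and odd: "q' \<in> J2" "odd (\<mu> q')"
  shows "\<exists>\<rho>. (\<forall>i\<in>J0. int (e i) - int (e' i) = int (\<mu> i) * (int (e x0) - int (e' x0))) \<and>
    (\<forall>i\<in>J1. int (e i) - int (e' i) = int (\<mu> i) * (int (e y0) - int (e' y0))) \<and>
    (\<forall>i\<in>J2. int (e i) - int (e' i) = int (\<mu> i) * \<rho>) \<and>
    (int (e x0) - int (e' x0)) + (int (e y0) - int (e' y0)) + 2 * \<rho> = 0"
proof -
  define \<Delta> where "\<Delta> = (\<lambda>i. int (e i) - int (e' i))"
  have rel: "int (\<mu> y) * int (\<mu> q) * \<Delta> t + int (\<mu> t) * int (\<mu> q) * \<Delta> y + 2 * int (\<mu> t) * int (\<mu> y) * \<Delta> q = 0"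
    if "t \<in> J0" "y \<in> J1" "q \<in> J2" for t y q
  proof -
    have "t \<in> I" "y \<in> I" "q \<in> I" using that blocks_subset by auto
    then show ?thesis
      using w[OF that] by (simp add: wt_weight that finite_I \<Delta>_def algebra_simps)
  qed
  have q': "int (\<mu> q') \<noteq> 0" using \<mu>_ge2[OF odd(1)] by simp
  have base: "int (\<mu> q') * \<Delta> x0 + int (\<mu> q') * \<Delta> y0 + 2 * \<Delta> q' = 0"
    using rel[OF x0(1) y0(1) odd(1)] by (simp add: x0 y0)
  have J0: "\<Delta> t = int (\<mu> t) * \<Delta> x0" if "t \<in> J0" for t
  proof -
    have "int (\<mu> q') * \<Delta> t + int (\<mu> t) * int (\<mu> q') * \<Delta> y0 + 2 * int (\<mu> t) * \<Delta> q' = 0"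
      using rel[OF that y0(1) odd(1)] by (simp add: y0)
    then have "int (\<mu> q') * (\<Delta> t - int (\<mu> t) * \<Delta> x0) = 0"
      using base by algebra
    then show ?thesis using q' by simp
  qed
  have J1: "\<Delta> y = int (\<mu> y) * \<Delta> y0" if "y \<in> J1" for y
  proof -
    have "int (\<mu> y) * int (\<mu> q') * \<Delta> x0 + int (\<mu> q') * \<Delta> y + 2 * int (\<mu> y) * \<Delta> q' = 0"
      using rel[OF x0(1) that odd(1)] by (simp add: x0)
    then have "int (\<mu> q') * (\<Delta> y - int (\<mu> y) * \<Delta> y0) = 0"
      using base by algebra
    then show ?thesis using q' by simp
  qed
  have J2: "2 * \<Delta> q = - (int (\<mu> q) * (\<Delta> x0 + \<Delta> y0))" if "q \<in> J2" for q
    using rel[OF x0(1) y0(1) that] by (simp add: x0 y0 algebra_simps)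
  have "even (int (\<mu> q') * (\<Delta> x0 + \<Delta> y0))" using J2[OF odd(1)] by (metis dvd_minus_iff dvd_triv_left)
  then have "even (\<Delta> x0 + \<Delta> y0)" using odd(2) by simp
  then obtain \<rho> where \<rho>: "\<Delta> x0 + \<Delta> y0 = 2 * \<rho>" by blast
  have "\<Delta> q = int (\<mu> q) * - \<rho>" if "q \<in> J2" for q using J2[OF that] \<rho> by simp
  then have "\<exists>\<rho>. (\<forall>i\<in>J0. \<Delta> i = int (\<mu> i) * \<Delta> x0) \<and> (\<forall>i\<in>J1. \<Delta> i = int (\<mu> i) * \<Delta> y0) \<and>
      (\<forall>i\<in>J2. \<Delta> i = int (\<mu> i) * \<rho>) \<and> \<Delta> x0 + \<Delta> y0 + 2 * \<rho> = 0"
    using J0 J1 \<rho> by (intro exI[of _ "- \<rho>"]) auto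
  then show ?thesis by (simp only: \<Delta>_def)
qed

text \<open>Terms of equal weight differ by powers of \<open>A\<close>, \<open>B\<close> and
  \<open>P\<close>. After pulling out a common monomial, products of total degree \<open>n\<close>
  remain, with \<open>P\<close> counting twice, and P = - (A ^ 2 + B ^ 2) on \<open>X\<close> turns
  them into binary forms.\<close>

lemma multihomogeneous_form:
  assumes h: "h \<in> KX" "h \<noteq> 0" "\<And>\<omega>. \<omega> \<in> weights \<Longrightarrow> homogeneous \<omega> (\<kappa> \<omega>) h"
    and odd: "q' \<in> J2" "odd (\<mu> q')"
  obtains f n g where "h = (\<lambda>x. M I f x * (\<Sum>i\<le>n. g i * AX x ^ i * BX x ^ (n - i)))"
proof -
  obtain ts where ts: "h = res (tsum I ts)" "\<forall>(c, e)\<in>set ts. \<forall>\<omega>\<in>weights. wt I \<omega> e = \<kappa> \<omega>"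
    using multihomogeneous_terms[OF finite_weights weights_admissible h(3,1)] by blast
  define E where "E = snd ` set ts"
  have "ts \<noteq> []" using h(2) ts(1) by (auto simp: res_eq_0_iff)
  then have E: "finite E" "E \<noteq> {}" by (auto simp: E_def)
  have wE: "wt I (weight t y q) e = wt I (weight t y q) e'"
    if "e \<in> E" "e' \<in> E" "t \<in> J0" "y \<in> J1" "q \<in> J2" for e e' t y q
  proof -
    have "weight t y q \<in> weights" using that by (force simp: weights_def)
    then have "wt I (weight t y q) e = \<kappa> (weight t y q)" "wt I (weight t y q) e' = \<kappa> (weight t y q)"
      using ts(2) that(1,2) by (fastforce simp: E_def)+
    then show ?thesis by simp
  qed
  have min: "\<exists>m\<in>E. \<forall>e\<in>E. w m \<le> w e" for w :: "('i \<Rightarrow> nat) \<Rightarrow> int"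
  proof -
    have "Min (w ` E) \<in> w ` E" using E by (intro Min_in) auto
    then obtain m where "m \<in> E" "w m = Min (w ` E)" by auto
    then show ?thesis using E(1) by (intro bexI[of _ m]) auto
  qed
  obtain ea where ea: "ea \<in> E" "\<And>e. e \<in> E \<Longrightarrow> ea x0 \<le> e x0"
    using min[of "\<lambda>e. int (e x0)"] by auto
  obtain eb where eb: "eb \<in> E" "\<And>e. e \<in> E \<Longrightarrow> eb y0 \<le> e y0"
    using min[of "\<lambda>e. int (e y0)"] by auto
  \<comment> \<open>The largest \<open>e x0 + e y0\<close> means the smallest power of
    \<open>P\<close>, by the last relation in \<open>exponents_of_equal_weight\<close>.\<close>
  obtain ec where ec: "ec \<in> E" "\<And>e. e \<in> E \<Longrightarrow> - int (ec x0 + ec y0) \<le> - int (e x0 + e y0)"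
    using min[of "\<lambda>e. - int (e x0 + e y0)"] by blast
  have rels: "\<exists>\<rho>. (\<forall>i\<in>J0. int (e i) - int (e' i) = int (\<mu> i) * (int (e x0) - int (e' x0))) \<and>
      (\<forall>i\<in>J1. int (e i) - int (e' i) = int (\<mu> i) * (int (e y0) - int (e' y0))) \<and>
      (\<forall>i\<in>J2. int (e i) - int (e' i) = int (\<mu> i) * \<rho>) \<and>
      (int (e x0) - int (e' x0)) + (int (e y0) - int (e' y0)) + 2 * \<rho> = 0"
    if "e \<in> E" "e' \<in> E" for e e'
    using exponents_of_equal_weight[of e e' q', OF wE[OF that] odd] by blast
  \<comment> \<open>The common monomial takes its exponents blockwise from three possibly different
    terms.\<close>
  define f where "f i = (if i \<in> J0 then ea i else if i \<in> J1 then eb i else ec i)" for i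
  define n where "n = (ec x0 + ec y0) - (ea x0 + eb y0)"
  have split: "\<exists>a b c. a + b + 2 * c = n \<and> (\<forall>x\<in>X. mon I e x = mon I f x * (A x ^ a * B x ^ b * P x ^ c))"
    if e: "e \<in> E" for e
  proof -
    have 1: "\<And>i. i \<in> J0 \<Longrightarrow> int (e i) - int (ea i) = int (\<mu> i) * (int (e x0) - int (ea x0))"
      using rels[OF e ea(1)] by blast
    have 2: "\<And>i. i \<in> J1 \<Longrightarrow> int (e i) - int (eb i) = int (\<mu> i) * (int (e y0) - int (eb y0))"
      using rels[OF e eb(1)] by blast
    obtain \<rho> where 3: "\<And>i. i \<in> J2 \<Longrightarrow> int (e i) - int (ec i) = int (\<mu> i) * \<rho>"
      "(int (e x0) - int (ec x0)) + (int (e y0) - int (ec y0)) + 2 * \<rho> = 0"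
      using rels[OF e ec(1)] by blast
    define a where "a = e x0 - ea x0"
    define b where "b = e y0 - eb y0"
    define c where "c = nat \<rho>"
    have a: "int a = int (e x0) - int (ea x0)" using ea(2)[OF e] by (simp add: a_def)
    have b: "int b = int (e y0) - int (eb y0)" using eb(2)[OF e] by (simp add: b_def)
    have "0 \<le> \<rho>" using 3(2) ec(2)[OF e] by simp
    then have c: "int c = \<rho>" by (simp add: c_def)
    have ei: "e i = f i + (if i \<in> J0 then \<mu> i * a else if i \<in> J1 then \<mu> i * b else \<mu> i * c)" if "i \<in> I" for i
    proof -
      have "int (e i) = int (f i + (if i \<in> J0 then \<mu> i * a else if i \<in> J1 then \<mu> i * b else \<mu> i * c))"
        using that 1[of i] 2[of i] 3(1)[of i] by (auto simp: f_def I_eq a b c)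
      then show ?thesis by (simp only: of_nat_eq_iff)
    qed
    have "mon I e x = mon I f x * (A x ^ a * B x ^ b * P x ^ c)" for x :: "'i \<Rightarrow> 'k"
    proof -
      define r where "r i = (if i \<in> J0 then \<mu> i * a else if i \<in> J1 then \<mu> i * b else \<mu> i * c)" for i
      have "(J0 \<union> J1) \<inter> J2 = {}" using disjoint by auto
      then have union: "mon I r x = mon J0 r x * mon J1 r x * mon J2 r x"
        using prod.union_disjoint[of "J0 \<union> J1" J2 "\<lambda>i. x i ^ r i"]
          prod.union_disjoint[of J0 J1 "\<lambda>i. x i ^ r i"] finite_blocks disjoint(1)
        by (simp add: mon_def I_eq)
      have "mon I e x = mon I (\<lambda>i. f i + r i) x"
        unfolding mon_def by (intro prod.cong) (simp_all add: ei r_def)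
      also have "\<dots> = mon I f x * mon I r x" by (rule mon_add)
      also note union
      also have "mon J0 r x = A x ^ a"
        by (auto simp: r_def mon_def prod_power_distrib power_mult intro!: prod.cong)
      also have "mon J1 r x = B x ^ b"
        unfolding mon_def prod_power_distrib power_mult[symmetric]
        using disjoint by (intro prod.cong) (auto simp: r_def)
      also have "mon J2 r x = P x ^ c"
        unfolding mon_def prod_power_distrib power_mult[symmetric]
        using disjoint by (intro prod.cong) (auto simp: r_def)
      finally show ?thesis .
    qed
    moreover have "a + b + 2 * c = n"
      unfolding n_def using a b c 3(2) by linarith
    ultimately show ?thesis by blast
  qed
  have single: "\<exists>g. \<forall>x\<in>X. mon I e x = mon I f x * (\<Sum>i\<le>n. g i * A x ^ i * B x ^ (n - i))" if e: "e \<in> E" for e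
  proof -
    obtain a b c where abc: "a + b + 2 * c = n"
      "\<And>x. x \<in> X \<Longrightarrow> mon I e x = mon I f x * (A x ^ a * B x ^ b * P x ^ c)"
      using split[OF e] by blast
    define g where "g i = (\<Sum>j\<le>c. if i = a + 2 * j then (- 1) ^ c * of_nat (c choose j) else (0::'k))" for i
    have "A x ^ a * B x ^ b * P x ^ c = (\<Sum>i\<le>n. g i * A x ^ i * B x ^ (n - i))" if x: "x \<in> X" for x
    proof -
      have "P x = - (A x ^ 2 + B x ^ 2)" using X_zero[OF x] add_eq_0_iff by blast
      then have "P x = - 1 * (A x ^ 2 + B x ^ 2)" by simp
      then have "P x ^ c = (- 1) ^ c * (A x ^ 2 + B x ^ 2) ^ c" by (simp only: power_mult_distrib)
      also have "(A x ^ 2 + B x ^ 2) ^ c = (\<Sum>j\<le>c. of_nat (c choose j) * (A x ^ 2) ^ j * (B x ^ 2) ^ (c - j))"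
        by (rule binomial_ring)
      finally have "A x ^ a * B x ^ b * P x ^ c = (\<Sum>j\<le>c. A x ^ a * B x ^ b *
          ((- 1) ^ c * (of_nat (c choose j) * (A x ^ 2) ^ j * (B x ^ 2) ^ (c - j))))"
        by (simp only: sum_distrib_left)
      also have "\<dots> = (\<Sum>j\<le>c. (- 1) ^ c * of_nat (c choose j) * A x ^ (a + 2 * j) * B x ^ (n - (a + 2 * j)))"
      proof (rule sum.cong)
        fix j assume "j \<in> {..c}"
        then have "n - (a + 2 * j) = b + 2 * (c - j)" using abc(1) by auto
        then show "A x ^ a * B x ^ b * ((- 1) ^ c * (of_nat (c choose j) * (A x ^ 2) ^ j * (B x ^ 2) ^ (c - j)))
          = (- 1) ^ c * of_nat (c choose j) * A x ^ (a + 2 * j) * B x ^ (n - (a + 2 * j))"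
          by (simp add: power_add power_mult)
      qed simp
      also have "\<dots> = (\<Sum>j\<le>c. \<Sum>i\<le>n. (if i = a + 2 * j then (- 1) ^ c * of_nat (c choose j) else 0) * A x ^ i * B x ^ (n - i))"
      proof (rule sum.cong)
        fix j assume "j \<in> {..c}"
        then have le: "a + 2 * j \<le> n" using abc(1) by auto
        have "(\<Sum>i\<le>n. (if i = a + 2 * j then (- 1) ^ c * of_nat (c choose j) else 0) * A x ^ i * B x ^ (n - i))
          = (\<Sum>i\<in>{a + 2 * j}. (if i = a + 2 * j then (- 1) ^ c * of_nat (c choose j) else 0) * A x ^ i * B x ^ (n - i))"
          by (rule sum.mono_neutral_right) (use le in auto)
        then show "(- 1) ^ c * of_nat (c choose j) * A x ^ (a + 2 * j) * B x ^ (n - (a + 2 * j))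
          = (\<Sum>i\<le>n. (if i = a + 2 * j then (- 1) ^ c * of_nat (c choose j) else 0) * A x ^ i * B x ^ (n - i))"
          by simp
      qed simp
      also have "\<dots> = (\<Sum>i\<le>n. g i * A x ^ i * B x ^ (n - i))"
        unfolding g_def sum_distrib_right by (rule sum.swap)
      finally show ?thesis .
    qed
    then show ?thesis using abc(2) by auto
  qed
  have "\<exists>g. \<forall>x\<in>X. tsum I us x = mon I f x * (\<Sum>i\<le>n. g i * A x ^ i * B x ^ (n - i))"
    if "set us \<subseteq> set ts" for us
    using that
  proof (induction us)
    case Nil
    show ?case by (rule exI[of _ "\<lambda>_. 0"]) simp
  next
    case (Cons t us)
    obtain c e where t: "t = (c, e)" by (cases t)
    have "e \<in> E" using Cons.prems t by (force simp: E_def)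
    then obtain g where g: "\<forall>x\<in>X. mon I e x = mon I f x * (\<Sum>i\<le>n. g i * A x ^ i * B x ^ (n - i))"
      using single by blast
    obtain g' where g': "\<forall>x\<in>X. tsum I us x = mon I f x * (\<Sum>i\<le>n. g' i * A x ^ i * B x ^ (n - i))"
      using Cons by auto
    have "(\<Sum>i\<le>n. (c * g i + g' i) * A x ^ i * B x ^ (n - i))
      = c * (\<Sum>i\<le>n. g i * A x ^ i * B x ^ (n - i)) + (\<Sum>i\<le>n. g' i * A x ^ i * B x ^ (n - i))" for x
      by (simp add: distrib_right sum.distrib sum_distrib_left mult.assoc)
    then show ?case
      using g g' by (intro exI[of _ "\<lambda>i. c * g i + g' i"]) (simp add: t algebra_simps)
  qed
  then obtain g where g: "\<forall>x\<in>X. tsum I ts x = mon I f x * (\<Sum>i\<le>n. g i * A x ^ i * B x ^ (n - i))"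
    by blast
  then have "h = (\<lambda>x. M I f x * (\<Sum>i\<le>n. g i * AX x ^ i * BX x ^ (n - i)))"
    by (auto simp: ts(1) M_def res_def)
  then show ?thesis by (rule that)
qed

end

section \<open>Derivations homogeneous for all weights\<close>

context trinomial_lnd
begin

lemma D_M_eq_0:
  assumes S: "S \<subseteq> I" and D: "\<And>i. i \<in> S \<Longrightarrow> D (T i) = 0"
  shows "D (M S e) = 0"
  using S
proof (induction rule: M_induct)
  case (mult i f)
  have "i \<in> I" using mult.hyps S by blast
  then have "D (T i * f) = T i * D f + D (T i) * f" by (intro D_mult T_in_KX mult.hyps)
  then show ?case using mult.IH D[OF mult.hyps(1)] by simp
qed (rule D_unit)

text \<open>A homogeneous element of the kernel is a monomial times a product of linear forms in
  \<open>A\<close> and \<open>B\<close>, and the kernel is factorially closed.\<close>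

lemma homogeneous_kernel:
  assumes forms: "\<And>\<alpha> \<beta>. \<alpha> \<noteq> 0 \<or> \<beta> \<noteq> 0 \<Longrightarrow> D (\<lambda>x. \<alpha> * AX x + \<beta> * BX x) \<noteq> 0"
    and h: "h \<in> KX" "h \<noteq> 0" "D h = 0" "\<And>\<omega>. \<omega> \<in> weights \<Longrightarrow> homogeneous \<omega> (\<kappa> \<omega>) h"
    and odd: "q' \<in> J2" "odd (\<mu> q')"
  obtains c f where "h = (\<lambda>x. c * M I f x)" "c \<noteq> 0" "\<And>i. i \<in> I \<Longrightarrow> f i \<noteq> 0 \<Longrightarrow> D (T i) = 0"
proof -
  obtain f n g where hf: "h = (\<lambda>x. M I f x * (\<Sum>i\<le>n. g i * AX x ^ i * BX x ^ (n - i)))"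
    using multihomogeneous_form[OF h(1,2,4) odd] by blast
  have fK: "M I f \<in> KX" by (simp add: M_in_KX)
  show ?thesis
  proof (cases n)
    case 0
    then have hc: "h = (\<lambda>x. g 0 * M I f x)" using hf by (simp add: mult.commute)
    then have c: "g 0 \<noteq> 0" using h(2) by (auto simp: fun_eq_iff fun_apply)
    have "(\<lambda>x. g 0 * D (M I f) x) = 0" using h(3) hc D_scale[OF fK] by simp
    then have "D (M I f) = 0" using c by (auto simp: fun_eq_iff fun_apply)
    then have "D (T i) = 0" if "i \<in> I" "f i \<noteq> 0" for i
      using killed_if_M_killed[OF subset_refl _ that(1)] that(2) by simp
    then show ?thesis using that hc c by blast
  next
    case (Suc m)
    obtain \<alpha> \<beta> g' where lf: "\<alpha> \<noteq> 0 \<or> \<beta> \<noteq> 0"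
      "\<And>X Y. (\<Sum>i\<le>Suc m. g i * X ^ i * Y ^ (Suc m - i)) = (\<alpha> * X + \<beta> * Y) * (\<Sum>i\<le>m. g' i * X ^ i * Y ^ (m - i))"
      using binary_form_linear_factor[where n = m and g = g] by blast
    define p where "p = (\<lambda>x. M I f x * (\<Sum>i\<le>m. g' i * AX x ^ i * BX x ^ (m - i)))"
    have "p = res (\<lambda>x. mon I f x * (\<Sum>i\<le>m. g' i * A x ^ i * B x ^ (m - i)))"
      by (auto simp: p_def M_def res_def)
    moreover have "(\<lambda>x. mon I f x * (\<Sum>i\<le>m. g' i * A x ^ i * B x ^ (m - i))) \<in> R"
      by (intro subalgebra_gen_intros mon_poly subset_refl ABP_poly)
    ultimately have p: "p \<in> KX" by (simp add: res_in_KX)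
    let ?l = "\<lambda>x. \<alpha> * AX x + \<beta> * BX x"
    have l: "?l \<in> KX"
      using add_closed[OF scale_closed[OF ABPX(1)] scale_closed[OF ABPX(2)], of \<alpha> \<beta>] by (simp add: plus_fun_def)
    have "h = ?l * p" unfolding hf Suc lf(2) p_def by (auto simp: fun_eq_iff fun_apply)
    then have "D ?l = 0" using ker_factor[OF l p] h(2,3) by simp
    then show ?thesis using forms lf(1) by blast
  qed
qed

lemma hom_iter:
  assumes "\<And>j f. homogeneous \<omega> j f \<Longrightarrow> homogeneous \<omega> (j + \<delta>) (D f)" "homogeneous \<omega> j f"
  shows "homogeneous \<omega> (j + int n * \<delta>) ((D ^^ n) f)"
proof (induction n)
  case (Suc n)
  have eq: "j + int (Suc n) * \<delta> = j + int n * \<delta> + \<delta>" by (simp add: algebra_simps)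
  show ?case unfolding eq using assms(1)[OF Suc] by simp
qed (use assms(2) in simp)

text \<open>Choose \<open>t\<close>, \<open>y\<close>, \<open>q\<close> not killed. Their weight is
  0 on kernel elements homogeneous for all weights, which are monomials in killed coordinates, but
  it is \<open>d > 0\<close> on \<open>A\<close> and \<open>B\<close>. As \<open>D\<close> shifts
  this degree by a constant, the degree of a homogeneous element determines its last nonzero
  iterate.\<close>

lemma no_multihomogeneous_lnd:
  assumes D: "\<exists>i\<in>I. D (T i) \<noteq> 0" "D (T x0) = 0"
    and ge2: "\<And>i. i \<in> J0 - {x0} \<Longrightarrow> 2 \<le> \<mu> i" and odd: "q' \<in> J2" "odd (\<mu> q')"
    and hom: "\<And>\<omega>. \<omega> \<in> weights \<Longrightarrow> \<exists>\<delta>. \<forall>j f. homogeneous \<omega> j f \<longrightarrow> homogeneous \<omega> (j + \<delta>) (D f)"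
  shows False
proof -
  have forms: "D (\<lambda>x. \<alpha> * AX x + \<beta> * BX x) \<noteq> 0" if "\<alpha> \<noteq> 0 \<or> \<beta> \<noteq> 0" for \<alpha> \<beta>
    using rigid_if_linear_form[OF D(2) ge2 _ that] D(1) T_in_KX by blast
  obtain \<delta> where \<delta>: "\<And>\<omega> j f. \<omega> \<in> weights \<Longrightarrow> homogeneous \<omega> j f \<Longrightarrow> homogeneous \<omega> (j + \<delta> \<omega>) (D f)"
    using hom by metis
  have DA: "D AX \<noteq> 0" using forms[of 1 0] by simp
  have DB: "D BX \<noteq> 0" using forms[of 0 1] by simp
  have DP: "D PX \<noteq> 0"
  proof
    assume "D PX = 0"
    then have "deg PX = 0" by (simp add: deg_eq_0_iff ABPX)
    then have "deg AX = 0" using deg_AX_le by simp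
    then show False using DA by (simp add: deg_eq_0_iff ABPX)
  qed
  obtain t where t: "t \<in> J0" "D (T t) \<noteq> 0" using D_M_eq_0[OF blocks_subset(1)] DA by blast
  obtain y where y: "y \<in> J1" "D (T y) \<noteq> 0" using D_M_eq_0[OF blocks_subset(2)] DB by blast
  obtain q where q: "q \<in> J2" "D (T q) \<noteq> 0" using D_M_eq_0[OF blocks_subset(3)] DP by blast
  have tyq: "t \<in> I" "y \<in> I" "q \<in> I" "t \<noteq> x0" using t y q blocks_subset D(2) by auto
  define \<omega> where "\<omega> = weight t y q"
  have \<omega>: "\<omega> \<in> weights" "admissible \<omega>"
    using t y q by (force simp: \<omega>_def weights_def, simp add: \<omega>_def admissible_weight)
  define d where "d = wt J0 \<omega> \<mu>"
  have "0 < \<mu> t" "0 < \<mu> y" "0 < \<mu> q" using \<mu>_pos' tyq by auto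
  then have d: "0 < d" using admissible_weight(2)[OF t(1) y(1) q(1)] by (simp add: d_def \<omega>_def)
  have homA: "homogeneous \<omega>' (wt J0 \<omega>' \<mu>) AX" for \<omega>' by (rule hom_M[OF blocks_subset(1)])
  have homB: "homogeneous \<omega>' (wt J0 \<omega>' \<mu>) BX" if "\<omega>' \<in> weights" for \<omega>'
    using hom_M[OF blocks_subset(2), of \<omega>' \<mu>] weights_admissible[OF that] by (simp add: admissible_def)
  have ker0: "k = 0" if h: "h \<in> KX" "h \<noteq> 0" "D h = 0" "\<And>\<omega>'. \<omega>' \<in> weights \<Longrightarrow> homogeneous \<omega>' (\<kappa> \<omega>') h"
    and k: "homogeneous \<omega> k h" for h k \<kappa>
  proof -
    obtain c f where cf: "h = (\<lambda>x. c * M I f x)" "c \<noteq> 0" "\<And>i. i \<in> I \<Longrightarrow> f i \<noteq> 0 \<Longrightarrow> D (T i) = 0"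
      using homogeneous_kernel[OF forms h odd] by metis
    have "f t = 0" "f y = 0" "f q = 0" using cf(3) tyq t y q by blast+
    then have "wt I \<omega> f = 0" unfolding \<omega>_def by (simp add: wt_weight t y q finite_I)
    then have "homogeneous \<omega> 0 h" using hom_scale[OF hom_M[OF subset_refl, of \<omega> f], of c] cf(1) by simp
    then show ?thesis using hom_unique[OF \<omega>(2) k _ h(2)] by blast
  qed
  have top: "d + int (deg Z) * \<delta> \<omega> = 0"
    if Z: "Z \<in> KX" "Z \<noteq> 0" "\<And>\<omega>'. \<omega>' \<in> weights \<Longrightarrow> homogeneous \<omega>' (wt J0 \<omega>' \<mu>) Z" for Z
  proof (rule ker0)
    show "(D ^^ deg Z) Z \<in> KX" "(D ^^ deg Z) Z \<noteq> 0" "D ((D ^^ deg Z) Z) = 0"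
      using iter_closed iter_deg iter_Suc_deg Z by auto
    show "homogeneous \<omega>' (wt J0 \<omega>' \<mu> + int (deg Z) * \<delta> \<omega>') ((D ^^ deg Z) Z)" if "\<omega>' \<in> weights" for \<omega>'
      by (rule hom_iter[OF \<delta>[OF that] Z(3)[OF that]])
    show "homogeneous \<omega> (d + int (deg Z) * \<delta> \<omega>) ((D ^^ deg Z) Z)"
      unfolding d_def by (rule hom_iter[OF \<delta>[OF \<omega>(1)] Z(3)[OF \<omega>(1)]])
  qed
  define n where "n = deg AX"
  have nA: "d + int n * \<delta> \<omega> = 0" unfolding n_def by (rule top[OF ABPX(1,4) homA])
  have nB: "d + int (deg BX) * \<delta> \<omega> = 0" by (rule top[OF ABPX(2,5) homB])
  have \<delta>0: "\<delta> \<omega> \<noteq> 0" using nA d by auto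
  have degB: "deg BX = n"
  proof -
    have "int (deg BX) * \<delta> \<omega> = int n * \<delta> \<omega>" using nA nB by linarith
    then show ?thesis using \<delta>0 by simp
  qed
  define a where "a = (D ^^ n) AX"
  define b where "b = (D ^^ n) BX"
  have a: "a \<in> KX" "a \<noteq> 0" "D a = 0"
    unfolding a_def n_def using iter_closed iter_deg iter_Suc_deg ABPX by auto
  have b: "b \<in> KX" "b \<noteq> 0" "D b = 0"
    unfolding b_def degB[symmetric] using iter_closed iter_deg iter_Suc_deg ABPX by auto
  have homa: "homogeneous \<omega>' (wt J0 \<omega>' \<mu> + int n * \<delta> \<omega>') a" if "\<omega>' \<in> weights" for \<omega>'
    unfolding a_def by (rule hom_iter[OF \<delta>[OF that] homA])
  have homb: "homogeneous \<omega>' (wt J0 \<omega>' \<mu> + int n * \<delta> \<omega>') b" if "\<omega>' \<in> weights" for \<omega>'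
    unfolding b_def by (rule hom_iter[OF \<delta>[OF that] homB[OF that]])
  \<comment> \<open>\<open>D ^^ n\<close> kills this combination. Its weight equals that of
    \<open>A\<close>, however, so a nonzero \<open>h\<close> would need exactly \<open>n\<close>
    steps to reach the kernel.\<close>
  define h where "h = b * AX - a * BX"
  have h: "h \<in> KX" unfolding h_def by (intro diff_closed mult_closed a b ABPX)
  have homh: "homogeneous \<omega>' (wt J0 \<omega>' \<mu> + int n * \<delta> \<omega>' + wt J0 \<omega>' \<mu>) h" if "\<omega>' \<in> weights" for \<omega>'
    unfolding h_def using that by (intro hom_diff hom_mult homa homb homA homB)
  have "h = 0"
  proof (rule ccontr)
    assume "h \<noteq> 0"
    have "(D ^^ n) (b * AX + - a * BX) = (D ^^ n) (b * AX) + (D ^^ n) (- a * BX)"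
      by (intro iter_add mult_closed uminus_closed a b ABPX)
    also have "(D ^^ n) (b * AX) = b * a"
      unfolding a_def[symmetric] using iter_ker_mult[OF b(1) ABPX(1) b(3), of n] by (simp only: a_def)
    also have "(D ^^ n) (- a * BX) = - a * b"
      using iter_ker_mult[OF uminus_closed[OF a(1)] ABPX(2), of n] D_uminus[OF a(1)] a(3)
      by (simp only: b_def minus_zero)
    also have "b * a + - a * b = 0" by (simp add: mult.commute)
    also have "b * AX + - a * BX = h" unfolding h_def by (simp only: minus_mult_left[symmetric] diff_conv_add_uminus)
    finally have Dn: "(D ^^ n) h = 0" .
    have less: "deg h < n"
    proof (rule ccontr)
      assume "\<not> deg h < n"
      then have "(D ^^ deg h) h = 0" using iter_eq_0_mono[OF Dn] by simp
      then show False using iter_deg[OF h \<open>h \<noteq> 0\<close>] by simp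
    qed
    have "(d + int n * \<delta> \<omega> + d) + int (deg h) * \<delta> \<omega> = 0"
    proof (rule ker0)
      show "(D ^^ deg h) h \<in> KX" "(D ^^ deg h) h \<noteq> 0" "D ((D ^^ deg h) h) = 0"
        using iter_closed iter_deg iter_Suc_deg h \<open>h \<noteq> 0\<close> by auto
      show "homogeneous \<omega>' ((wt J0 \<omega>' \<mu> + int n * \<delta> \<omega>' + wt J0 \<omega>' \<mu>) + int (deg h) * \<delta> \<omega>') ((D ^^ deg h) h)"
        if "\<omega>' \<in> weights" for \<omega>'
        by (rule hom_iter[OF \<delta>[OF that] homh[OF that]])
      show "homogeneous \<omega> ((d + int n * \<delta> \<omega> + d) + int (deg h) * \<delta> \<omega>) ((D ^^ deg h) h)"
        unfolding d_def by (rule hom_iter[OF \<delta>[OF \<omega>(1)] homh[OF \<omega>(1)]])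
    qed
    then have "int (deg h) * \<delta> \<omega> = int n * \<delta> \<omega>" using nA by linarith
    then show False using \<delta>0 less by simp
  qed
  then have eq: "b * AX = a * BX" by (simp add: h_def)
  obtain c f where cf: "a = (\<lambda>x. c * M I f x)" "c \<noteq> 0" "\<And>i. i \<in> I \<Longrightarrow> f i \<noteq> 0 \<Longrightarrow> D (T i) = 0"
    using homogeneous_kernel[OF forms a homa odd] by metis
  have ft: "f t = 0" using cf(3) tyq t by blast
  obtain p where p: "p \<in> X" "A p = 0" "B p = 1" "P p = - 1" "p x0 = 0" "p y0 = 1" "p q ^ \<mu> q = - 1"
    "\<forall>i\<in>I - {x0, y0, q}. p i = 1"
    using point_exists[of 0 1 "- 1" q] q by auto
  \<comment> \<open>\<open>A\<close> has to vanish through the coordinate \<open>t\<close>, which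
    does not occur in \<open>a\<close>; the killed coordinate \<open>x0\<close> may occur in
    \<open>a\<close>, so it is moved away from 0.\<close>
  define r where "r = p(x0 := 1, t := 0)"
  have notin: "x0 \<notin> J1" "x0 \<notin> J2" "t \<notin> J1" "t \<notin> J2" using t x0 disjoint by auto
  have A: "A r = 0" using t \<mu>_pos'[OF tyq(1)] by (intro mon_eq_0[of _ t]) (auto simp: finite_blocks r_def)
  have "B r = 1" "P r = - 1" using p notin by (simp_all add: r_def mon_upd)
  moreover have "r \<in> affine_space I"
    using p(1) tyq blocks_subset by (auto simp: X_F affine_space_def r_def)
  ultimately have r: "r \<in> X" "B r = 1" using A by (auto simp: X_F F_def)
  have "p q \<noteq> 0" using p(7) \<open>0 < \<mu> q\<close> by (auto simp: zero_power)
  then have nz: "r i \<noteq> 0" if "i \<in> I" "i \<noteq> t" for i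
    using that p(6,8) by (cases "i = x0 \<or> i = y0 \<or> i = q") (auto simp: r_def)
  have "mon I f r = mon (I - {t}) f r" using mon_remove[OF finite_I tyq(1), of f r] ft by simp
  also have "\<dots> \<noteq> 0" using nz by (intro mon_nonzero) auto
  finally have "a r \<noteq> 0" using cf(1,2) r by (simp add: M_def res_apply)
  moreover have "(b * AX) r = (a * BX) r" by (simp only: eq)
  then have "a r = 0" using A r by (simp add: fun_apply M_def res_apply)
  ultimately show False by simp
qed

end

section \<open>Coordinates killed by every locally nilpotent derivation\<close>

context trinomial
begin

text \<open>Each passage to a lowest part keeps the homogeneity achieved for earlier weights and
  still kills \<open>x0\<close>.\<close>

lemma homogenize_all:
  assumes "finite W" "\<And>\<omega>. \<omega> \<in> W \<Longrightarrow> admissible \<omega>"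
    and "locally_nilpotent_derivation KX D" "\<exists>i\<in>I. D (T i) \<noteq> 0" "D (T x0) = 0"
  shows "\<exists>D. locally_nilpotent_derivation KX D \<and> (\<exists>i\<in>I. D (T i) \<noteq> 0) \<and> D (T x0) = 0 \<and>
    (\<forall>\<omega>\<in>W. \<exists>\<delta>. \<forall>j f. homogeneous \<omega> j f \<longrightarrow> homogeneous \<omega> (j + \<delta>) (D f))"
  using assms(1,2)
proof (induction W)
  case empty
  then show ?case using assms(3-5) by blast
next
  case (insert \<omega> W)
  have "\<exists>D. locally_nilpotent_derivation KX D \<and> (\<exists>i\<in>I. D (T i) \<noteq> 0) \<and> D (T x0) = 0 \<and>
    (\<forall>\<omega>\<in>W. \<exists>\<delta>. \<forall>j f. homogeneous \<omega> j f \<longrightarrow> homogeneous \<omega> (j + \<delta>) (D f))"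
    by (rule insert.IH) (simp add: insert.prems)
  then obtain E where E: "locally_nilpotent_derivation KX E" "\<exists>i\<in>I. E (T i) \<noteq> 0" "E (T x0) = 0"
    "\<forall>\<omega>\<in>W. \<exists>\<delta>. \<forall>j f. homogeneous \<omega> j f \<longrightarrow> homogeneous \<omega> (j + \<delta>) (E f)"
    by (elim exE conjE)
  obtain i0 where i0: "i0 \<in> I" "E (T i0) \<noteq> 0" using E(2) by blast
  interpret E: trinomial_lnd J0 J1 J2 \<mu> x0 y0 X I E
    by unfold_locales (rule E(1))
  have adm: "admissible \<omega>" using insert.prems by simp
  obtain E' l where E': "locally_nilpotent_derivation KX E'" "\<exists>i\<in>I. E' (T i) \<noteq> 0"
    "\<forall>j f. homogeneous \<omega> j f \<longrightarrow> homogeneous \<omega> (j + l) (E' f)"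
    "\<forall>\<omega>' \<delta>. (\<forall>j f. homogeneous \<omega>' j f \<longrightarrow> homogeneous \<omega>' (j + \<delta>) (E f)) \<longrightarrow>
      (\<forall>j f. homogeneous \<omega>' j f \<longrightarrow> homogeneous \<omega>' (j + \<delta>) (E' f))"
    "\<forall>i\<in>I. E (T i) = 0 \<longrightarrow> E' (T i) = 0"
    "\<forall>i\<in>I. \<forall>k. component \<omega> (\<omega> i + k) (E (T i)) \<noteq> 0 \<longrightarrow> l \<le> k"
    using E.homogenize[OF adm i0] by (elim exE conjE)
  have "\<exists>\<delta>. \<forall>j f. homogeneous \<omega>' j f \<longrightarrow> homogeneous \<omega>' (j + \<delta>) (E' f)" if \<omega>': "\<omega>' \<in> insert \<omega> W" for \<omega>'
  proof (cases "\<omega>' = \<omega>")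
    case True
    show ?thesis unfolding True using E'(3) by (rule exI[of _ l])
  next
    case False
    then have "\<omega>' \<in> W" using \<omega>' by simp
    then obtain \<delta> where \<delta>: "\<forall>j f. homogeneous \<omega>' j f \<longrightarrow> homogeneous \<omega>' (j + \<delta>) (E f)"
      using E(4) by fast
    with E'(4) have "\<forall>j f. homogeneous \<omega>' j f \<longrightarrow> homogeneous \<omega>' (j + \<delta>) (E' f)" by metis
    then show ?thesis by (rule exI[of _ \<delta>])
  qed
  then show ?case using E'(1,2) E'(5)[rule_format, OF blocks_subset(4) E(3)] by (intro exI[of _ E'] conjI ballI)
qed

text \<open>In the grading \<open>deg T\<^sub>t = 1\<close>, \<open>deg T\<^sub>x\<^sub>0 = - \<mu> t\<close> all elements of positive degree are divisible by
  \<open>T\<^sub>t\<close> and all elements of negative degree by \<open>T\<^sub>x\<^sub>0\<close>. Hence a derivation that does not kill \<open>T\<^sub>t\<close> has a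
  component of negative degree, and the lowest component kills \<open>T\<^sub>x\<^sub>0\<close>.\<close>

theorem lnd_kills_coordinate:
  assumes lnd: "locally_nilpotent_derivation KX D"
    and ge2: "\<And>i. i \<in> J0 - {x0} \<Longrightarrow> 2 \<le> \<mu> i"
    and J2: "(\<forall>i\<in>J2. 4 \<le> \<mu> i) \<or> (\<exists>i\<in>J2. odd (\<mu> i))"
    and t: "t \<in> J0 - {x0}"
  shows "D (T t) = 0"
proof (rule ccontr)
  assume Dt: "D (T t) \<noteq> 0"
  interpret trinomial_lnd J0 J1 J2 \<mu> x0 y0 X I D
    by unfold_locales (rule lnd)
  have tI: "t \<in> I" "t \<noteq> x0" using t blocks_subset by auto
  define \<omega> where "\<omega> = (\<lambda>i. (if i = t then 1 else 0) + (if i = x0 then - int (\<mu> t) else 0))"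
  have wt\<omega>: "wt S \<omega> e = (if t \<in> S then int (e t) else 0) + (if x0 \<in> S then - int (e x0) * int (\<mu> t) else 0)"
    if "finite S" for S e
    unfolding \<omega>_def by (simp add: wt_sum wt_single[OF that])
  have adm: "admissible \<omega>"
    unfolding admissible_def using t x0 disjoint by (auto simp: wt\<omega> finite_blocks)
  have \<omega>t: "\<omega> t = 1" "\<omega> x0 = - int (\<mu> t)" using tI by (simp_all add: \<omega>_def)
  have "\<exists>k\<le>0. component \<omega> k (D (T t)) \<noteq> 0"
  proof (rule ccontr)
    assume neg: "\<not> ?thesis"
    have DT: "D (T t) \<in> KX" by (intro D_closed T_in_KX tI)
    have "\<exists>g\<in>KX. component \<omega> k (D (T t)) = T t * g" for k
    proof (cases "k \<le> 0")
      case True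
      then have "component \<omega> k (D (T t)) = T t * 0" using neg by simp
      then show ?thesis using zero_closed by blast
    next
      case False
      show ?thesis
      proof (rule hom_dvd_coordinate[OF tI(1) _ hom_comp[OF adm DT]])
        fix e assume "wt I \<omega> e = k"
        then have "int (e t) - int (e x0) * int (\<mu> t) = k"
          using tI(1) blocks_subset(4) by (simp add: wt\<omega> finite_I)
        moreover have "0 \<le> int (e x0) * int (\<mu> t)" by simp
        ultimately show "1 \<le> e t" using False by linarith
      qed
    qed
    then obtain g where g: "\<And>k. g k \<in> KX" "\<And>k. component \<omega> k (D (T t)) = T t * g k" by metis
    have "D (T t) = (\<Sum>k\<in>{k. component \<omega> k (D (T t)) \<noteq> 0}. component \<omega> k (D (T t)))"
      by (rule sum_supp[OF adm DT finite_supp[OF adm DT] subset_refl, symmetric])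
    also have "\<dots> = T t * (\<Sum>k\<in>{k. component \<omega> k (D (T t)) \<noteq> 0}. g k)"
      unfolding g(2) sum_distrib_left ..
    finally have "D (T t) = 0"
      by (rule ker_if_dvd_D[OF T_in_KX[OF tI(1)] sum_closed[OF g(1)]])
    then show False using Dt by simp
  qed
  \<comment> \<open>Since \<open>\<omega> t = 1\<close>, a component of degree
    \<open>k \<le> 0\<close> in \<open>D (T t)\<close> comes from a part of \<open>D\<close> of
    degree \<open>k - 1 < 0\<close>.\<close>
  then obtain k where k: "k \<le> 0" "component \<omega> (\<omega> t + (k - 1)) (D (T t)) \<noteq> 0" by (auto simp: \<omega>t)
  obtain E l where E: "locally_nilpotent_derivation KX E" "\<exists>i\<in>I. E (T i) \<noteq> 0"
    "\<forall>j f. homogeneous \<omega> j f \<longrightarrow> homogeneous \<omega> (j + l) (E f)"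
    "\<forall>\<omega>' \<delta>. (\<forall>j f. homogeneous \<omega>' j f \<longrightarrow> homogeneous \<omega>' (j + \<delta>) (D f)) \<longrightarrow>
      (\<forall>j f. homogeneous \<omega>' j f \<longrightarrow> homogeneous \<omega>' (j + \<delta>) (E f))"
    "\<forall>i\<in>I. D (T i) = 0 \<longrightarrow> E (T i) = 0"
    "\<forall>i\<in>I. \<forall>k. component \<omega> (\<omega> i + k) (D (T i)) \<noteq> 0 \<longrightarrow> l \<le> k"
    using homogenize[OF adm tI(1) Dt] by (elim exE conjE)
  have l: "l < 0" using E(6)[rule_format, OF tI(1) k(2)] k(1) by simp
  interpret E: trinomial_lnd J0 J1 J2 \<mu> x0 y0 X I E
    by unfold_locales (rule E(1))
  have "\<exists>g\<in>KX. E (T x0) = T x0 * g"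
  proof (rule hom_dvd_coordinate[OF blocks_subset(4)])
    show "homogeneous \<omega> (\<omega> x0 + l) (E (T x0))" by (intro E(3)[rule_format] hom_T blocks_subset)
    fix e assume "wt I \<omega> e = \<omega> x0 + l"
    then have "int (e t) - int (e x0) * int (\<mu> t) < 0"
      using tI(1) blocks_subset(4) l by (simp add: wt\<omega> finite_I \<omega>t)
    then show "1 \<le> e x0" by (cases "e x0") auto
  qed
  then have Ex0: "E (T x0) = 0" using E.ker_if_dvd_D[OF T_in_KX[OF blocks_subset(4)]] by blast
  show False
  proof (cases "\<exists>i\<in>J2. odd (\<mu> i)")
    case True
    then obtain q' where q': "q' \<in> J2" "odd (\<mu> q')" by blast
    have "\<exists>D. locally_nilpotent_derivation KX D \<and> (\<exists>i\<in>I. D (T i) \<noteq> 0) \<and> D (T x0) = 0 \<and>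
      (\<forall>\<omega>\<in>weights. \<exists>\<delta>. \<forall>j f. homogeneous \<omega> j f \<longrightarrow> homogeneous \<omega> (j + \<delta>) (D f))"
      by (rule homogenize_all[OF finite_weights weights_admissible E(1,2) Ex0])
    then obtain E' where E': "locally_nilpotent_derivation KX E'" "\<exists>i\<in>I. E' (T i) \<noteq> 0" "E' (T x0) = 0"
      "\<forall>\<omega>\<in>weights. \<exists>\<delta>. \<forall>j f. homogeneous \<omega> j f \<longrightarrow> homogeneous \<omega> (j + \<delta>) (E' f)"
      by (elim exE conjE)
    interpret E': trinomial_lnd J0 J1 J2 \<mu> x0 y0 X I E'
      by unfold_locales (rule E'(1))
    show False by (rule E'.no_multihomogeneous_lnd[OF E'(2,3) ge2 q' bspec[OF E'(4)]])
  next
    case False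
    then have "\<And>i. i \<in> J2 \<Longrightarrow> 4 \<le> \<mu> i" using J2 by blast
    then show False using E.rigid_if_ge4[OF Ex0 ge2] E(2) T_in_KX by blast
  qed
qed

end

section \<open>Additive group actions and the special automorphism group\<close>

locale affine_set =
  fixes I :: "'i set" and X :: "('i \<Rightarrow> 'k::field_char_0) set"
  assumes X_affine: "X \<subseteq> affine_space I"
begin

abbreviation "\<G> \<equiv> Aut_group I X"

lemma point_ext: "x \<in> X \<Longrightarrow> y \<in> X \<Longrightarrow> (\<And>i. i \<in> I \<Longrightarrow> x i = y i) \<Longrightarrow> x = y"
  using X_affine by (auto simp: affine_space_def intro!: PiE_ext[of _ I "\<lambda>_. UNIV"])

lemma automorphisms_Bij: "\<alpha> \<in> automorphisms I X \<Longrightarrow> \<alpha> \<in> Bij X"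
  by (simp add: automorphisms_def)

lemma Bij_mem: "\<alpha> \<in> Bij X \<Longrightarrow> x \<in> X \<Longrightarrow> \<alpha> x \<in> X"
  using Bij_imp_funcset by blast

lemma BijI:
  assumes "\<And>x. x \<in> X \<Longrightarrow> f x \<in> X" "\<And>x. x \<in> X \<Longrightarrow> g x \<in> X"
    "\<And>x. x \<in> X \<Longrightarrow> g (f x) = x" "\<And>x. x \<in> X \<Longrightarrow> f (g x) = x"
  shows "restrict f X \<in> Bij X"
proof -
  have "bij_betw (restrict f X) X X"
    by (rule bij_betw_byWitness[where f' = g]) (use assms in auto)
  then show ?thesis by (simp add: Bij_def)
qed

lemma inv_into_Bij:
  assumes "\<alpha> \<in> Bij X" "y \<in> X" "\<alpha> y = x"
  shows "inv_into X \<alpha> x = y"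
  using assms inv_into_f_f[of \<alpha> X y] by (auto simp: Bij_def bij_betw_def)

lemma Bij_inv_left: "\<alpha> \<in> Bij X \<Longrightarrow> x \<in> X \<Longrightarrow> inv_into X \<alpha> (\<alpha> x) = x"
  by (rule inv_into_Bij) simp_all

lemma Bij_inv_right: "\<alpha> \<in> Bij X \<Longrightarrow> x \<in> X \<Longrightarrow> \<alpha> (inv_into X \<alpha> x) = x"
  by (auto simp: Bij_def bij_betw_def f_inv_into_f)

lemma polynomial_map_cong:
  "polynomial_map_on S C I \<alpha> \<Longrightarrow> (\<And>x. x \<in> S \<Longrightarrow> \<beta> x = \<alpha> x) \<Longrightarrow> polynomial_map_on S C I \<beta>"
  unfolding polynomial_map_on_def by metis

lemma polynomial_map_pullback:
  assumes "polynomial_map_on S C I \<alpha>" "f \<in> subalgebra_gen (coordinates I)"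
  shows "\<exists>g\<in>subalgebra_gen C. \<forall>x\<in>S. f (\<alpha> x) = g x"
proof -
  obtain p where p: "\<And>i. i \<in> I \<Longrightarrow> p i \<in> subalgebra_gen C" "\<And>i x. i \<in> I \<Longrightarrow> x \<in> S \<Longrightarrow> \<alpha> x i = p i x"
    using assms(1) unfolding polynomial_map_on_def by metis
  have "(\<lambda>x. f (\<lambda>i. p i x)) \<in> subalgebra_gen C"
    using p(1) by (intro subalgebra_gen_subst[OF assms(2)]) auto
  moreover have "f (\<alpha> x) = f (\<lambda>i. p i x)" if "x \<in> S" for x
    by (rule subalgebra_gen_cong_point[OF assms(2)]) (simp add: p that)
  ultimately show ?thesis by (intro bexI[of _ "\<lambda>x. f (\<lambda>i. p i x)"] ballI)
qed

lemma polynomial_map_comp: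
  assumes "polynomial_map_on X (coordinates I) I \<alpha>" "polynomial_map_on X (coordinates I) I \<beta>"
    and "\<And>x. x \<in> X \<Longrightarrow> \<beta> x \<in> X"
  shows "polynomial_map_on X (coordinates I) I (\<lambda>x. \<alpha> (\<beta> x))"
  unfolding polynomial_map_on_def
proof
  fix i assume "i \<in> I"
  then obtain p where p: "p \<in> subalgebra_gen (coordinates I)" "\<And>x. x \<in> X \<Longrightarrow> \<alpha> x i = p x"
    using assms(1) by (auto simp: polynomial_map_on_def)
  then show "\<exists>p\<in>subalgebra_gen (coordinates I). \<forall>x\<in>X. \<alpha> (\<beta> x) i = p x"
    using polynomial_map_pullback[OF assms(2) p(1)] assms(3) by simp
qed

lemma polynomial_map_id: "polynomial_map_on S (coordinates I) I (\<lambda>x. x)"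
  unfolding polynomial_map_on_def
proof
  fix i assume "i \<in> I"
  then show "\<exists>p\<in>subalgebra_gen (coordinates I). \<forall>x\<in>S. x i = p x"
    by (intro bexI[OF _ subalgebra_gen_coordinate]) simp_all
qed

lemma automorphismsI:
  assumes "\<And>x. x \<in> X \<Longrightarrow> f x \<in> X" "\<And>x. x \<in> X \<Longrightarrow> g x \<in> X"
    "\<And>x. x \<in> X \<Longrightarrow> g (f x) = x" "\<And>x. x \<in> X \<Longrightarrow> f (g x) = x"
    "polynomial_map_on X (coordinates I) I f" "polynomial_map_on X (coordinates I) I g"
  shows "restrict f X \<in> automorphisms I X"
proof -
  have B: "restrict f X \<in> Bij X" using assms(1-4) by (rule BijI)
  have "inv_into X (restrict f X) x = g x" if "x \<in> X" for x
    by (rule inv_into_Bij[OF B]) (use assms that in auto)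
  then show ?thesis
    unfolding automorphisms_def
    using B polynomial_map_cong[OF assms(5), of "restrict f X"] polynomial_map_cong[OF assms(6)] by simp
qed

lemma subgroup_automorphisms: "subgroup (automorphisms I X) (BijGroup X)"
proof (rule subgroup.intro)
  show "automorphisms I X \<subseteq> carrier (BijGroup X)"
    by (auto simp: automorphisms_def BijGroup_def)
  show "\<one>\<^bsub>BijGroup X\<^esub> \<in> automorphisms I X"
    by (simp add: BijGroup_def)
       (rule automorphismsI[where g = "\<lambda>x. x"]; simp add: polynomial_map_id)
  show "\<alpha> \<otimes>\<^bsub>BijGroup X\<^esub> \<beta> \<in> automorphisms I X" if "\<alpha> \<in> automorphisms I X" "\<beta> \<in> automorphisms I X" for \<alpha> \<beta>
  proof -
    have B: "\<alpha> \<in> Bij X" "\<beta> \<in> Bij X" using that by (auto simp: automorphisms_def)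
    have "restrict (\<lambda>x. \<alpha> (\<beta> x)) X \<in> automorphisms I X"
    proof (rule automorphismsI[where g = "\<lambda>x. inv_into X \<beta> (inv_into X \<alpha> x)"])
      have pm: "polynomial_map_on X (coordinates I) I \<alpha>" "polynomial_map_on X (coordinates I) I \<beta>"
        "polynomial_map_on X (coordinates I) I (inv_into X \<alpha>)" "polynomial_map_on X (coordinates I) I (inv_into X \<beta>)"
        using that by (auto simp: automorphisms_def)
      show "polynomial_map_on X (coordinates I) I (\<lambda>x. \<alpha> (\<beta> x))"
        by (rule polynomial_map_comp[OF pm(1,2) Bij_mem[OF B(2)]])
      show "polynomial_map_on X (coordinates I) I (\<lambda>x. inv_into X \<beta> (inv_into X \<alpha> x))"
        by (rule polynomial_map_comp[OF pm(4,3) Bij_inv_into_mem[OF B(1)]])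
    qed (simp_all add: B Bij_mem Bij_inv_into_mem Bij_inv_left Bij_inv_right)
    moreover have "\<alpha> \<otimes>\<^bsub>BijGroup X\<^esub> \<beta> = restrict (\<lambda>x. \<alpha> (\<beta> x)) X"
      using B by (simp add: BijGroup_def compose_def)
    ultimately show ?thesis by simp
  qed
  show "inv\<^bsub>BijGroup X\<^esub> \<alpha> \<in> automorphisms I X" if "\<alpha> \<in> automorphisms I X" for \<alpha>
  proof -
    have B: "\<alpha> \<in> Bij X" using that by (auto simp: automorphisms_def)
    have "restrict (inv_into X \<alpha>) X \<in> automorphisms I X"
    proof (rule automorphismsI[where g = \<alpha>])
      show "polynomial_map_on X (coordinates I) I (inv_into X \<alpha>)" "polynomial_map_on X (coordinates I) I \<alpha>"
        using that by (auto simp: automorphisms_def)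
    qed (simp_all add: B Bij_mem Bij_inv_into_mem Bij_inv_left Bij_inv_right)
    then show ?thesis using B by (simp add: inv_BijGroup)
  qed
qed

lemma group_Aut: "group \<G>"
  unfolding Aut_group_def by (rule subgroup.subgroup_is_group[OF subgroup_automorphisms group_BijGroup])

lemma Aut_simps:
  "carrier \<G> = automorphisms I X"
  "\<alpha> \<in> automorphisms I X \<Longrightarrow> \<beta> \<in> automorphisms I X \<Longrightarrow> \<alpha> \<otimes>\<^bsub>\<G>\<^esub> \<beta> = restrict (\<lambda>x. \<alpha> (\<beta> x)) X"
  "\<one>\<^bsub>\<G>\<^esub> = restrict (\<lambda>x. x) X"
  using automorphisms_Bij by (auto simp: Aut_group_def BijGroup_def compose_def)

lemma subgroup_SAut: "subgroup (SAut I X) \<G>"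
  unfolding SAut_def
  by (rule group.generate_is_subgroup[OF group_Aut]) (auto simp: Ga_subgroup_def dest: subgroup.subset[THEN subsetD])

lemma SAut_automorphisms: "\<alpha> \<in> SAut I X \<Longrightarrow> \<alpha> \<in> automorphisms I X"
  using subgroup.subset[OF subgroup_SAut] by (auto simp: Aut_simps)

lemma SAut_mem: "\<alpha> \<in> SAut I X \<Longrightarrow> x \<in> X \<Longrightarrow> \<alpha> x \<in> X"
  by (rule Bij_mem[OF automorphisms_Bij[OF SAut_automorphisms]])

definition linked :: "('i \<Rightarrow> 'k) \<Rightarrow> ('i \<Rightarrow> 'k) \<Rightarrow> bool" where
  "linked P Q \<longleftrightarrow> P \<in> X \<and> (\<exists>\<alpha>\<in>SAut I X. \<alpha> P = Q)"

lemma linked_X: "linked P Q \<Longrightarrow> P \<in> X \<and> Q \<in> X"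
  by (auto simp: linked_def SAut_mem)

lemma linked_refl: "P \<in> X \<Longrightarrow> linked P P"
  unfolding linked_def using subgroup.one_closed[OF subgroup_SAut]
  by (intro conjI bexI[of _ "\<one>\<^bsub>\<G>\<^esub>"]) (simp_all add: Aut_simps(3))

lemma linked_trans: "linked P Q \<Longrightarrow> linked Q S \<Longrightarrow> linked P S"
proof -
  assume "linked P Q" "linked Q S"
  then obtain \<alpha> \<beta> where \<alpha>: "P \<in> X" "\<alpha> \<in> SAut I X" "\<alpha> P = Q" "\<beta> \<in> SAut I X" "\<beta> Q = S"
    by (auto simp: linked_def)
  have "\<beta> \<otimes>\<^bsub>\<G>\<^esub> \<alpha> \<in> SAut I X"
    by (rule subgroup.m_closed[OF subgroup_SAut \<alpha>(4,2)])
  moreover have "(\<beta> \<otimes>\<^bsub>\<G>\<^esub> \<alpha>) P = S"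
    using \<alpha> by (simp add: Aut_simps(2) SAut_automorphisms)
  ultimately show ?thesis using \<alpha>(1) by (auto simp: linked_def)
qed

lemma linked_sym: "linked P Q \<Longrightarrow> linked Q P"
proof -
  assume "linked P Q"
  then obtain \<alpha> where \<alpha>: "P \<in> X" "\<alpha> \<in> SAut I X" "\<alpha> P = Q" "Q \<in> X"
    by (auto simp: linked_def SAut_mem)
  let ?\<beta> = "inv\<^bsub>\<G>\<^esub> \<alpha>"
  have \<beta>: "?\<beta> \<in> SAut I X" using subgroup.m_inv_closed[OF subgroup_SAut \<alpha>(2)] .
  have "?\<beta> \<otimes>\<^bsub>\<G>\<^esub> \<alpha> = \<one>\<^bsub>\<G>\<^esub>"
    using group.l_inv[OF group_Aut] SAut_automorphisms[OF \<alpha>(2)] by (simp add: Aut_simps(1))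
  then have "(\<lambda>x\<in>X. ?\<beta> (\<alpha> x)) P = (\<lambda>x\<in>X. x) P"
    using Aut_simps(2)[OF SAut_automorphisms[OF \<beta>] SAut_automorphisms[OF \<alpha>(2)]]
    by (simp add: Aut_simps(3))
  then have "?\<beta> Q = P" using \<alpha> by simp
  then show ?thesis using \<beta> \<alpha>(4) by (auto simp: linked_def)
qed

lemma linked_orbit: "linked P Q \<Longrightarrow> SAut_orbit I X P = SAut_orbit I X Q"
proof -
  have orb: "S \<in> SAut_orbit I X P \<longleftrightarrow> linked P S" if "P \<in> X" for P S
    using that by (auto simp: SAut_orbit_def orbit_def linked_def)
  assume "linked P Q"
  then show ?thesis
    using linked_trans linked_sym linked_X orb by (metis subsetI subset_antisym)
qed

subsection \<open>Invariant functions\<close>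

text \<open>The degree bound uniform in \<open>x\<close> later yields one nilpotency order for all
  points.\<close>

lemma subalgebra_gen_product_line:
  fixes p :: "'k \<times> ('i \<Rightarrow> 'k) \<Rightarrow> 'k"
  assumes "p \<in> subalgebra_gen (insert fst ((\<lambda>f. f \<circ> snd) ` coordinates I))"
  shows "\<exists>q n. (\<forall>s x. p (s, x) = poly (q x) s) \<and> (\<forall>x. degree (q x) \<le> n) \<and>
    (\<forall>k. (\<lambda>x. coeff (q x) k) \<in> subalgebra_gen (coordinates I))"
  using assms
proof induction
  case (const c)
  have "(\<lambda>x. coeff [:c:] k) \<in> subalgebra_gen (coordinates I)" for k by (rule subalgebra_gen.const)
  then show ?case by (intro exI[of _ "\<lambda>_. [:c:]"] exI[of _ 0]) auto
next
  case (gen p)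
  then consider "p = fst" | i where "i \<in> I" "p = (\<lambda>x. x i) \<circ> snd" by (auto simp: coordinates_def)
  then show ?case
  proof cases
    case 1
    have "(\<lambda>x. coeff [:0, 1:] k) \<in> subalgebra_gen (coordinates I)" for k by (rule subalgebra_gen.const)
    then show ?thesis using 1 by (intro exI[of _ "\<lambda>_. [:0, 1:]"] exI[of _ 1]) auto
  next
    case 2
    have "(\<lambda>x. coeff [:x i:] k) \<in> subalgebra_gen (coordinates I)" for k
      using subalgebra_gen_coordinate[OF 2(1)] subalgebra_gen.const[of 0]
      by (cases k) (auto simp: coeff_pCons)
    then show ?thesis using 2 by (intro exI[of _ "\<lambda>x. [:x i:]"] exI[of _ 0]) auto
  qed
next
  case (add p p')
  then obtain q n q' n' where
    "\<And>s x. p (s, x) = poly (q x) s" "\<And>x. degree (q x) \<le> n" "\<And>k. (\<lambda>x. coeff (q x) k) \<in> subalgebra_gen (coordinates I)"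
    "\<And>s x. p' (s, x) = poly (q' x) s" "\<And>x. degree (q' x) \<le> n'" "\<And>k. (\<lambda>x. coeff (q' x) k) \<in> subalgebra_gen (coordinates I)"
    by metis
  moreover from this have "degree (q x + q' x) \<le> max n n'" for x
    by (metis degree_add_le_max max.mono order.trans)
  ultimately show ?case
    by (intro exI[of _ "\<lambda>x. q x + q' x"] exI[of _ "max n n'"]) (auto intro!: subalgebra_gen.add)
next
  case (mult p p')
  then obtain q n q' n' where *:
    "\<And>s x. p (s, x) = poly (q x) s" "\<And>x. degree (q x) \<le> n" "\<And>k. (\<lambda>x. coeff (q x) k) \<in> subalgebra_gen (coordinates I)"
    "\<And>s x. p' (s, x) = poly (q' x) s" "\<And>x. degree (q' x) \<le> n'" "\<And>k. (\<lambda>x. coeff (q' x) k) \<in> subalgebra_gen (coordinates I)"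
    by metis
  have "degree (q x * q' x) \<le> n + n'" for x
    by (rule order.trans[OF degree_mult_le add_mono[OF *(2) *(5)]])
  then show ?case
    using * by (intro exI[of _ "\<lambda>x. q x * q' x"] exI[of _ "n + n'"])
       (auto intro!: subalgebra_gen_sum subalgebra_gen.mult simp: coeff_mult)
qed

lemma poly_sum_le:
  fixes p :: "'k poly"
  shows "degree p \<le> n \<Longrightarrow> poly p s = (\<Sum>k\<le>n. coeff p k * s ^ k)"
  unfolding poly_altdef by (rule sum.mono_neutral_left) (auto simp: coeff_eq_0)

lemma pderiv_iter_eq_0: "degree p < n \<Longrightarrow> (pderiv ^^ n) p = (0::'k poly)"
proof (induction n arbitrary: p)
  case (Suc n)
  show ?case
  proof (cases n)
    case 0
    then show ?thesis using Suc.prems by (simp add: pderiv_eq_0_iff)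
  next
    case (Suc m)
    then have "degree (pderiv p) < n" using Suc.prems by (simp add: degree_pderiv)
    then show ?thesis using Suc.IH by (simp add: funpow_swap1)
  qed
qed simp

text \<open>The derivative at \<open>s = 0\<close> along the flow is an LND: its powers correspond
  to iterated differentiation of polynomials in \<open>s\<close> of bounded degree. It kills
  \<open>f\<close>, so the polynomial of \<open>f\<close> along each orbit is constant.\<close>

lemma polynomial_flow_invariant:
  assumes mem: "\<And>s x. x \<in> X \<Longrightarrow> \<phi> s x \<in> X" and zero: "\<And>x. x \<in> X \<Longrightarrow> \<phi> 0 x = x"
    and add: "\<And>s r x. x \<in> X \<Longrightarrow> \<phi> (s + r) x = \<phi> s (\<phi> r x)"
    and poly: "polynomial_map_on (UNIV \<times> X) (insert fst ((\<lambda>f. f \<circ> snd) ` coordinates I)) I (\<lambda>(s, x). \<phi> s x)"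
    and f: "f \<in> makar_limanov I X" and x: "x \<in> X"
  shows "f (\<phi> s x) = f x"
proof -
  let ?K = "coordinate_subring X I"
  define N where "N h x = (SOME p. \<forall>s. h (\<phi> s x) = poly p s)" for h x
  define D where "D h = (\<lambda>x. if x \<in> X then coeff (N h x) 1 else 0)" for h
  have curve: "\<exists>q n. (\<forall>x\<in>X. \<forall>s. h (\<phi> s x) = poly (q x) s) \<and> (\<forall>x. degree (q x) \<le> n) \<and>
      (\<forall>k. (\<lambda>x. coeff (q x) k) \<in> subalgebra_gen (coordinates I))" if h: "h \<in> ?K" for h
  proof -
    obtain p where p: "p \<in> subalgebra_gen (coordinates I)" "h = (\<lambda>x. if x \<in> X then p x else 0)"
      using h by (auto simp: coordinate_subring_def)
    then have hp: "h x = p x" if "x \<in> X" for x using that by simp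
    obtain g where g: "g \<in> subalgebra_gen (insert fst ((\<lambda>f. f \<circ> snd) ` coordinates I))"
      "\<And>s x. x \<in> X \<Longrightarrow> p (\<phi> s x) = g (s, x)"
      using polynomial_map_pullback[OF poly p(1)] by auto
    show ?thesis using subalgebra_gen_product_line[OF g(1)] g(2) hp mem by metis
  qed
  have N: "h (\<phi> s x) = poly (N h x) s" if h: "h \<in> ?K" and x: "x \<in> X" for h s x
  proof -
    obtain q where "\<forall>s. h (\<phi> s x) = poly (q x) s" using curve[OF h] x by blast
    then show ?thesis unfolding N_def by (rule someI2) blast
  qed
  have N_eq: "N h x = p" if "h \<in> ?K" "x \<in> X" "\<And>s. h (\<phi> s x) = poly p s" for h x p
    by (rule poly_eqI_cofinite) (simp add: N[OF that(1,2), symmetric] that(3))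
  have N0: "coeff (N h x) 0 = h x" if "h \<in> ?K" "x \<in> X" for h x
    using N[OF that, of 0] zero[OF that(2)] by (simp add: poly_0_coeff_0)
  have K_I: "(\<lambda>x. if x \<in> X then p x else 0) \<in> ?K" if "p \<in> subalgebra_gen (coordinates I)" for p
    using that unfolding coordinate_subring_def by auto
  have D_closed: "D h \<in> ?K" if h: "h \<in> ?K" for h
  proof -
    obtain q where q: "\<And>x s. x \<in> X \<Longrightarrow> h (\<phi> s x) = poly (q x) s"
      "\<And>k. (\<lambda>x. coeff (q x) k) \<in> subalgebra_gen (coordinates I)" using curve[OF h] by blast
    have "D h = (\<lambda>x. if x \<in> X then coeff (q x) 1 else 0)"
      using N_eq[OF h _ q(1)] by (auto simp: D_def)
    then show ?thesis using K_I[OF q(2)[of 1]] by simp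
  qed
  have K_add: "(\<lambda>x. g x + h x) \<in> ?K" if "g \<in> ?K" "h \<in> ?K" for g h
  proof -
    obtain p q where p: "p \<in> subalgebra_gen (coordinates I)" "g = (\<lambda>x. if x \<in> X then p x else 0)"
      and q: "q \<in> subalgebra_gen (coordinates I)" "h = (\<lambda>x. if x \<in> X then q x else 0)"
      using \<open>g \<in> ?K\<close> \<open>h \<in> ?K\<close> by (auto simp: coordinate_subring_def)
    have "(\<lambda>x. g x + h x) = (\<lambda>x. if x \<in> X then p x + q x else 0)" by (auto simp: p q)
    then show ?thesis using K_I[OF subalgebra_gen.add[OF p(1) q(1)]] by simp
  qed
  have K_mult: "(\<lambda>x. g x * h x) \<in> ?K" if "g \<in> ?K" "h \<in> ?K" for g h
  proof -
    obtain p q where p: "p \<in> subalgebra_gen (coordinates I)" "g = (\<lambda>x. if x \<in> X then p x else 0)"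
      and q: "q \<in> subalgebra_gen (coordinates I)" "h = (\<lambda>x. if x \<in> X then q x else 0)"
      using \<open>g \<in> ?K\<close> \<open>h \<in> ?K\<close> by (auto simp: coordinate_subring_def)
    have "(\<lambda>x. g x * h x) = (\<lambda>x. if x \<in> X then p x * q x else 0)" by (auto simp: p q)
    then show ?thesis using K_I[OF subalgebra_gen.mult[OF p(1) q(1)]] by simp
  qed
  have K_scale: "(\<lambda>x. c * h x) \<in> ?K" if "h \<in> ?K" for c h
  proof -
    obtain q where q: "q \<in> subalgebra_gen (coordinates I)" "h = (\<lambda>x. if x \<in> X then q x else 0)"
      using \<open>h \<in> ?K\<close> by (auto simp: coordinate_subring_def)
    have "(\<lambda>x. c * h x) = (\<lambda>x. if x \<in> X then c * q x else 0)" by (auto simp: q)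
    then show ?thesis using K_I[OF subalgebra_gen.mult[OF subalgebra_gen.const q(1)], of c] by simp
  qed
  have outside: "h x = 0" if "h \<in> ?K" "x \<notin> X" for h x using that by (auto simp: coordinate_subring_def)
  \<comment> \<open>By the flow law the polynomial at \<open>\<phi> s x\<close> is the one at
    \<open>x\<close> shifted by \<open>s\<close>, so \<open>D\<close> acts on these polynomials as
    differentiation.\<close>
  have ND: "N (D h) x = pderiv (N h x)" if h: "h \<in> ?K" and x: "x \<in> X" for h x
  proof (rule N_eq[OF D_closed[OF h] x])
    fix s
    let ?y = "\<phi> s x"
    have y: "?y \<in> X" by (rule mem[OF x])
    have "N h ?y = pcompose (N h x) [:s, 1:]"
    proof (rule N_eq[OF h y])
      fix r show "h (\<phi> r ?y) = poly (pcompose (N h x) [:s, 1:]) r"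
        using N[OF h x, of "r + s"] add[OF x, of r s] by (simp add: poly_pcompose add.commute)
    qed
    then have "D h ?y = coeff (pcompose (N h x) [:s, 1:]) 1" using y by (simp add: D_def)
    also have "\<dots> = poly (pderiv (pcompose (N h x) [:s, 1:])) 0"
      by (simp add: poly_0_coeff_0 coeff_pderiv)
    also have "\<dots> = poly (pderiv (N h x)) s"
      by (simp add: pderiv_pcompose poly_pcompose pderiv_pCons)
    finally show "D h ?y = poly (pderiv (N h x)) s" .
  qed
  have iter: "(D ^^ n) h \<in> ?K" if "h \<in> ?K" for n h
    by (induction n) (auto simp: that D_closed)
  have NDn: "N ((D ^^ n) h) x = (pderiv ^^ n) (N h x)" if "h \<in> ?K" "x \<in> X" for n h x
    by (induction n) (auto simp: ND iter that)
  have "locally_nilpotent_derivation ?K D"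
    unfolding locally_nilpotent_derivation_def derivation_def
  proof (intro conjI ballI allI)
    show "D \<in> ?K \<rightarrow> ?K" using D_closed by blast
  next
    fix g h assume gh: "g \<in> ?K" "h \<in> ?K"
    have "N (\<lambda>x. g x + h x) x = N g x + N h x" if "x \<in> X" for x
      by (rule N_eq[OF K_add[OF gh] that]) (simp add: N gh that)
    then show "D (\<lambda>x. g x + h x) = (\<lambda>x. D g x + D h x)" by (auto simp: D_def)
    have "N (\<lambda>x. g x * h x) x = N g x * N h x" if "x \<in> X" for x
      by (rule N_eq[OF K_mult[OF gh] that]) (simp add: N gh that)
    moreover have "coeff (p * q) 1 = coeff p 0 * coeff q 1 + coeff p 1 * coeff q 0" for p q :: "'k poly"
      by (simp add: coeff_mult)
    ultimately show "D (\<lambda>x. g x * h x) = (\<lambda>x. g x * D h x + D g x * h x)"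
      by (auto simp: D_def N0 gh outside)
  next
    fix c h assume h: "h \<in> ?K"
    have "N (\<lambda>x. c * h x) x = smult c (N h x)" if "x \<in> X" for x
      by (rule N_eq[OF K_scale[OF h] that]) (simp add: N h that)
    then show "D (\<lambda>x. c * h x) = (\<lambda>x. c * D h x)" by (auto simp: D_def)
  next
    fix h assume h: "h \<in> ?K"
    obtain q n where q: "\<And>x s. x \<in> X \<Longrightarrow> h (\<phi> s x) = poly (q x) s" "\<And>x. degree (q x) \<le> n"
      using curve[OF h] by blast
    have "(D ^^ Suc n) h x = 0" for x
    proof (cases "x \<in> X")
      case True
      have "N h x = q x" by (rule N_eq[OF h True q(1)[OF True]])
      then have "N ((D ^^ Suc n) h) x = 0"
        unfolding NDn[OF h True] using q(2)[of x] by (intro pderiv_iter_eq_0) simp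
      then show ?thesis using N0[OF iter[OF h] True, of "Suc n"] by simp
    qed (rule outside[OF iter[OF h]])
    then show "\<exists>n>0. (D ^^ n) h = (\<lambda>_. 0)" by (intro exI[of _ "Suc n"]) (auto simp del: funpow.simps)
  qed
  then have f': "f \<in> ?K" "D f = (\<lambda>_. 0)" using f by (auto simp: makar_limanov_def)
  have "pderiv (N f x) = N (D f) x" by (rule ND[OF f'(1) x, symmetric])
  also have "\<dots> = 0" by (rule N_eq[OF D_closed[OF f'(1)] x]) (simp add: f')
  finally have "degree (N f x) = 0" by (simp add: pderiv_eq_0_iff)
  then obtain c where "N f x = [:c:]" by (rule degree_eq_zeroE)
  then show ?thesis using N[OF f'(1) x, of s] N[OF f'(1) x, of 0] zero[OF x] by simp
qed

lemma makar_limanov_SAut_invariant: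
  assumes f: "f \<in> makar_limanov I X" and \<alpha>: "\<alpha> \<in> SAut I X" and x: "x \<in> X"
  shows "f (\<alpha> x) = f x"
proof -
  have Ga: "\<forall>x\<in>X. f (h x) = f x" if H: "Ga_subgroup I X H" "h \<in> H" for H h
  proof -
    obtain \<phi> where \<phi>: "\<phi> \<in> iso (additive_group :: 'k monoid) (\<G> \<lparr>carrier := H\<rparr>)"
      "polynomial_map_on (UNIV \<times> X) (insert fst ((\<lambda>f. f \<circ> snd) ` coordinates I)) I (\<lambda>(s, x). \<phi> s x)"
      using H(1) by (auto simp: Ga_subgroup_def)
    have sub: "subgroup H \<G>" using H(1) by (simp add: Ga_subgroup_def)
    have \<phi>H: "\<phi> s \<in> H" "\<phi> (s + r) = \<phi> s \<otimes>\<^bsub>\<G>\<^esub> \<phi> r" for s r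
      using \<phi>(1) by (auto simp: iso_def hom_def additive_group_def)
    have aut: "\<phi> s \<in> automorphisms I X" for s
      using subgroup.subset[OF sub] \<phi>H(1)[of s] by (auto simp: Aut_simps)
    have mem: "\<phi> s x \<in> X" if "x \<in> X" for s x by (rule Bij_mem[OF automorphisms_Bij[OF aut] that])
    have add: "\<phi> (s + r) x = \<phi> s (\<phi> r x)" if "x \<in> X" for s r x
      using \<phi>H(2)[of s r] that by (simp add: Aut_simps(2)[OF aut aut])
    have zero: "\<phi> 0 x = x" if "x \<in> X" for x
    proof -
      have "inj_on (\<phi> 0) X" using automorphisms_Bij[OF aut, of 0] by (simp add: Bij_def bij_betw_def)
      moreover have "\<phi> 0 (\<phi> 0 x) = \<phi> 0 x" using add[OF that, of 0 0] by simp
      ultimately show ?thesis using mem[OF that] that by (auto dest: inj_onD)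
    qed
    obtain s where "h = \<phi> s" using \<phi>(1) H(2) by (auto simp: iso_def bij_betw_def)
    then show ?thesis using polynomial_flow_invariant[OF mem zero add \<phi>(2) f] by blast
  qed
  have Haut: "h \<in> automorphisms I X" if "Ga_subgroup I X H" "h \<in> H" for H h
    using that subgroup.mem_carrier[of H \<G> h] by (auto simp: Ga_subgroup_def Aut_simps(1))
  have "\<alpha> \<in> automorphisms I X \<and> (\<forall>x\<in>X. f (\<alpha> x) = f x)" using \<alpha> unfolding SAut_def
  proof (induction rule: generate.induct)
    case one
    have "\<one>\<^bsub>\<G>\<^esub> \<in> automorphisms I X"
      using monoid.one_closed[OF group.is_monoid[OF group_Aut]] by (simp only: Aut_simps(1))
    moreover have "f (\<one>\<^bsub>\<G>\<^esub> x) = f x" if "x \<in> X" for x using that by (simp add: Aut_simps(3))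
    ultimately show ?case by blast
  next
    case (incl h)
    then show ?case using Ga Haut by blast
  next
    case (inv h)
    then obtain H where H: "Ga_subgroup I X H" "h \<in> H" by blast
    then have "inv\<^bsub>\<G>\<^esub> h \<in> H" using subgroup.m_inv_closed by (auto simp: Ga_subgroup_def)
    then show ?case using H Ga Haut by blast
  next
    case (eng h1 h2)
    have h: "h1 \<in> automorphisms I X" "h2 \<in> automorphisms I X" using eng.IH by auto
    then have "h1 \<otimes>\<^bsub>\<G>\<^esub> h2 \<in> automorphisms I X"
      using monoid.m_closed[OF group.is_monoid[OF group_Aut], of h1 h2] by (simp only: Aut_simps(1))
    moreover have "f ((h1 \<otimes>\<^bsub>\<G>\<^esub> h2) x) = f x" if "x \<in> X" for x
      using eng.IH that Bij_mem[OF automorphisms_Bij[OF h(2)] that] by (simp add: Aut_simps(2)[OF h])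
    ultimately show ?case by blast
  qed
  then show ?thesis using x by blast
qed

text \<open>An injective family is itself an additive subgroup. Otherwise it has a nonzero period
  \<open>d\<close>; in characteristic zero a polynomial taking the same value at all natural
  multiples of \<open>d\<close> is constant, so the flow is trivial.\<close>

lemma flow_SAut:
  fixes \<phi> :: "'k \<Rightarrow> ('i \<Rightarrow> 'k) \<Rightarrow> ('i \<Rightarrow> 'k)"
  assumes mem: "\<And>s x. x \<in> X \<Longrightarrow> \<phi> s x \<in> X" and zero: "\<And>x. x \<in> X \<Longrightarrow> \<phi> 0 x = x"
    and add: "\<And>s r x. x \<in> X \<Longrightarrow> \<phi> (s + r) x = \<phi> s (\<phi> r x)"
    and poly: "polynomial_map_on (UNIV \<times> X) (insert fst ((\<lambda>f. f \<circ> snd) ` coordinates I)) I (\<lambda>(s, x). \<phi> s x)"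
  shows "restrict (\<phi> s) X \<in> SAut I X"
proof -
  define \<psi> where "\<psi> s = restrict (\<phi> s) X" for s
  have "\<exists>p. p \<in> subalgebra_gen (insert fst ((\<lambda>f. f \<circ> snd) ` coordinates I)) \<and>
      (\<forall>s. \<forall>x\<in>X. \<phi> s x i = p (s, x))" if i: "i \<in> I" for i
  proof -
    obtain p where "p \<in> subalgebra_gen (insert fst ((\<lambda>f. f \<circ> snd) ` coordinates I))"
      "\<forall>z\<in>UNIV \<times> X. (case z of (s, x) \<Rightarrow> \<phi> s x) i = p z"
      using poly i unfolding polynomial_map_on_def by blast
    then show ?thesis by (intro exI[of _ p]) auto
  qed
  then obtain p where p: "\<And>i. i \<in> I \<Longrightarrow> p i \<in> subalgebra_gen (insert fst ((\<lambda>f. f \<circ> snd) ` coordinates I))"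
    "\<And>i s x. i \<in> I \<Longrightarrow> x \<in> X \<Longrightarrow> \<phi> s x i = p i (s, x)"
    by metis
  have "\<exists>q. (\<forall>s x. p i (s, x) = poly (q x) s) \<and> (\<forall>k. (\<lambda>x. coeff (q x) k) \<in> subalgebra_gen (coordinates I))
    \<and> (\<exists>n. \<forall>x. degree (q x) \<le> n)" if "i \<in> I" for i
    using subalgebra_gen_product_line[OF p(1)[OF that]] by blast
  then obtain q where q: "\<And>i s x. i \<in> I \<Longrightarrow> p i (s, x) = poly (q i x) s"
    "\<And>i k. i \<in> I \<Longrightarrow> (\<lambda>x. coeff (q i x) k) \<in> subalgebra_gen (coordinates I)"
    "\<And>i. i \<in> I \<Longrightarrow> \<exists>n. \<forall>x. degree (q i x) \<le> n"
    by metis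
  have pm: "polynomial_map_on X (coordinates I) I (\<phi> s)" for s
    unfolding polynomial_map_on_def
  proof
    fix i assume i: "i \<in> I"
    obtain n where n: "\<And>x. degree (q i x) \<le> n" using q(3)[OF i] by blast
    have "(\<lambda>x. \<Sum>k\<le>n. coeff (q i x) k * s ^ k) \<in> subalgebra_gen (coordinates I)"
      by (intro subalgebra_gen_intros q i)
    moreover have "\<phi> s x i = (\<Sum>k\<le>n. coeff (q i x) k * s ^ k)" if "x \<in> X" for x
      using p(2)[OF i that] q(1)[OF i] poly_sum_le[OF n] by metis
    ultimately show "\<exists>p\<in>subalgebra_gen (coordinates I). \<forall>x\<in>X. \<phi> s x i = p x"
      by (intro bexI[of _ "\<lambda>x. \<Sum>k\<le>n. coeff (q i x) k * s ^ k"] ballI)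
  qed
  have inverse: "\<phi> (- s) (\<phi> s x) = x" if "x \<in> X" for s x
    using add[OF that, of "- s" s] zero[OF that] by simp
  have aut: "\<psi> s \<in> automorphisms I X" for s
    unfolding \<psi>_def using inverse inverse[of _ "- s"]
    by (intro automorphismsI[where g = "\<phi> (- s)"] mem pm) auto
  have \<psi>_add: "\<psi> (s + r) = \<psi> s \<otimes>\<^bsub>\<G>\<^esub> \<psi> r" for s r
    using Aut_simps(2)[OF aut aut, of s r] by (auto simp: \<psi>_def add mem fun_eq_iff)
  have \<psi>_0: "\<psi> 0 = \<one>\<^bsub>\<G>\<^esub>" by (auto simp: \<psi>_def zero Aut_simps fun_eq_iff)
  have "\<psi> s \<in> SAut I X"
  proof (cases "inj \<psi>")
    case True
    have \<psi>_inv: "inv\<^bsub>\<G>\<^esub> (\<psi> s) = \<psi> (- s)" for s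
      using group.inv_equality[OF group_Aut, of "\<psi> (- s)" "\<psi> s"] \<psi>_add[of "- s" s] \<psi>_0 aut
      by (simp add: Aut_simps(1))
    have "subgroup (range \<psi>) \<G>"
    proof (rule subgroup.intro)
      show "range \<psi> \<subseteq> carrier \<G>" using aut by (auto simp: Aut_simps)
      show "\<one>\<^bsub>\<G>\<^esub> \<in> range \<psi>" using \<psi>_0 by (metis rangeI)
      show "x \<otimes>\<^bsub>\<G>\<^esub> y \<in> range \<psi>" if "x \<in> range \<psi>" "y \<in> range \<psi>" for x y
        using that by (auto simp: \<psi>_add[symmetric])
      show "inv\<^bsub>\<G>\<^esub> x \<in> range \<psi>" if "x \<in> range \<psi>" for x
        using that by (auto simp: \<psi>_inv)
    qed
    moreover have "\<psi> \<in> iso (additive_group :: 'k monoid) (\<G> \<lparr>carrier := range \<psi>\<rparr>)"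
      using True \<psi>_add by (auto simp: iso_def hom_def additive_group_def bij_betw_def)
    moreover have "polynomial_map_on (UNIV \<times> X) (insert fst ((\<lambda>f. f \<circ> snd) ` coordinates I)) I (\<lambda>(s, x). \<psi> s x)"
      by (rule polynomial_map_cong[OF poly]) (auto simp: \<psi>_def)
    ultimately have "Ga_subgroup I X (range \<psi>)" unfolding Ga_subgroup_def by blast
    then show ?thesis unfolding SAut_def by (intro generate.incl) blast
  next
    case False
    then obtain a b where ab: "\<psi> a = \<psi> b" "a \<noteq> b" by (auto simp: inj_def)
    define d where "d = a - b"
    have d: "d \<noteq> 0" using ab by (simp add: d_def)
    have fix1: "\<phi> d x = x" if "x \<in> X" for x
    proof -
      have "\<phi> a x = \<phi> b x" using fun_cong[OF ab(1), of x] that by (simp add: \<psi>_def)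
      then show ?thesis
        using add[OF that, of "- b" a] add[OF that, of "- b" b] zero[OF that] by (simp add: d_def)
    qed
    have fixn: "\<phi> (of_nat n * d) x = x" if "x \<in> X" for n x
      by (induction n) (simp_all add: zero that distrib_right add fix1)
    have "\<phi> s x = x" if x: "x \<in> X" for x
    proof (rule point_ext[OF mem[OF x] x])
      fix i assume i: "i \<in> I"
      have val: "poly (q i x) r = \<phi> r x i" for r using p(2)[OF i x] q(1)[OF i] by simp
      have "q i x - [:x i:] = 0"
      proof (rule ccontr)
        assume "q i x - [:x i:] \<noteq> 0"
        then have "finite {r. poly (q i x - [:x i:]) r = 0}" by (rule poly_roots_finite)
        moreover have "range (\<lambda>n. of_nat n * d) \<subseteq> {r. poly (q i x - [:x i:]) r = 0}"
          using fixn[OF x] val by auto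
        ultimately have "finite (range (\<lambda>n. of_nat n * d))" by (rule rev_finite_subset)
        moreover have "inj (\<lambda>n. of_nat n * d)" using d by (auto simp: inj_def)
        ultimately show False using finite_imageD infinite_UNIV_nat by blast
      qed
      then have "q i x = [:x i:]" by simp
      then show "\<phi> s x i = x i" using val[of s] by simp
    qed
    then have "\<psi> s = \<one>\<^bsub>\<G>\<^esub>" by (auto simp: \<psi>_def Aut_simps fun_eq_iff)
    then show ?thesis using subgroup.one_closed[OF subgroup_SAut] by simp
  qed
  then show ?thesis by (simp add: \<psi>_def)
qed

lemma flow_linked:
  assumes "\<And>s x. x \<in> X \<Longrightarrow> \<phi> s x \<in> X" "\<And>x. x \<in> X \<Longrightarrow> \<phi> 0 x = x"
    and "\<And>s r x. x \<in> X \<Longrightarrow> \<phi> (s + r) x = \<phi> s (\<phi> r x)"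
    and "polynomial_map_on (UNIV \<times> X) (insert fst ((\<lambda>f. f \<circ> snd) ` coordinates I)) I (\<lambda>(s, x). \<phi> s x)"
    and "x \<in> X"
  shows "linked x (\<phi> s x)"
proof -
  have "restrict (\<phi> s) X \<in> SAut I X" by (rule flow_SAut) (fact assms)+
  then show ?thesis
    unfolding linked_def using assms(5) by (intro conjI bexI[of _ "restrict (\<phi> s) X"]) simp_all
qed

lemma makar_limanov_linked: "f \<in> makar_limanov I X \<Longrightarrow> linked P Q \<Longrightarrow> f Q = f P"
  using makar_limanov_SAut_invariant by (auto simp: linked_def)

end

section \<open>Transitivity on the fibres of the invariants\<close>

text \<open>\<open>telescope n s c q\<close> is \<open>((q + s c)\<^sup>n - q\<^sup>n) / c\<close>, written as a polynomial.\<close>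

definition telescope :: "nat \<Rightarrow> 'k \<Rightarrow> 'k \<Rightarrow> 'k \<Rightarrow> 'k::field" where
  "telescope n s c q = s * (\<Sum>i<n. q ^ (n - Suc i) * (q + s * c) ^ i)"

lemma telescope_mult: "c * telescope n s c q = (q + s * c) ^ n - q ^ n"
  using power_diff_sumr2[of "q + s * c" n q] by (simp add: telescope_def)

text \<open>The cocycle law of difference quotients; it becomes the group law of the flow.\<close>

lemma telescope_add: "telescope n (s + r) c q = telescope n r c q + telescope n s c (q + r * c)"
proof (cases "c = 0")
  case True
  then show ?thesis by (simp add: telescope_def algebra_simps)
next
  case False
  have "c * telescope n (s + r) c q = c * (telescope n r c q + telescope n s c (q + r * c))"
    unfolding distrib_left telescope_mult by (simp add: algebra_simps)
  then show ?thesis using False by simp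
qed

section \<open>Explicit additive group actions on \<open>X\<close>\<close>

context trinomial
begin

sublocale affine_set I X
  by unfold_locales (auto simp: X_F)

definition free_block :: "'i set" where "free_block = {i \<in> J1. \<mu> i = 1}"

text \<open>The flows below move only \<open>x0\<close>, the free block and \<open>J2\<close>; the
  remaining coordinates generate an upper bound for the Makar-Limanov invariant.\<close>

definition invariant_coordinates :: "'i set" where
  "invariant_coordinates = (J0 - {x0}) \<union> (J1 - free_block)"

definition v :: "'i \<Rightarrow> ('i \<Rightarrow> 'k) \<Rightarrow> 'k" where "v y = mon (J1 - {y}) \<mu>"

definition lin :: "'k \<Rightarrow> ('i \<Rightarrow> 'k) \<Rightarrow> 'k" where "lin \<iota> x = A x + \<iota> * B x"

lemma B_v: "y \<in> free_block \<Longrightarrow> B x = x y * v y x"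
  using mon_remove[OF finite_blocks(2), of y \<mu> x] by (simp add: free_block_def v_def)

lemma y0_free: "y0 \<in> free_block"
  by (simp add: free_block_def y0)

lemma lin_conj:
  assumes "\<iota> ^ 2 = - 1" "x \<in> X"
  shows "lin \<iota> x * lin (- \<iota>) x = - P x"
  using X_zero[OF assms(2)] assms(1) unfolding lin_def by algebra

text \<open>The flow fixes \<open>a = A + \<iota> B\<close> and all coordinates other than \<open>x0\<close>, \<open>y\<close>, \<open>q\<close>; it moves \<open>T\<^sub>q\<close> with
  speed \<open>a u v\<close>, and \<open>A - \<iota> B = - P / a\<close> accordingly.\<close>

definition flow :: "'k \<Rightarrow> 'i \<Rightarrow> 'i \<Rightarrow> 'k \<Rightarrow> ('i \<Rightarrow> 'k) \<Rightarrow> ('i \<Rightarrow> 'k)" where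
  "flow \<iota> y q s x = (let c = lin \<iota> x * u x * v y x;
       d = mon (J2 - {q}) \<mu> x * telescope (\<mu> q) s c (x q) / 2
     in x(x0 := x x0 - v y x * d, y := x y - \<iota> * u x * d, q := x q + s * c))"

context
  fixes \<iota> y q
  assumes \<iota>: "\<iota> ^ 2 = (- 1 :: 'k)" and y: "y \<in> free_block" and q: "q \<in> J2"
begin

lemma flow_indices: "x0 \<noteq> y" "x0 \<noteq> q" "y \<noteq> q" "x0 \<notin> J1" "x0 \<notin> J2" "y \<notin> J0" "y \<notin> J2" "q \<notin> J0" "q \<notin> J1"
  "x0 \<in> I" "y \<in> I" "q \<in> I" "y \<in> J1"
  using x0 y q disjoint by (auto simp: free_block_def I_eq)

lemma upd_simps:
  "u (x(x0 := a, y := b, q := c)) = u x" "v y (x(x0 := a, y := b, q := c)) = v y x"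
  "mon (J2 - {q}) \<mu> (x(x0 := a, y := b, q := c)) = mon (J2 - {q}) \<mu> x"
  using flow_indices by (simp_all add: u_def v_def mon_upd)

text \<open>The changes of \<open>A\<close> and \<open>\<iota> * B\<close> cancel in
  \<open>lin \<iota>\<close>. Its conjugate drops by \<open>2 * u x * v y x * d\<close> while
  \<open>P\<close> grows by \<open>2 * c x * d\<close>, which balances the equation.\<close>

lemma flow_values:
  defines "c \<equiv> \<lambda>x. lin \<iota> x * u x * v y x"
  shows "u (flow \<iota> y q s x) = u x" "v y (flow \<iota> y q s x) = v y x"
    "mon (J2 - {q}) \<mu> (flow \<iota> y q s x) = mon (J2 - {q}) \<mu> x"
    "flow \<iota> y q s x q = x q + s * c x" "\<And>i. i \<notin> {x0, y, q} \<Longrightarrow> flow \<iota> y q s x i = x i"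
    "lin \<iota> (flow \<iota> y q s x) = lin \<iota> x" "F (flow \<iota> y q s x) = F x"
proof -
  define d where "d = mon (J2 - {q}) \<mu> x * telescope (\<mu> q) s (c x) (x q) / 2"
  have fl: "flow \<iota> y q s x = x(x0 := x x0 - v y x * d, y := x y - \<iota> * u x * d, q := x q + s * c x)"
    by (simp add: flow_def Let_def d_def c_def)
  show 1: "u (flow \<iota> y q s x) = u x" "v y (flow \<iota> y q s x) = v y x"
    "mon (J2 - {q}) \<mu> (flow \<iota> y q s x) = mon (J2 - {q}) \<mu> x"
    unfolding fl by (rule upd_simps)+
  show 2: "flow \<iota> y q s x q = x q + s * c x" "\<And>i. i \<notin> {x0, y, q} \<Longrightarrow> flow \<iota> y q s x i = x i"
    using flow_indices by (auto simp: fl)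
  have x0y: "flow \<iota> y q s x x0 = x x0 - v y x * d" "flow \<iota> y q s x y = x y - \<iota> * u x * d"
    using flow_indices by (simp_all add: fl)
  have AB: "A (flow \<iota> y q s x) = A x - u x * v y x * d" "B (flow \<iota> y q s x) = B x - \<iota> * (u x * v y x * d)"
    unfolding A_u B_v[OF y] 1 x0y by (simp_all add: algebra_simps)
  show "lin \<iota> (flow \<iota> y q s x) = lin \<iota> x"
    unfolding lin_def AB using \<iota> by algebra
  have "P (flow \<iota> y q s x) - P x = mon (J2 - {q}) \<mu> x * ((x q + s * c x) ^ \<mu> q - x q ^ \<mu> q)"
    using mon_remove[OF finite_blocks(3) q, of \<mu> "flow \<iota> y q s x"] mon_remove[OF finite_blocks(3) q, of \<mu> x]
    by (simp add: 1 2 algebra_simps)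
  also have "\<dots> = c x * (2 * d)" unfolding telescope_mult[symmetric] by (simp add: d_def)
  finally have "P (flow \<iota> y q s x) = P x + c x * (2 * d)" by (simp add: algebra_simps)
  then show "F (flow \<iota> y q s x) = F x"
    unfolding F_def AB c_def lin_def using \<iota> by algebra
qed

lemma flow_mem: "x \<in> X \<Longrightarrow> flow \<iota> y q s x \<in> X"
proof -
  assume x: "x \<in> X"
  have "flow \<iota> y q s x i = undefined" if "i \<notin> I" for i
  proof -
    have "i \<notin> {x0, y, q}" using that flow_indices by blast
    then show ?thesis using flow_values(5)[of i s x] x that by (auto simp: X_F affine_space_def PiE_iff extensional_def)
  qed
  then show ?thesis using flow_values(7)[of s x] x by (auto simp: X_F affine_space_def PiE_iff extensional_def)
qed

lemma flow_zero: "flow \<iota> y q 0 x = x"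
  by (simp add: flow_def telescope_def Let_def)

lemma flow_add: "flow \<iota> y q (s + r) x = flow \<iota> y q s (flow \<iota> y q r x)"
proof -
  define c where "c = lin \<iota> x * u x * v y x"
  define z where "z = mon (J2 - {q}) \<mu> x"
  define x' where "x' = flow \<iota> y q r x"
  have c': "lin \<iota> x' * u x' * v y x' = c" "mon (J2 - {q}) \<mu> x' = z" "u x' = u x" "v y x' = v y x"
    by (simp_all add: x'_def flow_values c_def z_def)
  have x': "x' = x(x0 := x x0 - v y x * (z * telescope (\<mu> q) r c (x q) / 2),
      y := x y - \<iota> * u x * (z * telescope (\<mu> q) r c (x q) / 2), q := x q + r * c)"
    by (simp add: x'_def flow_def Let_def c_def z_def)
  have x'v: "x' x0 = x x0 - v y x * (z * telescope (\<mu> q) r c (x q) / 2)"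
    "x' y = x y - \<iota> * u x * (z * telescope (\<mu> q) r c (x q) / 2)" "x' q = x q + r * c"
    using flow_indices by (simp_all add: x')
  have 1: "flow \<iota> y q s x' = x'(x0 := x' x0 - v y x * (z * telescope (\<mu> q) s c (x' q) / 2),
      y := x' y - \<iota> * u x * (z * telescope (\<mu> q) s c (x' q) / 2), q := x' q + s * c)"
    unfolding flow_def Let_def c'(1,2) unfolding c'(3,4) ..
  have 2: "flow \<iota> y q (s + r) x = x(x0 := x x0 - v y x * (z * telescope (\<mu> q) (s + r) c (x q) / 2),
      y := x y - \<iota> * u x * (z * telescope (\<mu> q) (s + r) c (x q) / 2), q := x q + (s + r) * c)"
    unfolding flow_def Let_def c_def z_def ..
  have "flow \<iota> y q (s + r) x = flow \<iota> y q s x'"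
  proof
    fix i
    show "flow \<iota> y q (s + r) x i = flow \<iota> y q s x' i"
    proof (cases "i \<in> {x0, y, q}")
      case True
      then show ?thesis
        using flow_indices unfolding 1 2 telescope_add by (auto simp: x'v field_simps)
    next
      case False
      then show ?thesis unfolding 1 2 by (simp add: x')
    qed
  qed
  then show ?thesis by (simp add: x'_def)
qed

lemma flow_poly:
  "polynomial_map_on (UNIV \<times> X) (insert fst ((\<lambda>f. f \<circ> snd) ` coordinates I)) I (\<lambda>(s, x). flow \<iota> y q s x)"
proof -
  let ?C = "insert fst ((\<lambda>f. f \<circ> snd) ` coordinates I) :: ('k \<times> ('i \<Rightarrow> 'k) \<Rightarrow> 'k) set"
  have co: "(\<lambda>z. snd z i) \<in> subalgebra_gen ?C" if "i \<in> I" for i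
  proof -
    have "(\<lambda>x. x i) \<circ> snd \<in> subalgebra_gen ?C"
      using that by (intro subalgebra_gen.gen) (auto simp: coordinates_def)
    then show ?thesis by (simp add: comp_def)
  qed
  have s: "(\<lambda>z. fst z) \<in> subalgebra_gen ?C" by (rule subalgebra_gen.gen) auto
  have lift: "(\<lambda>z. f (snd z)) \<in> subalgebra_gen ?C" if "f \<in> R" for f
    by (rule subalgebra_gen_subst[OF that co])
  have R: "u \<in> R" "v y \<in> R" "lin \<iota> \<in> R" "mon (J2 - {q}) \<mu> \<in> R"
  proof -
    show "u \<in> R" "v y \<in> R" "mon (J2 - {q}) \<mu> \<in> R"
      unfolding u_def v_def by (rule mon_poly, use blocks_subset in auto)+
    show "lin \<iota> \<in> R" unfolding lin_def[abs_def] by (intro subalgebra_gen_intros ABP_poly)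
  qed
  define c where "c z = lin \<iota> (snd z) * u (snd z) * v y (snd z)" for z :: "'k \<times> ('i \<Rightarrow> 'k)"
  have cC: "c \<in> subalgebra_gen ?C"
    unfolding c_def[abs_def] by (intro subalgebra_gen_intros lift R)
  define d where "d z = mon (J2 - {q}) \<mu> (snd z) * telescope (\<mu> q) (fst z) (c z) (snd z q) * (1 / 2)" for z
  have dC: "d \<in> subalgebra_gen ?C"
    unfolding d_def[abs_def] telescope_def
    by (intro subalgebra_gen_intros lift R s co cC flow_indices)
  show ?thesis
    unfolding polynomial_map_on_def
  proof
    fix i assume i: "i \<in> I"
    define p where "p z = (if i = q then snd z q + fst z * c z else if i = y then snd z y - \<iota> * u (snd z) * d z
      else if i = x0 then snd z x0 - v y (snd z) * d z else snd z i)" for z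
    have "p \<in> subalgebra_gen ?C"
    proof -
      have "(\<lambda>z. snd z q + fst z * c z) \<in> subalgebra_gen ?C"
        "(\<lambda>z. snd z y - \<iota> * u (snd z) * d z) \<in> subalgebra_gen ?C"
        "(\<lambda>z. snd z x0 - v y (snd z) * d z) \<in> subalgebra_gen ?C"
        by (intro subalgebra_gen_intros lift R s co cC dC flow_indices)+
      then show ?thesis
        unfolding p_def[abs_def] using co[OF i] by (cases "i = q"; cases "i = y"; cases "i = x0") simp_all
    qed
    moreover have "(case z of (s, x) \<Rightarrow> flow \<iota> y q s x) i = p z" for z
      by (cases z) (auto simp: flow_def Let_def p_def d_def c_def)
    ultimately show "\<exists>p\<in>subalgebra_gen ?C. \<forall>z\<in>UNIV \<times> X. (case z of (s, x) \<Rightarrow> flow \<iota> y q s x) i = p z"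
      by (intro bexI[of _ p]) simp_all
  qed
qed

lemma move_coordinate:
  assumes x: "x \<in> X" and nz: "lin \<iota> x \<noteq> 0" "u x \<noteq> 0" "v y x \<noteq> 0"
  shows "\<exists>x'. linked x x' \<and> x' q = \<tau> \<and> (\<forall>i. i \<notin> {x0, y, q} \<longrightarrow> x' i = x i) \<and> lin \<iota> x' = lin \<iota> x"
proof -
  define s where "s = (\<tau> - x q) / (lin \<iota> x * u x * v y x)"
  have "linked x (flow \<iota> y q s x)"
    by (rule flow_linked[OF flow_mem flow_zero flow_add flow_poly x])
  moreover have "flow \<iota> y q s x q = \<tau>" using nz by (simp add: flow_values s_def)
  ultimately show ?thesis using flow_values(5)[of _ s x] flow_values(6)[of s x] by blast
qed

end

section \<open>Normal forms in the fibres of the invariant coordinates\<close>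

lemma uv_cong: "(\<And>i. i \<in> J0 \<union> J1 - {x0, y} \<Longrightarrow> x' i = x i) \<Longrightarrow> y \<in> free_block \<Longrightarrow> u x' = u x \<and> v y x' = v y x"
  unfolding u_def v_def using disjoint x0 by (auto simp: free_block_def intro!: mon_cong)

lemma move_coordinates:
  assumes \<iota>: "\<iota> ^ 2 = (- 1 :: 'k)" and y: "y \<in> free_block" and Q: "Q \<subseteq> J2"
    and x: "x \<in> X" and nz: "lin \<iota> x \<noteq> 0" "u x \<noteq> 0" "v y x \<noteq> 0"
  shows "\<exists>x'. linked x x' \<and> (\<forall>q\<in>Q. x' q = 1) \<and> (\<forall>i. i \<notin> {x0, y} \<union> Q \<longrightarrow> x' i = x i) \<and> lin \<iota> x' = lin \<iota> x"
proof -
  have "finite Q" using Q finite_blocks(3) by (rule finite_subset)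
  then show ?thesis using Q
  proof (induction Q)
    case empty
    then show ?case using linked_refl[OF x] by auto
  next
    case (insert q Q)
    then obtain x1 where x1: "linked x x1" "\<forall>q\<in>Q. x1 q = 1" "\<forall>i. i \<notin> {x0, y} \<union> Q \<longrightarrow> x1 i = x i"
      "lin \<iota> x1 = lin \<iota> x" by auto
    have q: "q \<in> J2" using insert.prems by simp
    have Q': "Q \<inter> (J0 \<union> J1) = {}" "x0 \<notin> Q" "y \<notin> Q" "x0 \<notin> J2" "y \<notin> J2"
      using insert.prems disjoint x0 y by (auto simp: free_block_def)
    have "u x1 = u x \<and> v y x1 = v y x" using Q' x1(3) by (intro uv_cong y) auto
    then obtain x2 where x2: "linked x1 x2" "x2 q = 1" "\<forall>i. i \<notin> {x0, y, q} \<longrightarrow> x2 i = x1 i" "lin \<iota> x2 = lin \<iota> x1"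
      using move_coordinate[OF \<iota> y q, of x1 1] linked_X[OF x1(1)] nz x1(4) by auto
    have "\<forall>q'\<in>insert q Q. x2 q' = 1" using x1(2) x2(2,3) Q' by (metis insertE empty_iff)
    moreover have "\<forall>i. i \<notin> {x0, y} \<union> insert q Q \<longrightarrow> x2 i = x i" using x1(3) x2(3) by simp
    ultimately show ?case using linked_trans[OF x1(1) x2(1)] x1(4) x2(4) by (intro exI[of _ x2]) simp
  qed
qed

text \<open>Where \<open>lin \<iota>\<close> is nonzero, it and \<open>P\<close> determine its
  conjugate, hence \<open>A\<close> and \<open>B\<close>; division by \<open>u\<close> and
  \<open>v\<close> recovers \<open>x0\<close> and \<open>y\<close>.\<close>

lemma point_unique:
  assumes \<iota>: "\<iota> ^ 2 = (- 1 :: 'k)" and y: "y \<in> free_block" and x: "x \<in> X" "x' \<in> X"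
    and agree: "\<And>i. i \<in> I - {x0, y} \<Longrightarrow> x' i = x i"
    and nz: "lin \<iota> x \<noteq> 0" "u x \<noteq> 0" "v y x \<noteq> 0" and lin: "lin \<iota> x' = lin \<iota> x"
  shows "x' = x"
proof -
  have J: "x0 \<notin> J2" "y \<notin> J2" using disjoint x0 y by (auto simp: free_block_def)
  have uv: "u x' = u x" "v y x' = v y x" using agree uv_cong[OF _ y, of x' x] by (auto simp: I_eq)
  have P: "P x' = P x" using agree J by (intro mon_cong) (auto simp: I_eq)
  have "lin \<iota> x * lin (- \<iota>) x' = lin \<iota> x * lin (- \<iota>) x"
    using lin_conj[OF \<iota> x(1)] lin_conj[OF \<iota> x(2)] P lin by simp
  then have lin': "lin (- \<iota>) x' = lin (- \<iota>) x" using nz by simp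
  have "2 * A x' = 2 * A x" using lin lin' unfolding lin_def by algebra
  then have A: "A x' = A x" by simp
  then have "\<iota> * B x' = \<iota> * B x" using lin by (simp add: lin_def)
  moreover have "\<iota> \<noteq> 0" using \<iota> by auto
  ultimately have B: "B x' = B x" by simp
  have "x' x0 = x x0" using A nz(2) by (simp add: A_u uv)
  moreover have "x' y = x y" using B nz(3) by (simp add: B_v[OF y] uv)
  ultimately show ?thesis using agree by (intro point_ext[OF x(2,1)]) blast
qed

text \<open>Flows for \<open>\<iota>\<close> normalize \<open>J2\<close> but fix
  \<open>lin \<iota>\<close>; a flow for \<open>- \<iota>\<close> fixes the conjugate and changes
  \<open>lin \<iota>\<close> through \<open>P\<close>. Hence the sandwich: normalize
  \<open>J2\<close>, bring \<open>lin \<iota>\<close> to 1, normalize \<open>J2\<close>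
  again.\<close>

lemma linked_normal_form:
  assumes \<iota>: "\<iota> ^ 2 = (- 1 :: 'k)" and y: "y \<in> free_block"
    and x: "x \<in> X" and nz: "lin \<iota> x \<noteq> 0" "u x \<noteq> 0" "v y x \<noteq> 0"
  shows "\<exists>x'. linked x x' \<and> lin \<iota> x' = 1 \<and> (\<forall>q\<in>J2. x' q = 1) \<and> (\<forall>i. i \<notin> {x0, y} \<union> J2 \<longrightarrow> x' i = x i)"
proof -
  have \<iota>': "(- \<iota>) ^ 2 = - 1" using \<iota> by simp
  have J: "x0 \<notin> J2" "y \<notin> J2" "J2 \<inter> (J0 \<union> J1) = {}" using disjoint x0 y by (auto simp: free_block_def)
  obtain q where q: "q \<in> J2" using J2_ne by blast
  obtain x1 where x1: "linked x x1" "\<forall>q\<in>J2. x1 q = 1" "\<forall>i. i \<notin> {x0, y} \<union> J2 \<longrightarrow> x1 i = x i" "lin \<iota> x1 = lin \<iota> x"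
    using move_coordinates[OF \<iota> y subset_refl x nz] by auto
  have x1X: "x1 \<in> X" using linked_X[OF x1(1)] by simp
  have uv1: "u x1 = u x" "v y x1 = v y x" using uv_cong[OF _ y, of x1 x] x1(3) J by auto
  have "P x1 = 1" unfolding mon_def using x1(2) by simp
  then have b1: "lin \<iota> x * lin (- \<iota>) x1 = - 1" using lin_conj[OF \<iota> x1X] x1(4) by simp
  then have b1nz: "lin (- \<iota>) x1 \<noteq> 0" by auto
  \<comment> \<open>The conjugate is now -1 divided by \<open>lin \<iota> x\<close>, so
    \<open>lin \<iota>\<close> becomes 1 when \<open>P\<close> equals
    \<open>1 / lin \<iota> x\<close>.\<close>
  obtain \<tau> where \<tau>: "\<tau> ^ \<mu> q = 1 / lin \<iota> x" using nth_root_exists[of "\<mu> q"] \<mu>_ge2[OF q] by (metis not_numeral_le_zero neq0_conv)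
  obtain x2 where x2: "linked x1 x2" "x2 q = \<tau>" "\<forall>i. i \<notin> {x0, y, q} \<longrightarrow> x2 i = x1 i" "lin (- \<iota>) x2 = lin (- \<iota>) x1"
    using move_coordinate[OF \<iota>' y q x1X b1nz] uv1 nz by auto
  have x2X: "x2 \<in> X" using linked_X[OF x2(1)] by simp
  have uv2: "u x2 = u x" "v y x2 = v y x" using uv_cong[OF _ y, of x2 x1] x2(3) J q uv1 by auto
  have "mon (J2 - {q}) \<mu> x2 = 1"
    unfolding mon_def using x1(2) x2(3) J by (intro prod.neutral) auto
  then have "P x2 = 1 / lin \<iota> x" using mon_remove[OF finite_blocks(3) q, of \<mu> x2] x2(2) \<tau> by simp
  then have "lin \<iota> x2 * lin (- \<iota>) x1 = - (1 / lin \<iota> x)" using lin_conj[OF \<iota> x2X] x2(4) by simp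
  then have "lin \<iota> x2 * (lin \<iota> x * lin (- \<iota>) x1) = - 1" using nz(1) by (simp add: field_simps)
  then have a2: "lin \<iota> x2 = 1" by (simp add: b1)
  obtain x3 where x3: "linked x2 x3" "\<forall>q\<in>J2. x3 q = 1" "\<forall>i. i \<notin> {x0, y} \<union> J2 \<longrightarrow> x3 i = x2 i" "lin \<iota> x3 = lin \<iota> x2"
    using move_coordinates[OF \<iota> y subset_refl x2X] a2 uv2 nz by auto
  have "\<forall>i. i \<notin> {x0, y} \<union> J2 \<longrightarrow> x3 i = x i" using x1(3) x2(3) x3(3) q by auto
  then show ?thesis
    using linked_trans[OF x1(1) linked_trans[OF x2(1) x3(1)]] x3(2,4) a2 by auto
qed

text \<open>Both points have the same normal form.\<close>

lemma linked_fibre: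
  assumes \<iota>: "\<iota> ^ 2 = (- 1 :: 'k)" and y: "y \<in> free_block" and x: "x \<in> X" "x' \<in> X"
    and agree: "\<And>i. i \<in> I - ({x0, y} \<union> J2) \<Longrightarrow> x' i = x i"
    and nz: "lin \<iota> x \<noteq> 0" "lin \<iota> x' \<noteq> 0" "u x \<noteq> 0" "v y x \<noteq> 0"
  shows "linked x x'"
proof -
  have J: "J2 \<inter> (J0 \<union> J1) = {}" using disjoint by auto
  have uv: "u x' = u x" "v y x' = v y x" using uv_cong[OF _ y, of x' x] agree J by (auto simp: I_eq)
  obtain z where z: "linked x z" "lin \<iota> z = 1" "\<forall>q\<in>J2. z q = 1" "\<forall>i. i \<notin> {x0, y} \<union> J2 \<longrightarrow> z i = x i"
    using linked_normal_form[OF \<iota> y x(1)] nz by auto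
  obtain z' where z': "linked x' z'" "lin \<iota> z' = 1" "\<forall>q\<in>J2. z' q = 1" "\<forall>i. i \<notin> {x0, y} \<union> J2 \<longrightarrow> z' i = x' i"
    using linked_normal_form[OF \<iota> y x(2)] nz uv by auto
  have "u z = u x" "v y z = v y x" using uv_cong[OF _ y, of z x] z(4) J by auto
  moreover have "z' i = z i" if "i \<in> I - {x0, y}" for i
    using that z(3,4) z'(3,4) agree by (cases "i \<in> J2") auto
  ultimately have "z' = z"
    using z(2) z'(2) nz linked_X[OF z(1)] linked_X[OF z'(1)] by (intro point_unique[OF \<iota> y]) auto
  then show ?thesis using linked_trans[OF z(1)] linked_sym[OF z'(1)] by simp
qed

definition generic_points :: "'k \<Rightarrow> ('i \<Rightarrow> 'k) set" where
  "generic_points \<iota> = {x \<in> X. u x \<noteq> 0 \<and> (\<forall>i\<in>J1. x i \<noteq> 0) \<and> lin \<iota> x \<noteq> 0}"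

lemma v_nonzero: "x \<in> generic_points \<iota> \<Longrightarrow> v y x \<noteq> 0"
  unfolding v_def by (rule mon_nonzero) (auto simp: generic_points_def)

text \<open>\<open>linked_fibre\<close> leaves the coordinate \<open>y\<close> unconstrained, so it
  suffices to exhibit a generic point with value 1 there. Setting \<open>x0\<close> to 0 gives
  \<open>A = 0\<close> and \<open>B = v y x\<close>, and \<open>\<rho>\<close> solves the remaining
  equation for \<open>P\<close>.\<close>

lemma normalize_coordinate:
  assumes \<iota>: "\<iota> ^ 2 = (- 1 :: 'k)" and y: "y \<in> free_block" and x: "x \<in> generic_points \<iota>"
  shows "\<exists>x'\<in>generic_points \<iota>. linked x x' \<and> x' y = 1 \<and> (\<forall>i\<in>I - ({x0, y} \<union> J2). x' i = x i)"
proof -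
  have J: "J2 \<inter> (J0 \<union> J1) = {}" "x0 \<notin> J1" "x0 \<notin> J2" "y \<notin> J0" "y \<notin> J2" "y \<in> J1" "x0 \<noteq> y" "x0 \<in> I" "y \<in> I"
    using disjoint x0 y by (auto simp: free_block_def I_eq)
  obtain q where q: "q \<in> J2" using J2_ne by blast
  have \<mu>q: "\<mu> q > 0" using \<mu>_ge2[OF q] by simp
  obtain \<rho> where \<rho>: "\<rho> ^ \<mu> q = - (v y x ^ 2)" using nth_root_exists[OF \<mu>q] by blast
  define x' where "x' = (\<lambda>i. if i = x0 then 0 else if i = y then 1 else if i = q then \<rho>
    else if i \<in> J2 then 1 else x i)"
  have xX: "x \<in> X" "u x \<noteq> 0" "\<And>i. i \<in> J1 \<Longrightarrow> x i \<noteq> 0" "lin \<iota> x \<noteq> 0" using x by (auto simp: generic_points_def)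
  have other: "x' i = x i" if "i \<notin> {x0, y} \<union> J2" for i using that q by (auto simp: x'_def)
  have uv: "u x' = u x" "v y x' = v y x" using uv_cong[OF _ y, of x' x] other J by auto
  have x'v: "x' x0 = 0" "x' y = 1" "x' q = \<rho>" using J q by (auto simp: x'_def)
  have A: "A x' = 0" by (simp add: A_u x'v)
  have B: "B x' = v y x" by (simp add: B_v[OF y] x'v uv)
  have "mon (J2 - {q}) \<mu> x' = 1" unfolding mon_def using J by (intro prod.neutral) (auto simp: x'_def)
  then have P: "P x' = - (v y x ^ 2)" using mon_remove[OF finite_blocks(3) q, of \<mu> x'] x'v \<rho> by simp
  have "x' \<in> affine_space I"
    using xX(1) J q other by (fastforce simp: X_F affine_space_def PiE_iff extensional_def I_eq)
  then have x'X: "x' \<in> X" by (simp add: X_F F_def A B P)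
  have "\<iota> \<noteq> 0" using \<iota> by auto
  then have lin: "lin \<iota> x' \<noteq> 0" using v_nonzero[OF x] by (simp add: lin_def A B)
  have "x' i \<noteq> 0" if "i \<in> J1" for i
  proof (cases "i = y")
    case False
    then have "i \<notin> {x0, y} \<union> J2" using that J by blast
    then show ?thesis using xX(3)[OF that] other by simp
  qed (simp add: x'v)
  then have "x' \<in> generic_points \<iota>" using x'X uv xX lin by (simp add: generic_points_def)
  moreover have "linked x x'"
    by (rule linked_fibre[OF \<iota> y xX(1) x'X _ xX(4) lin xX(2) v_nonzero[OF x]]) (use other in auto)
  ultimately show ?thesis using x'v other by blast
qed

lemma normalize_free_block:
  assumes \<iota>: "\<iota> ^ 2 = (- 1 :: 'k)" and S: "S \<subseteq> free_block" and x: "x \<in> generic_points \<iota>"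
  shows "\<exists>x'\<in>generic_points \<iota>. linked x x' \<and> (\<forall>i\<in>S. x' i = 1) \<and> (\<forall>i\<in>I - ({x0} \<union> S \<union> J2). x' i = x i)"
proof -
  have "S \<subseteq> J1" using S by (auto simp: free_block_def)
  then have "finite S" using finite_blocks(2) by (rule finite_subset)
  then show ?thesis using S
  proof (induction S)
    case empty
    then show ?case using x linked_refl by (intro bexI[of _ x]) (auto simp: generic_points_def)
  next
    case (insert y S)
    then obtain x1 where x1: "x1 \<in> generic_points \<iota>" "linked x x1" "\<forall>i\<in>S. x1 i = 1"
      "\<forall>i\<in>I - ({x0} \<union> S \<union> J2). x1 i = x i" by auto
    have y: "y \<in> free_block" using insert.prems by simp
    obtain x2 where x2: "x2 \<in> generic_points \<iota>" "linked x1 x2" "x2 y = 1" "\<forall>i\<in>I - ({x0, y} \<union> J2). x2 i = x1 i"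
      using normalize_coordinate[OF \<iota> y x1(1)] by blast
    have "S \<subseteq> I - ({x0, y} \<union> J2)"
      using insert disjoint x0 by (auto simp: free_block_def I_eq)
    then have "x2 i = 1" if "i \<in> S" for i using that x1(3) x2(4) by (metis subsetD)
    then have "\<forall>i\<in>insert y S. x2 i = 1" using x2(3) by simp
    moreover have "\<forall>i\<in>I - ({x0} \<union> insert y S \<union> J2). x2 i = x i" using x1(4) x2(4) by auto
    ultimately show ?case using linked_trans[OF x1(2) x2(2)] x2(1) by blast
  qed
qed

lemma generic_linked:
  assumes \<iota>: "\<iota> ^ 2 = (- 1 :: 'k)" and x: "x \<in> generic_points \<iota>" "x' \<in> generic_points \<iota>"
    and agree: "\<And>i. i \<in> invariant_coordinates \<Longrightarrow> x' i = x i"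
  shows "linked x x'"
proof -
  obtain z where z: "z \<in> generic_points \<iota>" "linked x z" "\<forall>i\<in>free_block. z i = 1"
    "\<forall>i\<in>I - ({x0} \<union> free_block \<union> J2). z i = x i"
    using normalize_free_block[OF \<iota> subset_refl x(1)] by blast
  obtain z' where z': "z' \<in> generic_points \<iota>" "linked x' z'" "\<forall>i\<in>free_block. z' i = 1"
    "\<forall>i\<in>I - ({x0} \<union> free_block \<union> J2). z' i = x' i"
    using normalize_free_block[OF \<iota> subset_refl x(2)] by blast
  have "z' i = z i" if "i \<in> I - ({x0, y0} \<union> J2)" for i
  proof (cases "i \<in> free_block")
    case True
    then show ?thesis using z(3) z'(3) by simp
  next
    case False
    then have "i \<in> invariant_coordinates" using that by (auto simp: invariant_coordinates_def I_eq)
    then show ?thesis using z(4) z'(4) agree that False by simp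
  qed
  then have "linked z z'"
    using z(1) z'(1) by (intro linked_fibre[OF \<iota> y0_free _ _ _ _ _ _ v_nonzero]) (auto simp: generic_points_def)
  then show ?thesis using linked_trans[OF z(2)] linked_sym[OF z'(2)] linked_trans by blast
qed

section \<open>The upper bound for the invariant and the separation of orbits\<close>

definition generic_poly :: "'k \<Rightarrow> ('i \<Rightarrow> 'k) \<Rightarrow> 'k" where
  "generic_poly \<iota> x = u x * mon J1 (\<lambda>_. 1) x * lin \<iota> x"

lemma generic_poly_poly: "generic_poly \<iota> \<in> R"
proof -
  have "u \<in> R" unfolding u_def by (rule mon_poly) (use blocks_subset in auto)
  moreover have "mon J1 (\<lambda>_. 1) \<in> R" by (rule mon_poly[OF blocks_subset(2)])
  moreover have "lin \<iota> \<in> R" unfolding lin_def[abs_def] by (intro subalgebra_gen_intros ABP_poly)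
  ultimately show ?thesis unfolding generic_poly_def[abs_def] by (intro subalgebra_gen_intros)
qed

lemma generic_points_eq: "generic_points \<iota> = {x \<in> X. generic_poly \<iota> x \<noteq> 0}"
  using finite_blocks(2) by (auto simp: generic_points_def generic_poly_def mon_def)

lemma generic_points_nonempty: "\<iota> ^ 2 = (- 1 :: 'k) \<Longrightarrow> generic_points \<iota> \<noteq> {}"
proof -
  assume \<iota>: "\<iota> ^ 2 = - 1"
  obtain q where q: "q \<in> J2" using J2_ne by blast
  obtain x where x: "x \<in> X" "A x = 0" "B x = 1" "x x0 = 0" "x y0 = 1" "\<forall>i\<in>I - {x0, y0, q}. x i = 1"
    using point_exists[of 0 1 "- 1" q] q by auto
  have one: "x i = 1" if "i \<in> J0 - {x0} \<or> i \<in> J1" for i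
    using that x(5,6) q disjoint x0 by (cases "i = y0") (auto simp: I_eq)
  have "u x = 1" unfolding u_def mon_def using one by (intro prod.neutral) simp
  moreover have "lin \<iota> x \<noteq> 0" using \<iota> x(2,3) by (auto simp: lin_def)
  ultimately have "x \<in> generic_points \<iota>" using x(1) one by (auto simp: generic_points_def)
  then show ?thesis by blast
qed

text \<open>The torus of \<open>X\<close> contracts the fibre through a generic point to the point where all coordinates
  other than the invariant ones vanish, so invariant functions are determined by their values there.\<close>

lemma makar_limanov_section:
  assumes \<iota>: "\<iota> ^ 2 = (- 1 :: 'k)" and f: "f \<in> makar_limanov I X" "f = res p" "p \<in> R"
    and x: "x \<in> generic_points \<iota>"
  shows "p x = p (\<lambda>i. if i \<in> invariant_coordinates then x i else 0)"
proof -
  define k where "k = card free_block"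
  define l where "l = (\<Sum>i\<in>J2. \<mu> i)"
  have "finite free_block" using finite_blocks(2) by (simp add: free_block_def)
  then have k: "0 < k" unfolding k_def using y0_free by (auto simp: card_gt_0_iff)
  obtain q where q: "q \<in> J2" using J2_ne by blast
  have "\<mu> q \<le> l" unfolding l_def by (rule member_le_sum[OF q]) (simp_all add: finite_blocks)
  then have l: "0 < l" using \<mu>_ge2[OF q] by simp
  \<comment> \<open>These weights give \<open>A\<close>, \<open>B\<close>, \<open>P\<close> the
    degrees \<open>k * l\<close>, \<open>k * l\<close>, \<open>2 * k * l\<close>: the free block has
    \<open>k\<close> coordinates of exponent one, and the exponents in \<open>J2\<close> add up to
    \<open>l\<close>.\<close>
  define w where "w i = (if i = x0 then k * l else if i \<in> J2 then 2 * k else if i \<in> free_block then l else 0)" for i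
  define \<gamma> where "\<gamma> s = (\<lambda>i\<in>I. s ^ w i * x i)" for s :: 'k
  have J: "x0 \<notin> J1" "x0 \<notin> J2" "J2 \<inter> J0 = {}" "J2 \<inter> J1 = {}" "free_block \<subseteq> J1" "free_block \<inter> J0 = {}"
    using disjoint x0 by (auto simp: free_block_def)
  have mon\<gamma>: "mon S e (\<gamma> s) = s ^ (\<Sum>i\<in>S. w i * e i) * mon S e x" if "S \<subseteq> I" for S e s
    using that by (simp add: mon_def \<gamma>_def power_mult_distrib prod.distrib power_sum power_mult subset_iff)
  have u\<gamma>: "u (\<gamma> s) = u x" for s
  proof -
    have "(\<Sum>i\<in>J0 - {x0}. w i * \<mu> i) = 0" using J by (intro sum.neutral) (auto simp: w_def)
    then show ?thesis unfolding u_def using mon\<gamma>[of "J0 - {x0}" \<mu> s] blocks_subset by auto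
  qed
  have A\<gamma>: "A (\<gamma> s) = s ^ (k * l) * A x" for s
    unfolding A_u u\<gamma> using blocks_subset by (simp add: \<gamma>_def w_def)
  have B\<gamma>: "B (\<gamma> s) = s ^ (k * l) * B x" for s
  proof -
    have "(\<Sum>i\<in>J1. w i * \<mu> i) = (\<Sum>i\<in>free_block. w i * \<mu> i)"
      using J finite_blocks by (intro sum.mono_neutral_right) (auto simp: w_def)
    also have "\<dots> = (\<Sum>i\<in>free_block. l)"
      using J by (intro sum.cong) (auto simp: w_def free_block_def)
    finally show ?thesis using mon\<gamma>[OF blocks_subset(2), of \<mu> s] by (simp add: k_def)
  qed
  have P\<gamma>: "P (\<gamma> s) = s ^ (2 * (k * l)) * P x" for s
  proof -
    have "(\<Sum>i\<in>J2. w i * \<mu> i) = (\<Sum>i\<in>J2. 2 * k * \<mu> i)" using J by (intro sum.cong) (auto simp: w_def)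
    then show ?thesis
      using mon\<gamma>[OF blocks_subset(3), of \<mu> s] by (simp add: l_def sum_distrib_left[symmetric] mult.assoc)
  qed
  have xX: "x \<in> X" using x by (simp add: generic_points_def)
  have \<gamma>X: "\<gamma> s \<in> X" for s
  proof -
    have "F (\<gamma> s) = s ^ (2 * (k * l)) * F x"
      unfolding F_def A\<gamma> B\<gamma> P\<gamma> by (simp add: power_mult[symmetric] algebra_simps)
    then show ?thesis using xX by (auto simp: X_F affine_space_def \<gamma>_def)
  qed
  have generic: "\<gamma> s \<in> generic_points \<iota>" if s: "s \<noteq> 0" for s
  proof -
    have "lin \<iota> (\<gamma> s) = s ^ (k * l) * lin \<iota> x" unfolding lin_def A\<gamma> B\<gamma> by (simp add: algebra_simps)
    moreover have "\<gamma> s i \<noteq> 0" if "i \<in> J1" for i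
      using that s x blocks_subset by (auto simp: \<gamma>_def generic_points_def)
    ultimately show ?thesis using x s \<gamma>X u\<gamma> by (simp add: generic_points_def)
  qed
  have inv: "w i = 0" if "i \<in> invariant_coordinates" for i
    using that J by (auto simp: invariant_coordinates_def w_def)
  have const: "p (\<gamma> s) = p x" if "s \<noteq> 0" for s
  proof -
    have "linked x (\<gamma> s)"
      using inv blocks_subset
      by (intro generic_linked[OF \<iota> x generic[OF that]]) (auto simp: \<gamma>_def invariant_coordinates_def)
    then have "f (\<gamma> s) = f x" by (rule makar_limanov_linked[OF f(1)])
    then show ?thesis using \<gamma>X xX by (simp add: f(2) res_apply)
  qed
  have "\<exists>g. \<forall>s. \<gamma> s i = poly g s" if "i \<in> I" for i
    by (rule exI[of _ "monom (x i) (w i)"]) (simp add: \<gamma>_def that poly_monom)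
  then obtain g where g: "\<And>s. p (\<gamma> s) = poly g s" using subalgebra_gen_poly_curve[OF f(3), of \<gamma>] by blast
  \<comment> \<open>The limit point at \<open>s = 0\<close> is not generic; the value there comes
    from polynomial dependence on \<open>s\<close>.\<close>
  have "g = [:p x:]" by (rule poly_eqI_cofinite) (simp add: g[symmetric] const)
  then have "p (\<gamma> 0) = p x" by (simp add: g)
  moreover have "p (\<gamma> 0) = p (\<lambda>i. if i \<in> invariant_coordinates then x i else 0)"
  proof (rule subalgebra_gen_cong_point[OF f(3)])
    fix i assume i: "i \<in> I"
    show "\<gamma> 0 i = (if i \<in> invariant_coordinates then x i else 0)"
    proof (cases "i \<in> invariant_coordinates")
      case True
      then show ?thesis using i inv by (simp add: \<gamma>_def)
    next
      case False
      then have "0 < w i" using i k l by (auto simp: invariant_coordinates_def w_def I_eq)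
      then show ?thesis using False i by (simp add: \<gamma>_def)
    qed
  qed
  ultimately show ?thesis by simp
qed

text \<open>\<open>makar_limanov_section\<close> holds on the nonvanishing locus of a polynomial;
  since K[X] has no zero divisors, it extends to all of \<open>X\<close>.\<close>

lemma makar_limanov_subset: "makar_limanov I X \<subseteq> coordinate_subring X invariant_coordinates"
proof
  fix f assume f: "f \<in> makar_limanov I X"
  then have "f \<in> KX" by (simp add: makar_limanov_def)
  then obtain p where p: "p \<in> R" "f = res p" by (auto simp: KX_res)
  obtain \<iota> :: 'k where \<iota>: "\<iota> ^ 2 = - 1" using nth_root_exists[of 2 "-1"] by auto
  define \<sigma> where "\<sigma> x = (\<lambda>i. if i \<in> invariant_coordinates then x i else (0::'k))" for x
  have p\<sigma>: "(\<lambda>x. p (\<sigma> x)) \<in> subalgebra_gen (coordinates J)" if "invariant_coordinates \<subseteq> J" for J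
  proof (rule subalgebra_gen_subst[OF p(1)])
    show "(\<lambda>x. \<sigma> x i) \<in> subalgebra_gen (coordinates J)" for i
      using that subalgebra_gen.const[of 0] subalgebra_gen_coordinate[of i J]
      by (cases "i \<in> invariant_coordinates") (auto simp: \<sigma>_def)
  qed
  have sub: "invariant_coordinates \<subseteq> I" using blocks_subset by (auto simp: invariant_coordinates_def)
  have "(\<lambda>x. p x - p (\<sigma> x)) \<in> R" by (intro subalgebra_gen_diff p p\<sigma> sub)
  then have "(\<forall>x\<in>X. p x - p (\<sigma> x) = 0) \<or> (\<forall>x\<in>X. generic_poly \<iota> x = 0)"
  proof (rule no_zero_divisors_X[OF _ generic_poly_poly])
    fix x assume x: "x \<in> X"
    show "(p x - p (\<sigma> x)) * generic_poly \<iota> x = 0"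
    proof (cases "generic_poly \<iota> x = 0")
      case False
      then have "x \<in> generic_points \<iota>" using x by (simp add: generic_points_eq)
      then show ?thesis using makar_limanov_section[OF \<iota> f p(2,1)] by (simp add: \<sigma>_def)
    qed simp
  qed
  moreover have "\<not> (\<forall>x\<in>X. generic_poly \<iota> x = 0)"
    using generic_points_nonempty[OF \<iota>] by (auto simp: generic_points_eq)
  ultimately have "f = (\<lambda>x. if x \<in> X then p (\<sigma> x) else 0)" by (auto simp: p(2) res_def)
  then show "f \<in> coordinate_subring X invariant_coordinates"
    using p\<sigma>[OF subset_refl] by (auto simp: coordinate_subring_def)
qed

text \<open>\<open>generic_points\<close> need not be stable under \<open>SAut\<close>;
  \<open>U\<close> is its saturation, the union of the nonvanishing loci of all pullbacks of
  \<open>generic_poly\<close>, hence open.\<close>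

lemma separated_generic_orbits:
  assumes "\<And>i. i \<in> invariant_coordinates \<Longrightarrow> T i \<in> makar_limanov I X"
  shows "generic_orbits_separated I X"
proof -
  obtain \<iota> :: 'k where \<iota>: "\<iota> ^ 2 = - 1" using nth_root_exists[of 2 "-1"] by auto
  define U where "U = {x \<in> X. \<exists>z\<in>generic_points \<iota>. linked x z}"
  have "zariski_open I X U"
    unfolding zariski_open_def
  proof (intro conjI exI)
    show "U \<subseteq> X" by (auto simp: U_def)
    let ?F = "(\<lambda>\<alpha>. res (\<lambda>x. generic_poly \<iota> (\<alpha> x))) ` SAut I X"
    show "?F \<subseteq> KX"
    proof
      fix f assume "f \<in> ?F"
      then obtain \<alpha> where \<alpha>: "\<alpha> \<in> SAut I X" "f = res (\<lambda>x. generic_poly \<iota> (\<alpha> x))" by blast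
      have "polynomial_map_on X (coordinates I) I \<alpha>"
        using SAut_automorphisms[OF \<alpha>(1)] by (simp add: automorphisms_def)
      then obtain g where g: "g \<in> R" "\<forall>x\<in>X. generic_poly \<iota> (\<alpha> x) = g x"
        using polynomial_map_pullback[OF _ generic_poly_poly] by blast
      then have "f = res g" by (auto simp: \<alpha>(2) res_eq_iff)
      then show "f \<in> KX" using res_in_KX[OF g(1)] by simp
    qed
    have "x \<in> U \<longleftrightarrow> (\<exists>\<alpha>\<in>SAut I X. generic_poly \<iota> (\<alpha> x) \<noteq> 0)" if "x \<in> X" for x
      using that SAut_mem[OF _ that] by (auto simp: U_def generic_points_eq linked_def)
    then show "X - U = {x \<in> X. \<forall>f\<in>?F. f x = 0}" by (auto simp: res_apply)
  qed
  moreover have "U \<noteq> {}"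
    using generic_points_nonempty[OF \<iota>] linked_refl by (force simp: U_def generic_points_def)
  moreover have "\<alpha> ` U = U" if \<alpha>: "\<alpha> \<in> SAut I X" for \<alpha>
  proof -
    have inU: "z \<in> U" if "x \<in> U" "linked x z" for x z
      using that linked_X linked_sym linked_trans unfolding U_def by blast
    have link: "linked x (\<alpha> x)" if "x \<in> X" for x using \<alpha> that by (auto simp: linked_def)
    have "bij_betw \<alpha> X X" using automorphisms_Bij[OF SAut_automorphisms[OF \<alpha>]] by (simp add: Bij_def)
    then have surj: "\<alpha> ` X = X" by (simp add: bij_betw_def)
    show ?thesis
    proof
      show "\<alpha> ` U \<subseteq> U"
      proof
        fix z assume "z \<in> \<alpha> ` U"
        then obtain x where x: "x \<in> U" "z = \<alpha> x" by blast
        then have "x \<in> X" by (simp add: U_def)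
        show "z \<in> U" unfolding x(2) by (rule inU[OF x(1) link[OF \<open>x \<in> X\<close>]])
      qed
      show "U \<subseteq> \<alpha> ` U"
      proof
        fix z assume z: "z \<in> U"
        then have "z \<in> \<alpha> ` X" using surj by (simp add: U_def)
        then obtain x where x: "x \<in> X" "z = \<alpha> x" by blast
        then have "x \<in> U" using inU[OF z linked_sym[OF link[OF x(1)], folded x(2)]] by simp
        then show "z \<in> \<alpha> ` U" using x by blast
      qed
    qed
  qed
  moreover have "\<exists>f\<in>makar_limanov I X. f S \<noteq> f Q"
    if "S \<in> U" "Q \<in> U" "SAut_orbit I X S \<noteq> SAut_orbit I X Q" for S Q
  proof (rule ccontr)
    assume neg: "\<not> ?thesis"
    obtain S' where S': "S' \<in> generic_points \<iota>" "linked S S'" using \<open>S \<in> U\<close> by (auto simp: U_def)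
    obtain Q' where Q': "Q' \<in> generic_points \<iota>" "linked Q Q'" using \<open>Q \<in> U\<close> by (auto simp: U_def)
    have "Q' i = S' i" if "i \<in> invariant_coordinates" for i
    proof -
      have "T i S' = T i Q'"
        using neg assms[OF that] makar_limanov_linked[OF assms[OF that] S'(2)]
          makar_limanov_linked[OF assms[OF that] Q'(2)] by auto
      then show ?thesis using S'(1) Q'(1) by (simp add: generic_points_def T_def res_apply)
    qed
    then have "linked S' Q'" by (rule generic_linked[OF \<iota> S'(1) Q'(1)])
    then have "linked S Q" using linked_trans[OF S'(2)] linked_trans linked_sym[OF Q'(2)] by blast
    then show False using linked_orbit that(3) by blast
  qed
  ultimately show ?thesis unfolding generic_orbits_separated_def by blast
qed

lemma subring_makar_limanov:
  assumes Z: "Z \<subseteq> I" and kill: "\<And>D i. locally_nilpotent_derivation KX D \<Longrightarrow> i \<in> Z \<Longrightarrow> D (T i) = 0"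
  shows "coordinate_subring X Z \<subseteq> makar_limanov I X"
proof
  fix f assume "f \<in> coordinate_subring X Z"
  then obtain p where p: "p \<in> subalgebra_gen (coordinates Z)" "f = res p"
    by (auto simp: coordinate_subring_def res_def)
  have R: "p \<in> R" if "p \<in> subalgebra_gen (coordinates Z)" for p
    using that subalgebra_gen_mono[OF coordinates_mono[OF Z]] by blast
  have "D f = (\<lambda>_. 0)" if D: "locally_nilpotent_derivation KX D" for D
  proof -
    interpret D: trinomial_lnd J0 J1 J2 \<mu> x0 y0 X I D
      by unfold_locales (rule D)
    have "D (res p) = 0" using p(1)
    proof induction
      case (const c)
      show ?case by (rule D.D_const)
    next
      case (gen g)
      then show ?case using kill[OF D] by (auto simp: coordinates_def T_def)
    next
      case (add g h)
      then show ?case using D.D_add[OF res_in_KX[OF R] res_in_KX[OF R], of g h] by (simp add: res_add)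
    next
      case (mult g h)
      then show ?case using D.D_mult[OF res_in_KX[OF R] res_in_KX[OF R], of g h] by (simp add: res_mult)
    qed
    then show ?thesis by (simp add: p(2) zero_fun_def)
  qed
  then show "f \<in> makar_limanov I X"
    using res_in_KX[OF R[OF p(1)]] by (simp add: makar_limanov_def p(2))
qed

end

section \<open>The trinomial of the theorem\<close>

lemma mon_const_index: "mon ({c} \<times> S) e T = (\<Prod>j\<in>S. T (c, j) ^ e (c, j))"
proof -
  have "{c} \<times> S = Pair c ` S" by auto
  then show ?thesis by (simp add: mon_def prod.reindex inj_on_def)
qed

lemma atLeast_split: "1 \<le> n \<Longrightarrow> {1..n} = insert 1 {2..n::nat}"
  by auto

theorem proposition3:
  fixes n\<^sub>0 n\<^sub>1 n\<^sub>2 k\<^sub>1 :: nat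
    and m\<^sub>0 m\<^sub>1 l\<^sub>2 :: "nat \<Rightarrow> nat"
    and I :: "(nat \<times> nat) set"
    and X :: "(nat \<times> nat \<Rightarrow> 'k :: {alg_closed_field, field_char_0}) set"
  assumes "n\<^sub>0 \<ge> 2" and "1 \<le> k\<^sub>1" and "k\<^sub>1 \<le> n\<^sub>1" and "n\<^sub>2 \<ge> 1"
    and "\<forall>j\<in>{2..n\<^sub>0}. m\<^sub>0 j \<ge> 2"
    and "\<forall>j\<in>{k\<^sub>1+1..n\<^sub>1}. m\<^sub>1 j \<ge> 2"
    and "\<forall>j\<in>{1..n\<^sub>2}. l\<^sub>2 j \<ge> 2"
    and "\<not> ((\<forall>j\<in>{1..n\<^sub>2}. even (l\<^sub>2 j)) \<and> (\<exists>j\<in>{1..n\<^sub>2}. l\<^sub>2 j = 2))"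
    and "I = {0} \<times> {1..n\<^sub>0} \<union> {1} \<times> {1..n\<^sub>1} \<union> {2} \<times> {1..n\<^sub>2}"
    and "X = zero_locus I (\<lambda>T.
           T (0, 1) ^ 2 * (\<Prod>j=2..n\<^sub>0. T (0, j) ^ (2 * m\<^sub>0 j))
         + (\<Prod>j=1..k\<^sub>1. T (1, j) ^ 2) * (\<Prod>j=k\<^sub>1+1..n\<^sub>1. T (1, j) ^ (2 * m\<^sub>1 j))
         + (\<Prod>j=1..n\<^sub>2. T (2, j) ^ l\<^sub>2 j))"
  shows "coordinate_subring X ({0} \<times> {2..n\<^sub>0}) \<subseteq> makar_limanov I X
    \<and> (k\<^sub>1 = 1 \<longrightarrow>
         makar_limanov I X = coordinate_subring X ({0} \<times> {2..n\<^sub>0} \<union> {1} \<times> {2..n\<^sub>1})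
         \<and> generic_orbits_separated I X)
    \<and> (k\<^sub>1 = n\<^sub>1 \<longrightarrow>
         makar_limanov I X = coordinate_subring X ({0} \<times> {2..n\<^sub>0})
         \<and> generic_orbits_separated I X)"
proof -
  define \<mu> :: "nat \<times> nat \<Rightarrow> nat" where "\<mu> = (\<lambda>(i, j). if i = 0 then (if j = 1 then 1 else m\<^sub>0 j)
    else if i = 1 then (if j \<le> k\<^sub>1 then 1 else m\<^sub>1 j) else l\<^sub>2 j)"
  let ?J0 = "{0::nat} \<times> {1..n\<^sub>0}" and ?J1 = "{1::nat} \<times> {1..n\<^sub>1}" and ?J2 = "{2::nat} \<times> {1..n\<^sub>2}"
  have A: "mon ?J0 \<mu> T ^ 2 = T (0, 1) ^ 2 * (\<Prod>j=2..n\<^sub>0. T (0, j) ^ (2 * m\<^sub>0 j))" for T :: "nat \<times> nat \<Rightarrow> 'k"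
  proof -
    have "mon ?J0 \<mu> T = T (0, 1) * (\<Prod>j=2..n\<^sub>0. T (0, j) ^ m\<^sub>0 j)"
      unfolding mon_const_index using assms(1) atLeast_split[of n\<^sub>0] by (simp add: \<mu>_def)
    then show ?thesis by (simp add: power_mult_distrib prod_power_distrib power_mult[symmetric] mult.commute)
  qed
  have B: "mon ?J1 \<mu> T ^ 2 = (\<Prod>j=1..k\<^sub>1. T (1, j) ^ 2) * (\<Prod>j=k\<^sub>1+1..n\<^sub>1. T (1, j) ^ (2 * m\<^sub>1 j))"
    for T :: "nat \<times> nat \<Rightarrow> 'k"
  proof -
    have "{1..n\<^sub>1} = {1..k\<^sub>1} \<union> {k\<^sub>1+1..n\<^sub>1}" using assms(2,3) by auto
    then have "mon ?J1 \<mu> T = (\<Prod>j\<in>{1..k\<^sub>1} \<union> {k\<^sub>1+1..n\<^sub>1}. T (1, j) ^ \<mu> (1, j))"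
      by (simp add: mon_const_index)
    also have "\<dots> = (\<Prod>j=1..k\<^sub>1. T (1, j) ^ \<mu> (1, j)) * (\<Prod>j=k\<^sub>1+1..n\<^sub>1. T (1, j) ^ \<mu> (1, j))"
      by (rule prod.union_disjoint) auto
    also have "\<dots> = (\<Prod>j=1..k\<^sub>1. T (1, j)) * (\<Prod>j=k\<^sub>1+1..n\<^sub>1. T (1, j) ^ m\<^sub>1 j)"
      by (intro arg_cong2[where f = "(*)"] prod.cong) (auto simp: \<mu>_def)
    finally show ?thesis by (simp add: power_mult_distrib prod_power_distrib power_mult[symmetric] mult.commute)
  qed
  have P: "mon ?J2 \<mu> T = (\<Prod>j=1..n\<^sub>2. T (2, j) ^ l\<^sub>2 j)" for T :: "nat \<times> nat \<Rightarrow> 'k"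
    by (simp add: mon_const_index \<mu>_def)
  \<comment> \<open>If no \<open>l\<^sub>2 j\<close> is odd, the hypothesis excludes the value 2,
    and the next even value is 4.\<close>
  have J2_cond: "(\<forall>i\<in>?J2. 4 \<le> \<mu> i) \<or> (\<exists>i\<in>?J2. odd (\<mu> i))"
  proof (rule ccontr)
    assume "\<not> ?thesis"
    then obtain j where even: "\<forall>j\<in>{1..n\<^sub>2}. even (l\<^sub>2 j)" and j: "j \<in> {1..n\<^sub>2}" "l\<^sub>2 j < 4"
      by (auto simp: \<mu>_def)
    have "even (l\<^sub>2 j)" using even j(1) by blast
    moreover have "2 \<le> l\<^sub>2 j" using assms(7) j(1) by blast
    moreover have "l\<^sub>2 j \<noteq> 2" using assms(8) even j(1) by blast
    ultimately have "l\<^sub>2 j = 3" "even (l\<^sub>2 j)" using j(2) by auto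
    then show False by simp
  qed
  have \<mu>0: "1 \<le> \<mu> (0, j)" "j \<noteq> 1 \<Longrightarrow> 2 \<le> \<mu> (0, j)" if "j \<in> {1..n\<^sub>0}" for j
  proof -
    have "j \<noteq> 1 \<Longrightarrow> j \<in> {2..n\<^sub>0}" using that by auto
    then have "j \<noteq> 1 \<Longrightarrow> 2 \<le> m\<^sub>0 j" using assms(5) by blast
    then show "1 \<le> \<mu> (0, j)" "j \<noteq> 1 \<Longrightarrow> 2 \<le> \<mu> (0, j)" by (cases "j = 1"; simp add: \<mu>_def)+
  qed
  have \<mu>1: "1 \<le> \<mu> (1, j)" "\<mu> (1, j) = 1 \<longleftrightarrow> j \<le> k\<^sub>1" if "j \<in> {1..n\<^sub>1}" for j
  proof -
    have "\<not> j \<le> k\<^sub>1 \<Longrightarrow> j \<in> {k\<^sub>1+1..n\<^sub>1}" using that by auto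
    then have "\<not> j \<le> k\<^sub>1 \<Longrightarrow> 2 \<le> m\<^sub>1 j" using assms(6) by blast
    then show "1 \<le> \<mu> (1, j)" "\<mu> (1, j) = 1 \<longleftrightarrow> j \<le> k\<^sub>1" by (cases "j \<le> k\<^sub>1"; simp add: \<mu>_def)+
  qed
  interpret t: trinomial ?J0 ?J1 ?J2 \<mu> "(0, 1)" "(1, 1)" X I
  proof
    show "(0, 1) \<in> ?J0" "(1, 1) \<in> ?J1" "?J2 \<noteq> {}" using assms(1-4) by auto
    show "1 \<le> \<mu> i" if "i \<in> ?J0 \<union> ?J1" for i using that \<mu>0 \<mu>1 by auto
    show "2 \<le> \<mu> i" if "i \<in> ?J2" for i using that assms(7) by (auto simp: \<mu>_def)
    show "X = zero_locus I (\<lambda>x. mon ?J0 \<mu> x ^ 2 + mon ?J1 \<mu> x ^ 2 + mon ?J2 \<mu> x)"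
      unfolding A B P by (rule assms(10))
  qed (use assms(2,9) in \<open>auto simp: \<mu>_def\<close>)
  have inv: "t.invariant_coordinates = {0} \<times> {2..n\<^sub>0} \<union> {1} \<times> {k\<^sub>1+1..n\<^sub>1}"
  proof -
    have "?J1 - t.free_block = {1} \<times> {k\<^sub>1+1..n\<^sub>1}"
      unfolding t.free_block_def using \<mu>1(2) by auto
    moreover have "?J0 - {(0, 1)} = {0} \<times> {2..n\<^sub>0}" by auto
    ultimately show ?thesis by (simp only: t.invariant_coordinates_def)
  qed
  have sub: "t.invariant_coordinates \<subseteq> I"
    unfolding inv assms(9) using assms(2) by auto
  have kill0: "D (t.T i) = 0"
    if "locally_nilpotent_derivation (coordinate_subring X I) D" "i \<in> {0} \<times> {2..n\<^sub>0}" for D i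
  proof (rule t.lnd_kills_coordinate[OF that(1) _ J2_cond])
    show "i \<in> ?J0 - {(0, 1)}" using that(2) by auto
    show "2 \<le> \<mu> i" if "i \<in> ?J0 - {(0, 1)}" for i
    proof -
      obtain j where j: "i = (0, j)" "j \<in> {1..n\<^sub>0}" using \<open>i \<in> ?J0 - {(0, 1)}\<close> by blast
        have "j \<noteq> 1" using \<open>i \<in> ?J0 - {(0, 1)}\<close> j(1) by simp
      show ?thesis unfolding j(1) by (rule \<mu>0(2)[OF j(2) \<open>j \<noteq> 1\<close>])
    qed
  qed
  have ML0: "coordinate_subring X ({0} \<times> {2..n\<^sub>0}) \<subseteq> makar_limanov I X"
  proof (rule t.subring_makar_limanov)
    show "{0} \<times> {2..n\<^sub>0} \<subseteq> I" by (auto simp: assms(9))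
    fix D and i :: "nat \<times> nat"
    assume "locally_nilpotent_derivation (coordinate_subring X I) D" "i \<in> {0} \<times> {2..n\<^sub>0}"
    then show "D (t.T i) = 0" by (rule kill0[of D i])
  qed
  have sufficient: "makar_limanov I X = coordinate_subring X t.invariant_coordinates \<and> generic_orbits_separated I X"
    if "coordinate_subring X t.invariant_coordinates \<subseteq> makar_limanov I X"
  proof
    show "makar_limanov I X = coordinate_subring X t.invariant_coordinates"
      using that t.makar_limanov_subset by blast
    have "t.T i \<in> coordinate_subring X t.invariant_coordinates" if "i \<in> t.invariant_coordinates" for i
      using subalgebra_gen_coordinate[OF that] by (auto simp: coordinate_subring_def t.T_def t.res_def)
    then show "generic_orbits_separated I X"
      using that by (intro t.separated_generic_orbits) blast
  qed
  have "makar_limanov I X = coordinate_subring X ({0} \<times> {2..n\<^sub>0} \<union> {1} \<times> {2..n\<^sub>1}) \<and> generic_orbits_separated I X"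
    if k1: "k\<^sub>1 = 1"
  proof -
    \<comment> \<open>With \<open>k\<^sub>1 = 1\<close> block 1 also has just one coordinate with
      \<open>\<mu> = 1\<close>, so the two blocks can be exchanged; \<open>X\<close> and the
      coordinate functions stay the same.\<close>
    interpret s: trinomial ?J1 ?J0 ?J2 \<mu> "(1, 1)" "(0, 1)" X I
    proof
      show "(0, 1) \<in> ?J0" "(1, 1) \<in> ?J1" "?J2 \<noteq> {}" using assms(1-4) by auto
      show "1 \<le> \<mu> i" if "i \<in> ?J1 \<union> ?J0" for i using that t.\<mu>_pos by blast
      show "2 \<le> \<mu> i" if "i \<in> ?J2" for i using that t.\<mu>_ge2 by blast
      show "X = zero_locus I (\<lambda>x. mon ?J1 \<mu> x ^ 2 + mon ?J0 \<mu> x ^ 2 + mon ?J2 \<mu> x)"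
        unfolding add.commute[of "mon ?J1 \<mu> _ ^ 2"] by (rule t.X_eq)
    qed (use assms(2,9) in \<open>auto simp: \<mu>_def\<close>)
    have two: "k\<^sub>1 + 1 = 2" using k1 by simp
    have kill: "D (t.T i) = 0"
      if D: "locally_nilpotent_derivation (coordinate_subring X I) D" and i: "i \<in> t.invariant_coordinates" for D i
    proof (cases "i \<in> {0} \<times> {2..n\<^sub>0}")
      case True
      then show ?thesis by (rule kill0[of D i, OF D])
    next
      case False
      then have i: "i \<in> {1} \<times> {2..n\<^sub>1}" using i unfolding inv two by blast
      show ?thesis
      proof (rule s.lnd_kills_coordinate[OF D _ J2_cond])
        show "i \<in> ?J1 - {(1, 1)}" using i by auto
        show "2 \<le> \<mu> i" if "i \<in> ?J1 - {(1, 1)}" for i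
        proof -
          obtain j where j: "i = (1, j)" "j \<in> {1..n\<^sub>1}" using \<open>i \<in> ?J1 - {(1, 1)}\<close> by blast
          have "j \<noteq> 1" using \<open>i \<in> ?J1 - {(1, 1)}\<close> j(1) by simp
          then have "1 \<le> \<mu> (1, j)" "\<mu> (1, j) \<noteq> 1" using \<mu>1[OF j(2)] j(2) k1 by auto
          then show ?thesis unfolding j(1) by linarith
        qed
      qed
    qed
    have "coordinate_subring X t.invariant_coordinates \<subseteq> makar_limanov I X"
    proof (rule t.subring_makar_limanov)
      show "t.invariant_coordinates \<subseteq> I" by (rule sub)
      fix D i assume "locally_nilpotent_derivation (coordinate_subring X I) D" "i \<in> t.invariant_coordinates"
      then show "D (t.T i) = 0" by (rule kill[of D i])
    qed
    from sufficient[OF this] show ?thesis unfolding inv two .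
  qed
  moreover have "makar_limanov I X = coordinate_subring X ({0} \<times> {2..n\<^sub>0}) \<and> generic_orbits_separated I X"
    if k1: "k\<^sub>1 = n\<^sub>1"
  proof -
    have "{k\<^sub>1+1..n\<^sub>1} = {}" using k1 by simp
    then have "t.invariant_coordinates = {0} \<times> {2..n\<^sub>0}" unfolding inv by simp
    then show ?thesis using sufficient ML0 by (simp only:)
  qed
  ultimately show ?thesis using ML0 by blast
qed

end
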